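(* Let $\mathbb{H}^n$ be the Heisenberg group and let $\pi:\mathbb{H}^n\to\mathbb{R}^{2n}$ be the projection onto the first $2n$ coordinates. Assume that a set $E\subset\mathbb{H}^n$ is countably $k$-rectifiable for some $k\leq n$. Then for any Borel function $g:E\to[0,\infty]$ we have $$\int_{E}g(x)\,d\mathcal{H}^k_{cc}(x)=\int_{\pi(E)}\Big(\sum_{x\in\pi^{-1}(y)\cap E}g(x)\Big)\,d\mathcal{H}^k(y).$$
   Context: Heisenberg group: for a positive integer $n$, $\mathbb{H}^n=\mathbb{R}^n\times\mathbb{R}^n\times\mathbb{R}=\mathbb{R}^{2n+1}$ with group law $$(x,y,t)*(x',y',t')=\Big(x+x',\,y+y',\,t+t'+2\sum_{j=1}^n(y_jx_j'-x_jy_j')\Big).$$ A basis of left invariant vector fields is $X_j=\partial_{x_j}+2y_j\partial_t$, $Y_j=\partial_{y_j}-2x_j\partial_t$ ($j=1,\dots,n$), $T=\partial_t$; $\mathbb{H}^n$ carries the left invariant Riemannian metric for which these fields are orthonormal. The horizontal distribution is $H_p\mathbb{H}^n=\operatorname{span}\{X_1(p),Y_1(p),\dots,X_n(p),Y_n(p)\}$. A Lipschitz curve $\gamma:[a,b]\to\mathbb{R}^{2n+1}$ is horizontal if $\gamma'(t)\in H_{\gamma(t)}\mathbb{H}^n$ for a.e. $t$. The Carnot–Carathéodory distance $d_{cc}$ between two points is the infimum of the lengths (with respect to the Riemannian metric) of horizontal curves connecting them; $\mathbb{H}^n$ is always regarded as the metric space $(\mathbb{H}^n,d_{cc})$. The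 projection is $\pi(x,y,t)=(x,y)$. Rectifiability: a subset $E$ of a metric space $X$ is countably $k$-rectifiable if there is a countable family of Lipschitz mappings $f_i:\mathbb{R}^k\supset E_i\to E$, $i=1,2,\dots$, defined on measurable sets $E_i\subset\mathbb{R}^k$, such that $\mathcal{H}^k(E\setminus\bigcup_{i=1}^\infty f_i(E_i))=0$. (For $E\subset\mathbb{H}^n$ both the Lipschitz condition and $\mathcal{H}^k$ are taken with respect to $d_{cc}$.) $\mathcal{H}^k_{cc}$ is the $k$-dimensional Hausdorff measure on $\mathbb{H}^n$ with respect to $d_{cc}$ and $\mathcal{H}^k$ is the Hausdorff measure on Euclidean $\mathbb{R}^{2n}$, both with the normalization $\mathcal{H}^k(A)=\lim_{\delta\to0^+}\inf\sum_i\frac{\omega_k}{2^k}(\operatorname{diam}A_i)^k$ (infimum over countable coverings of $A$ by sets of diameter $\le\delta$; $\omega_k$ is the volume of the unit ball in $\mathbb{R}^k$). *)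

theory Defs
  imports "HOL-Analysis.Analysis"
begin

section \<open>Hausdorff measure and rectifiability for a distance function\<close>

text \<open>
  The Heisenberg group is carried by a product type whose type class metric is the Euclidean
  one. The metric notions below therefore take the distance function \<open>d\<close> on the whole type as
  a parameter.
\<close>

definition ediam :: "('a \<Rightarrow> 'a \<Rightarrow> real) \<Rightarrow> 'a set \<Rightarrow> ennreal" where
  "ediam d A = (SUP x\<in>A. SUP y\<in>A. ennreal (d x y))"

text \<open>
  Families indexed by \<open>nat\<close> with possibly empty members represent all countable coverings; the
  case distinction only matters for \<open>k = 0\<close>, where \<open>0 ^ 0 = 1\<close>.
\<close>

definition hausdorff_pre :: "('a \<Rightarrow> 'a \<Rightarrow> real) \<Rightarrow> nat \<Rightarrow> real \<Rightarrow> 'a set \<Rightarrow> ennreal" where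
  "hausdorff_pre d k \<delta> A =
     (INF S\<in>{S :: nat \<Rightarrow> 'a set. A \<subseteq> (\<Union>i. S i) \<and> (\<forall>i. ediam d (S i) \<le> ennreal \<delta>)}.
        \<Sum>i. if S i = {} then 0
            else ennreal (unit_ball_vol (real k) / 2 ^ k) * ediam d (S i) ^ k)"

definition hausdorff_outer :: "('a \<Rightarrow> 'a \<Rightarrow> real) \<Rightarrow> nat \<Rightarrow> 'a set \<Rightarrow> ennreal" where
  "hausdorff_outer d k A = Lim (at_right 0) (\<lambda>\<delta>. hausdorff_pre d k \<delta> A)"

text \<open>The restriction of the outer measure to the Caratheodory measurable sets.\<close>

definition hausdorff_measure :: "('a \<Rightarrow> 'a \<Rightarrow> real) \<Rightarrow> nat \<Rightarrow> 'a measure" where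
  "hausdorff_measure d k =
     measure_of UNIV (lambda_system UNIV UNIV (hausdorff_outer d k)) (hausdorff_outer d k)"

definition dist_borel :: "('a \<Rightarrow> 'a \<Rightarrow> real) \<Rightarrow> 'a measure" where
  "dist_borel d = sigma UNIV {U. openin (Metric_space.mtopology UNIV d) U}"

definition countably_rectifiable ::
    "'k::finite itself \<Rightarrow> ('a \<Rightarrow> 'a \<Rightarrow> real) \<Rightarrow> 'a set \<Rightarrow> bool" where
  "countably_rectifiable _ d E \<longleftrightarrow>
     (\<exists>(A :: nat \<Rightarrow> (real^'k) set) (f :: nat \<Rightarrow> real^'k \<Rightarrow> 'a).
        (\<forall>i. A i \<in> sets lebesgue \<and> f i ` A i \<subseteq> E \<and>
             (\<exists>L. \<forall>u\<in>A i. \<forall>v\<in>A i. d (f i u) (f i v) \<le> L * dist u v)) \<and>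
        hausdorff_outer d CARD('k) (E - (\<Union>i. f i ` A i)) = 0)"

lemma hausdorff_pre_antimono:
  "\<delta> \<le> \<epsilon> \<Longrightarrow> hausdorff_pre d k \<epsilon> A \<le> hausdorff_pre d k \<delta> A"
  unfolding hausdorff_pre_def
  by (intro INF_superset_mono) (auto intro: order_trans ennreal_leI)

lemma hausdorff_outer_eq_SUP:
  "hausdorff_outer d k A = (SUP \<delta>\<in>{0<..}. hausdorff_pre d k \<delta> A)"
proof -
  let ?s = "SUP \<delta>\<in>{0<..}. hausdorff_pre d k \<delta> A"
  have "((\<lambda>\<delta>. hausdorff_pre d k \<delta> A) \<longlongrightarrow> ?s) (at_right 0)"
  proof (rule order_tendstoI)
    fix a assume "a < ?s"
    then obtain \<delta> where \<delta>: "\<delta> > 0" "a < hausdorff_pre d k \<delta> A"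
      by (auto simp: less_SUP_iff)
    show "\<forall>\<^sub>F x in at_right 0. a < hausdorff_pre d k x A"
      using eventually_at_right_less[of "0::real"] eventually_at_right_real[OF \<delta>(1)]
      by eventually_elim (meson \<delta>(2) greaterThanLessThan_iff hausdorff_pre_antimono less_imp_le less_le_trans)
  next
    fix a assume a: "?s < a"
    show "\<forall>\<^sub>F x in at_right 0. hausdorff_pre d k x A < a"
      using eventually_at_right_less[of "0::real"]
      by eventually_elim (auto intro: le_less_trans[OF SUP_upper a])
  qed
  then show ?thesis
    unfolding hausdorff_outer_def by (intro tendsto_Lim) auto
qed


section \<open>The Heisenberg group with the Carnot-Caratheodory distance\<close>

type_synonym 'n heis = "(real^'n) \<times> (real^'n) \<times> real"

definition heis_mult :: "'n::finite heis \<Rightarrow> 'n heis \<Rightarrow> 'n heis" where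
  "heis_mult = (\<lambda>(x, y, t) (x', y', t').
     (x + x', y + y', t + t' + 2 * (\<Sum>j\<in>UNIV. y $ j * x' $ j - x $ j * y' $ j)))"

definition heis_X :: "'n::finite \<Rightarrow> 'n heis \<Rightarrow> 'n heis" where
  "heis_X j = (\<lambda>(x, y, t). (axis j 1, 0, 2 * y $ j))"

definition heis_Y :: "'n::finite \<Rightarrow> 'n heis \<Rightarrow> 'n heis" where
  "heis_Y j = (\<lambda>(x, y, t). (0, axis j 1, - 2 * x $ j))"

definition heis_T :: "'n::finite heis \<Rightarrow> 'n heis" where
  "heis_T p = (0, 0, 1)"

definition horizontal_space :: "'n::finite heis \<Rightarrow> 'n heis set" where
  "horizontal_space p = span (range (\<lambda>j. heis_X j p) \<union> range (\<lambda>j. heis_Y j p))"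

text \<open>
  The linear isomorphism from \<open>\<real>\<^sup>2\<^sup>n\<^sup>+\<^sup>1\<close> to the tangent space at \<open>p\<close> given by the frame of left
  invariant fields. Transporting the standard inner product along it gives the Riemannian metric
  for which the frame is orthonormal.
\<close>

definition heis_frame :: "'n::finite heis \<Rightarrow> 'n heis \<Rightarrow> 'n heis" where
  "heis_frame p = (\<lambda>(a, b, c).
     (\<Sum>j\<in>UNIV. a $ j *\<^sub>R heis_X j p) + (\<Sum>j\<in>UNIV. b $ j *\<^sub>R heis_Y j p) + c *\<^sub>R heis_T p)"

definition heis_metric :: "'n::finite heis \<Rightarrow> 'n heis \<Rightarrow> 'n heis \<Rightarrow> real" where
  "heis_metric p v w = inv (heis_frame p) v \<bullet> inv (heis_frame p) w"

definition heis_length :: "real \<Rightarrow> real \<Rightarrow> (real \<Rightarrow> 'n::finite heis) \<Rightarrow> real" where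
  "heis_length a b \<gamma> =
     integral {a..b} (\<lambda>s. let v = vector_derivative \<gamma> (at s within {a..b})
                          in sqrt (heis_metric (\<gamma> s) v v))"

definition horizontal_curve :: "real \<Rightarrow> real \<Rightarrow> (real \<Rightarrow> 'n::finite heis) \<Rightarrow> bool" where
  "horizontal_curve a b \<gamma> \<longleftrightarrow>
     (\<exists>L. L-lipschitz_on {a..b} \<gamma>) \<and>
     (AE s in lebesgue_on {a..b}.
        \<exists>v\<in>horizontal_space (\<gamma> s). (\<gamma> has_vector_derivative v) (at s within {a..b}))"

definition cc_dist :: "'n::finite heis \<Rightarrow> 'n heis \<Rightarrow> real" where
  "cc_dist p q =
     Inf {heis_length a b \<gamma> | a b \<gamma>. a < b \<and> horizontal_curve a b \<gamma> \<and> \<gamma> a = p \<and> \<gamma> b = q}"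

text \<open>
  The codomain is \<open>\<real>\<^sup>2\<^sup>n\<close>: the type class metric \<open>dist\<close> of a product is the Euclidean one.
\<close>

definition heis_proj :: "'n::finite heis \<Rightarrow> (real^'n) \<times> (real^'n)" where
  "heis_proj = (\<lambda>(x, y, t). (x, y))"

lemma heis_frame_eq:
  "heis_frame (x, y, t) (a, b, c) = (a, b, c + 2 * (\<Sum>j\<in>UNIV. y $ j * a $ j - x $ j * b $ j))"
proof -
  have 1: "(\<Sum>j\<in>UNIV. a $ j *\<^sub>R axis j (1::real)) = a" for a :: "real^'n"
    by (simp add: vec_eq_iff axis_def if_distrib cong: if_cong)
  show ?thesis
    by (simp add: heis_frame_def heis_X_def heis_Y_def heis_T_def prod_eq_iff fst_sum snd_sum 1
        sum_distrib_left sum_subtractf sum_negf algebra_simps)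
qed

lemma heis_frame_eq_deriv_left_translation:
  "(\<lambda>s. heis_mult p (s *\<^sub>R v)) = (\<lambda>s. p + s *\<^sub>R heis_frame p v)"
  by (cases p; cases v)
     (simp add: fun_eq_iff heis_mult_def heis_frame_eq sum_distrib_left sum_subtractf algebra_simps)

lemma bij_heis_frame: "bij (heis_frame p)"
proof (cases p)
  case (fields x y t)
  show ?thesis
    unfolding fields
    by (rule bij_betw_byWitness[where f' = "\<lambda>(a, b, c).
          (a, b, c - 2 * (\<Sum>j\<in>UNIV. y $ j * a $ j - x $ j * b $ j))"])
       (auto simp: heis_frame_eq)
qed

lemma heis_metric_frame: "heis_metric p (heis_frame p v) (heis_frame p w) = v \<bullet> w"
  using bij_heis_frame[of p] by (simp add: heis_metric_def bij_is_inj)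

end

theory Submission
  imports Defs
begin

text \<open>
  The formula holds because, along a rectifiable set, the Carnot-Caratheodory distance and the
  Euclidean distance of the projections agree to first order. Write \<open>\<pi>\<close> for \<open>heis_proj\<close>, and let \<open>\<tau> p q\<close> be the vertical
  coordinate of \<open>p\<inverse> * q\<close> (\<open>heis_tau\<close>). Horizontal curves and explicit paths give
  \<open>dist (\<pi> p) (\<pi> q) \<le> cc_dist p q \<le> dist (\<pi> p) (\<pi> q) + 2 * sqrt \<bar>\<tau> p q\<bar>\<close> and
  \<open>\<bar>\<tau> p q\<bar> \<le> 2 * (cc_dist p q)\<^sup>2\<close>. For a map \<open>f\<close> that is Lipschitz with respect to \<open>cc_dist\<close>
  on a measurable set \<open>A\<close> of parameters, the vertical part \<open>\<tau> (f w) (f w')\<close> is thus at most of order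
  \<open>(dist w w')\<^sup>2\<close>, which is just too weak for a comparison of the two distances.

  The key point is that at almost every \<open>u\<in>A\<close> it is of order \<open>o(R\<^sup>2)\<close> for \<open>w, w'\<close> in the ball of
  radius \<open>R\<close> about \<open>u\<close> (\<open>heis_tau_small_at_thick_point\<close>). Take a density point \<open>u\<close> at which
  \<open>\<pi> \<circ> f\<close> is differentiable, and go from \<open>w\<close> to \<open>w'\<close> in \<open>m\<close> steps through points of \<open>A\<close> close to the
  segment. The vertical parts of the steps add up to \<open>m * O((R / m)\<^sup>2)\<close>. The remaining part
  of \<open>\<tau> (f w) (f w')\<close> is a sum of symplectic areas spanned by increments of \<open>\<pi> \<circ> f\<close>; by
  differentiability these increments are almost parallel, so for fixed \<open>m\<close> this sum is \<open>o(R\<^sup>2)\<close>. Now let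
  \<open>m\<close> grow. Almost every point qualifies by the density theorem (\<open>negligible_not_thick\<close>) and
  Rademacher's theorem (\<open>Rademacher_within\<close>).

  It follows that \<open>cc_dist (f w) (f w')\<close> exceeds \<open>dist (\<pi> (f w)) (\<pi> (f w'))\<close> by \<open>o(R)\<close> only. Where the
  derivative of \<open>\<pi> \<circ> f\<close> is injective, this error is absorbed by the factor \<open>1 + \<eta>\<close>
  (\<open>cc_dist_le_at_immersion_point\<close>). The points at which it is not injective have an image of measure
  zero, because small balls are mapped close to a ball of lower dimension
  (\<open>critical_values_hausdorff_null\<close>). So for every \<open>\<eta> > 0\<close> the set \<open>E\<close> is, up to a null set, a
  countable union of Borel sets on which \<open>\<pi>\<close> is injective, does not increase distances and
  decreases them at most by the factor \<open>1 + \<eta>\<close> (\<open>rectifiable_decomposition\<close>).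

  On such a piece \<open>\<pi>\<close> changes the \<open>k\<close>-dimensional Hausdorff measure at most by the factor
  \<open>(1 + \<eta>) ^ k\<close>, and each fibre of \<open>\<pi>\<close> has at most one point. Summation over disjoint pieces bounds
  the two sides of the formula by each other up to \<open>(1 + \<eta>) ^ k\<close>
  (\<open>integral_bounds_of_decomposition\<close>), and \<open>\<eta>\<close> is arbitrary.
\<close>

section \<open>Lipschitz functions of one real variable\<close>

text \<open>
  The Lebesgue differentiation theorem for the cubes with lower corner \<open>x\<close>, which are the intervals
  \<open>{x..x + h}\<close> in dimension one.
\<close>

lemma right_derivative_of_indefinite_integral:
  fixes F g :: "real \<Rightarrow> real"
  assumes int: "\<And>a b. a \<le> b \<Longrightarrow> (g has_integral F b - F a) {a..b}"
  obtains N where "negligible N" "\<And>x. x \<notin> N \<Longrightarrow> ((\<lambda>h. (F (x + h) - F x) / h) \<longlongrightarrow> g x) (at_right 0)"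
proof -
  have "g integrable_on cbox a b" for a b :: real
    using int[of a b] by (cases "a \<le> b") (auto simp: integrable_on_def)
  then show thesis
  proof (rule integrable_ccontinuous_explicit[of g])
    fix N assume N: "negligible N" "\<And>x e. x \<notin> N \<Longrightarrow> 0 < e \<Longrightarrow> \<exists>d>0. \<forall>h. 0 < h \<and> h < d \<longrightarrow>
       norm (integral (cbox x (x + h *\<^sub>R One)) g /\<^sub>R h ^ DIM(real) - g x) < e"
    show thesis
    proof (rule that[OF N(1)])
      fix x assume "x \<notin> N"
      show "((\<lambda>h. (F (x + h) - F x) / h) \<longlongrightarrow> g x) (at_right 0)"
        unfolding tendsto_iff
      proof (intro allI impI)
        fix e :: real assume "e > 0"
        then obtain d where d: "d > 0" "\<And>h. 0 < h \<Longrightarrow> h < d \<Longrightarrow> norm (integral (cbox x (x + h *\<^sub>R One)) g /\<^sub>R h ^ DIM(real) - g x) < e"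
          using N(2)[OF \<open>x \<notin> N\<close> \<open>e > 0\<close>] by blast
        show "\<forall>\<^sub>F h in at_right 0. dist ((F (x + h) - F x) / h) (g x) < e"
          using eventually_at_right_real[OF d(1)]
        proof eventually_elim
          fix h assume h: "h \<in> {0<..<d}"
          have "integral {x..x + h} g = F (x + h) - F x"
            using int[of x "x + h"] h by (intro integral_unique) auto
          then show "dist ((F (x + h) - F x) / h) (g x) < e"
            using d(2)[of h] h by (simp add: dist_real_def divide_inverse mult.commute)
        qed
      qed
    qed
  qed
qed

text \<open>
  The left derivative is a right derivative after reflection at the origin; both limits are the
  value of the same function \<open>g\<close>.
\<close>

lemma has_derivative_of_indefinite_integral:
  fixes F g :: "real \<Rightarrow> real"
  assumes int: "\<And>a b. a \<le> b \<Longrightarrow> (g has_integral F b - F a) {a..b}"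
  obtains N where "negligible N" "\<And>x. x \<notin> N \<Longrightarrow> (F has_real_derivative g x) (at x)"
proof -
  obtain N1 where N1: "negligible N1" "\<And>x. x \<notin> N1 \<Longrightarrow> ((\<lambda>h. (F (x + h) - F x) / h) \<longlongrightarrow> g x) (at_right 0)"
    using right_derivative_of_indefinite_integral[OF int] by blast
  have "((\<lambda>x. g (- x)) has_integral - F (- b) - - F (- a)) {a..b}" if "a \<le> b" for a b
    using has_integral_reflect_lemma_real[OF int[of "-b" "-a"]] that by simp
  then obtain N2 where N2: "negligible N2"
    "\<And>x. x \<notin> N2 \<Longrightarrow> ((\<lambda>h. (- F (- (x + h)) - - F (- x)) / h) \<longlongrightarrow> g (- x)) (at_right 0)"
    using right_derivative_of_indefinite_integral[of "\<lambda>x. g (- x)" "\<lambda>x. - F (- x)"] by blast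
  show thesis
  proof (rule that[of "N1 \<union> uminus ` N2"])
    show "negligible (N1 \<union> uminus ` N2)"
      by (intro negligible_Un N1(1) negligible_differentiable_image_negligible N2(1)) auto
    fix x assume x: "x \<notin> N1 \<union> uminus ` N2"
    then have "- x \<notin> N2" by (auto simp: image_iff)
    have "((\<lambda>h. (F (x + h) - F x) / h) \<longlongrightarrow> g x) (at_left 0)"
      using N2(2)[OF \<open>- x \<notin> N2\<close>] unfolding at_left_minus[of "0::real"] filterlim_filtermap
      by (simp add: diff_divide_distrib minus_divide_left[symmetric] algebra_simps)
    moreover have "((\<lambda>h. (F (x + h) - F x) / h) \<longlongrightarrow> g x) (at_right 0)"
      using N1(2) x by auto
    ultimately show "(F has_real_derivative g x) (at x)"
      by (simp add: DERIV_def filterlim_split_at)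
  qed
qed

text \<open>
  The pushforward of Lebesgue measure under \<open>F\<inverse>\<close> is the Stieltjes measure of \<open>F\<close>. It is absolutely
  continuous because Lipschitz maps preserve null sets, and \<open>g\<close> is its Radon-Nikodym density. The
  lower bound on the increments makes \<open>F\<close> a bijection, so that this pushforward is available.
\<close>

lemma increasing_Lipschitz_indefinite_integral:
  fixes F :: "real \<Rightarrow> real"
  assumes lip: "L-lipschitz_on UNIV F" and inc: "\<And>x y. x \<le> y \<Longrightarrow> y - x \<le> F y - F x"
  obtains g where "\<And>x. 0 \<le> g x" "\<And>a b. a \<le> b \<Longrightarrow> (g has_integral F b - F a) {a..b}"
proof -
  have cont: "continuous_on UNIV F" using lip by (rule lipschitz_on_continuous_on)
  have less: "x < y \<longleftrightarrow> F x < F y" for x y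
    using inc[of x y] inc[of y x] by (cases x y rule: linorder_cases) auto
  have inj: "inj F"
    by (rule injI) (metis less linorder_neq_iff)
  have surj: "\<exists>x. F x = y" for y
  proof -
    define c where "c = \<bar>y - F 0\<bar>"
    have "F (- c) \<le> y" "y \<le> F c" using inc[of "-c" 0] inc[of 0 c] by (auto simp: c_def)
    then show ?thesis
      using IVT'[of F "- c" y c] cont by (auto simp: c_def intro: continuous_on_subset)
  qed
  then have bij: "bij F" using inj by (metis bijI surjI)
  define G where "G = inv F"
  have FG [simp]: "F (G y) = y" and GF [simp]: "G (F x) = x" for x y
    using bij by (auto simp: G_def bij_is_surj surj_f_inv_f bij_is_inj)
  have G_vim: "G -` B = F ` B" for B
    by (auto intro: rev_image_eqI)
  have "mono G"
    by (rule monoI) (metis FG less not_le)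
  then have G_meas [measurable]: "G \<in> borel_measurable borel" by (rule borel_measurable_mono)
  \<comment> \<open>The Stieltjes measure of \<open>F\<close>, as \<open>N_Ioc\<close> shows.\<close>
  define N where "N = distr lborel borel G"
  have sets_N [simp]: "sets N = sets borel" by (simp add: N_def)
  have N_Ioc: "emeasure N {a<..b} = ennreal (F b - F a)" if "a \<le> b" for a b
  proof -
    have "G -` {a<..b} = {F a<..F b}"
      using less FG by (auto; metis FG less not_le)
    then show ?thesis
      using that less[of b a] by (simp add: N_def emeasure_distr not_less)
  qed
  have "absolutely_continuous lborel N"
    unfolding absolutely_continuous_def
  proof
    fix B :: "real set" assume B: "B \<in> null_sets lborel"
    then have "negligible B"
      by (auto simp: negligible_iff_null_sets null_sets_def)
    then have "negligible (F ` B)"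
    proof (rule negligible_locally_Lipschitz_image[rotated])
      fix x assume "x \<in> B"
      have "norm (F y - F x) \<le> L * norm (y - x)" for y
        using lipschitz_onD[OF lip, of y x] by (simp add: dist_norm)
      then show "\<exists>T B'. open T \<and> x \<in> T \<and> (\<forall>y\<in>B \<inter> T. norm (F y - F x) \<le> B' * norm (y - x))"
        by blast
    qed simp
    moreover have "F ` B \<in> sets borel"
      using measurable_sets_borel[OF G_meas, of B] B by (auto simp: G_vim)
    ultimately have "emeasure lborel (F ` B) = 0"
      by (auto simp: negligible_iff_null_sets null_sets_def emeasure_completion)
    then show "B \<in> null_sets N"
      using B by (auto simp: null_sets_def N_def emeasure_distr G_vim)
  qed
  then obtain f where f: "f \<in> borel_measurable lborel" "density lborel f = N"
    using sigma_finite_measure.Radon_Nikodym[OF lborel.sigma_finite_measure_axioms, of N] by auto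
  have f_int: "(\<integral>\<^sup>+x\<in>{a..b}. f x \<partial>lborel) = ennreal (F b - F a)" if "a \<le> b" for a b
  proof -
    have "emeasure N {a..b} = emeasure N {a<..b}"
    proof -
      have "emeasure N {a} = 0"
      proof -
        have "{a} \<in> null_sets lborel" by (simp add: null_sets_def)
        then show ?thesis
          using \<open>absolutely_continuous lborel N\<close> by (auto simp: absolutely_continuous_def)
      qed
      moreover have "{a..b} = {a} \<union> {a<..b}" using that by auto
      ultimately show ?thesis
        by (simp add: emeasure_Un_null_set null_sets_def del: insert_is_Un)
           (metis (no_types) emeasure_Un_null_set null_setsI sets_N sup_commute borel_singleton insert_is_Un sets.empty_sets greaterThanAtMost_borel)
    qed
    then show ?thesis
      using f(1) N_Ioc[OF that] unfolding f(2)[symmetric] by (simp add: emeasure_density)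
  qed
  define g where "g x = enn2real (f x)" for x
  have "AE x in lborel. f x \<noteq> \<infinity>"
  proof -
    have "AE x in lborel. \<forall>n::nat. x \<in> {- real n..real n} \<longrightarrow> f x \<noteq> \<infinity>"
    proof (intro AE_all_countable[THEN iffD2] allI)
      fix n :: nat
      have "AE x in lborel. f x * indicator {- real n..real n} x \<noteq> \<infinity>"
        using f(1) f_int[of "- real n" "real n"] by (intro nn_integral_PInf_AE) auto
      then show "AE x in lborel. x \<in> {- real n..real n} \<longrightarrow> f x \<noteq> \<infinity>"
        by eventually_elim auto
    qed
    then show ?thesis
    proof eventually_elim
      fix x assume *: "\<forall>n::nat. x \<in> {- real n..real n} \<longrightarrow> f x \<noteq> \<infinity>"
      obtain n :: nat where "\<bar>x\<bar> \<le> real n" using real_arch_simple by blast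
      then show "f x \<noteq> \<infinity>" using * by (auto simp: abs_le_iff)
    qed
  qed
  then have g_eq: "AE x in lborel. ennreal (g x) = f x"
    by eventually_elim (simp add: g_def less_top)
  show thesis
  proof (rule that[of g])
    show "(g has_integral F b - F a) {a..b}" if "a \<le> b" for a b
    proof -
      have "(\<integral>\<^sup>+x. ennreal (indicator {a..b} x * g x) \<partial>lborel) = ennreal (F b - F a)"
        unfolding f_int[OF that, symmetric] using g_eq
        by (intro nn_integral_cong_AE, eventually_elim) (auto simp: indicator_def)
      then have "((\<lambda>x. indicator {a..b} x * g x) has_integral (F b - F a)) UNIV"
        using f(1) inc[OF that] that
        by (intro nn_integral_has_integral) (auto simp: g_def)
      moreover have "(\<lambda>x. indicator {a..b} x * g x) = (\<lambda>x. if x \<in> {a..b} then g x else 0)"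
        by (auto simp: indicator_def)
      ultimately show ?thesis
        by (simp only: has_integral_restrict_UNIV)
    qed
  qed (simp add: g_def)
qed

theorem Lipschitz_ae_has_derivative:
  fixes f :: "real \<Rightarrow> real"
  assumes lip: "L-lipschitz_on UNIV f"
  shows "\<exists>g N. negligible N \<and> (\<forall>x. x \<notin> N \<longrightarrow> (f has_real_derivative g x) (at x))
    \<and> (\<forall>a b. a \<le> b \<longrightarrow> (g has_integral f b - f a) {a..b})
    \<and> (\<forall>a b. g absolutely_integrable_on {a..b})"
proof -
  \<comment> \<open>The slope \<open>L + 1\<close> outweighs the possible decrease of \<open>f\<close> and leaves increments of at least \<open>y - x\<close>.\<close>
  define F where "F x = f x + (L + 1) * x" for x
  have L: "L \<ge> 0" using lip by (rule lipschitz_on_nonneg)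
  have lipf: "\<bar>f x - f y\<bar> \<le> L * \<bar>x - y\<bar>" for x y
    using lipschitz_onD[OF lip, of x y] by (simp add: dist_real_def)
  have "(L + (L + 1))-lipschitz_on UNIV F"
    unfolding F_def
    by (intro lipschitz_on_add lip lipschitz_onI) (auto simp: dist_real_def right_diff_distrib[symmetric] abs_mult L)
  moreover have "y - x \<le> F y - F x" if "x \<le> y" for x y
    using lipf[of x y] that by (simp add: F_def algebra_simps)
  ultimately obtain g where g: "\<And>x. 0 \<le> g x" "\<And>a b. a \<le> b \<Longrightarrow> (g has_integral F b - F a) {a..b}"
    using increasing_Lipschitz_indefinite_integral by blast
  obtain N where N: "negligible N" "\<And>x. x \<notin> N \<Longrightarrow> (F has_real_derivative g x) (at x)"
    using has_derivative_of_indefinite_integral[OF g(2)] by blast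
  have f_eq: "f = (\<lambda>x. F x - (L + 1) * x)" by (auto simp: F_def)
  show ?thesis
  proof (intro exI[of _ N] exI[of _ "\<lambda>x. g x - (L + 1)"] conjI allI impI)
    show "(f has_real_derivative g x - (L + 1)) (at x)" if "x \<notin> N" for x
      unfolding f_eq using N(2)[OF that] by (auto intro!: derivative_eq_intros)
    show int: "((\<lambda>x. g x - (L + 1)) has_integral f b - f a) {a..b}" if "a \<le> b" for a b
      using has_integral_diff[OF g(2)[OF that] has_integral_const_real[of "L + 1" a b]] that
      by (simp add: F_def algebra_simps)
    show "(\<lambda>x. g x - (L + 1)) absolutely_integrable_on {a..b}" for a b
    proof (cases "a \<le> b")
      case True
      have "g absolutely_integrable_on {a..b}"
        using g(1) g(2)[OF True] by (intro nonnegative_absolutely_integrable_1) auto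
      then show ?thesis
        by (intro set_integral_diff absolutely_integrable_on_const) auto
    qed auto
  qed (rule N(1))
qed

section \<open>Density points and the Vitali covering lemma\<close>

text \<open>
  The covering lemma with the disjoint balls numbered by a set of natural numbers, the form in
  which the countable covers below are summed.
\<close>

lemma Vitali_sequence:
  fixes K :: "('a::euclidean_space \<times> real) set"
  assumes S: "S \<subseteq> fst ` K" and K: "\<And>a r. (a, r) \<in> K \<Longrightarrow> 0 < r \<and> r \<le> B"
  obtains I :: "nat set" and a r where
    "\<And>i. i \<in> I \<Longrightarrow> (a i, r i) \<in> K"
    "disjoint_family_on (\<lambda>i. cball (a i) (r i)) I"
    "S \<subseteq> (\<Union>i\<in>I. cball (a i) (5 * r i))"
proof -
  have "S \<subseteq> (\<Union>i\<in>K. cball (fst i) (snd i))"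
    using S K by (force intro: less_imp_le)
  then obtain C where C: "countable C" "C \<subseteq> K"
     "pairwise (\<lambda>i j. disjnt (cball (fst i) (snd i)) (cball (fst j) (snd j))) C"
     "S \<subseteq> (\<Union>i\<in>C. cball (fst i) (5 * snd i))"
    by (rule Vitali_covering_lemma_cballs[where B = B]) (use K in \<open>auto simp: prod_eq_iff\<close>)
  let ?I = "to_nat_on C ` C" and ?c = "\<lambda>n. from_nat_into C n"
  show thesis
  proof (rule that[of ?I "\<lambda>n. fst (?c n)" "\<lambda>n. snd (?c n)"])
    show "\<And>i. i \<in> ?I \<Longrightarrow> (fst (?c i), snd (?c i)) \<in> K"
      using C(1,2) by auto
    show "disjoint_family_on (\<lambda>i. cball (fst (?c i)) (snd (?c i))) ?I"
      using C(1,3) by (auto simp: disjoint_family_on_def pairwise_def disjnt_def)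
    show "S \<subseteq> (\<Union>i\<in>?I. cball (fst (?c i)) (5 * snd (?c i)))"
      using C(1,4) by auto
  qed
qed

lemma suminf_emeasure_disjoint_le:
  assumes "\<And>i. i \<in> I \<Longrightarrow> A i \<in> sets M" "disjoint_family_on A I" "\<And>i. i \<in> I \<Longrightarrow> A i \<subseteq> U" "U \<in> sets M"
  shows "(\<Sum>i::nat. if i \<in> I then emeasure M (A i) else 0) \<le> emeasure M U"
proof -
  let ?A = "\<lambda>i. if i \<in> I then A i else {}"
  have "(\<Sum>i. if i \<in> I then emeasure M (A i) else 0) = (\<Sum>i. emeasure M (?A i))"
    by (intro suminf_cong) auto
  also have "\<dots> = emeasure M (\<Union>i. ?A i)"
    using assms(1,2) by (intro suminf_emeasure) (auto simp: disjoint_family_on_def)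
  also have "\<dots> \<le> emeasure M U"
    using assms by (intro emeasure_mono) (auto split: if_splits)
  finally show ?thesis .
qed

text \<open>
  The set \<open>A\<close> is not porous at \<open>u\<close>. Every Lebesgue density point has this property, and it is all that
  the arguments below use about density: points near \<open>u\<close> can be replaced by points of \<open>A\<close>.
\<close>

definition thick_at :: "'a::euclidean_space set \<Rightarrow> 'a \<Rightarrow> bool" where
  "thick_at A u \<longleftrightarrow> (\<forall>\<delta>>0. \<exists>R\<^sub>0>0. \<forall>R. 0 < R \<and> R < R\<^sub>0 \<longrightarrow> (\<forall>z\<in>cball u R. \<exists>v\<in>A. dist z v \<le> \<delta> * R))"

text \<open>
  Around a point that is not thick there are arbitrarily small balls with a hole of
  proportional size outside \<open>A\<close>. For disjoint such balls inside an open set \<open>U\<close> containing \<open>A\<close> the holes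
  are disjoint subsets of \<open>U - A\<close>, so the total volume of the balls is controlled by that of \<open>U - A\<close>,
  which is arbitrarily small.
\<close>

lemma negligible_not_thick:
  fixes A :: "'a::euclidean_space set"
  assumes A: "A \<in> sets lebesgue"
  shows "negligible {u \<in> A. \<not> thick_at A u}"
proof -
  define P where "P \<delta> M = {u \<in> A \<inter> ball 0 M. \<forall>R\<^sub>0>0. \<exists>R. 0 < R \<and> R < R\<^sub>0 \<and> (\<exists>z\<in>cball u R. \<forall>v\<in>A. \<delta> * R < dist z v)}"
    for \<delta> M :: real
  have P_null: "negligible (P \<delta> M)" if \<delta>: "0 < \<delta>" "\<delta> \<le> 1" for \<delta> M
    unfolding negligible_outer_le
  proof (intro allI impI)
    fix e :: real assume "0 < e"
    \<comment> \<open>The ratio of the volumes of a ball of radius \<open>5 * r\<close> and of a hole of radius \<open>\<delta> * (r / 2)\<close>.\<close>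
    define c where "c = (10 / \<delta>) ^ DIM('a)"
    have "c > 0" using \<delta> by (simp add: c_def)
    obtain U where U: "open U" "A \<subseteq> U" "U - A \<in> lmeasurable" "measure lebesgue (U - A) < e / c"
      using sets_lebesgue_outer_open[OF A, of "e / c"] \<open>0 < e\<close> \<open>c > 0\<close>
      by (metis divide_pos_pos emeasure_eq_measure2 ennreal_less_iff fmeasurableD2 measure_nonneg)
    define K where "K = {(u, r). 0 < r \<and> r \<le> 1 \<and> cball u r \<subseteq> U \<and>
        (\<exists>z\<in>cball u (r/2). \<forall>v\<in>A. \<delta> * (r/2) < dist z v)}"
    have "P \<delta> M \<subseteq> fst ` K"
    proof
      fix u assume u: "u \<in> P \<delta> M"
      then obtain t where t: "t > 0" "cball u t \<subseteq> U"
        using U(1,2) unfolding open_contains_cball P_def by blast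
      obtain R where R: "0 < R" "R < min (t/2) (1/2)" "\<exists>z\<in>cball u R. \<forall>v\<in>A. \<delta> * R < dist z v"
      proof -
        have "min (t/2) (1/2) > 0" using t(1) by simp
        then show ?thesis using u that unfolding P_def by blast
      qed
      have "(u, 2 * R) \<in> K"
        using R t(2) by (auto simp: K_def)
      then show "u \<in> fst ` K" by force
    qed
    then obtain I :: "nat set" and a r where I: "\<And>i. i \<in> I \<Longrightarrow> (a i, r i) \<in> K"
      "disjoint_family_on (\<lambda>i. cball (a i) (r i)) I" "P \<delta> M \<subseteq> (\<Union>i\<in>I. cball (a i) (5 * r i))"
      by (rule Vitali_sequence[of "P \<delta> M" K 1]) (auto simp: K_def)
    have "\<exists>z. \<forall>i\<in>I. z i \<in> cball (a i) (r i / 2) \<and> (\<forall>v\<in>A. \<delta> * (r i / 2) < dist (z i) v)"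
      using I(1) unfolding K_def by (intro bchoice) blast
    then obtain z where z: "\<And>i. i \<in> I \<Longrightarrow> z i \<in> cball (a i) (r i / 2)"
      "\<And>i v. i \<in> I \<Longrightarrow> v \<in> A \<Longrightarrow> \<delta> * (r i / 2) < dist (z i) v" by blast
    have hole: "cball (z i) (\<delta> * (r i / 2)) \<subseteq> cball (a i) (r i) - A" if i: "i \<in> I" for i
    proof
      fix x assume x: "x \<in> cball (z i) (\<delta> * (r i / 2))"
      have "r i > 0" using I(1)[OF i] by (simp add: K_def)
      then have "\<delta> * (r i / 2) \<le> r i / 2" using \<delta> by (simp add: mult_le_cancel_right1)
      then have "dist (a i) x \<le> r i"
        using x z(1)[OF i] dist_triangle[of "a i" x "z i"] by simp
      then show "x \<in> cball (a i) (r i) - A"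
        using x z(2)[OF i, of x] by auto
    qed
    let ?T = "\<Union>i\<in>I. cball (a i) (5 * r i)"
    have "emeasure lebesgue ?T \<le> (\<Sum>i. emeasure lebesgue (if i \<in> I then cball (a i) (5 * r i) else {}))"
      by (rule order_trans[OF _ emeasure_subadditive_countably]) (auto intro!: emeasure_mono split: if_splits)
    also have "\<dots> = (\<Sum>i. ennreal c * (if i \<in> I then emeasure lebesgue (cball (z i) (\<delta> * (r i / 2))) else 0))"
    proof (intro suminf_cong)
      fix i
      show "emeasure lebesgue (if i \<in> I then cball (a i) (5 * r i) else {}) =
          ennreal c * (if i \<in> I then emeasure lebesgue (cball (z i) (\<delta> * (r i / 2))) else 0)"
      proof (cases "i \<in> I")
        case True
        then have "r i > 0" using I(1) by (simp add: K_def)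
        have "5 * r i = (10 / \<delta>) * (\<delta> * (r i / 2))" using \<delta> by simp
        then have "(5 * r i) ^ DIM('a) = c * (\<delta> * (r i / 2)) ^ DIM('a)"
          unfolding c_def by (simp only: power_mult_distrib)
        then show ?thesis
          using True \<open>r i > 0\<close> \<delta> \<open>c > 0\<close>
          by (simp add: emeasure_cball ennreal_mult[symmetric] mult.left_commute del: times_divide_eq_right)
      qed simp
    qed
    also have "\<dots> = ennreal c * (\<Sum>i. if i \<in> I then emeasure lebesgue (cball (z i) (\<delta> * (r i / 2))) else 0)"
      by (rule ennreal_suminf_cmult)
    also have "\<dots> \<le> ennreal c * emeasure lebesgue (U - A)"
    proof (intro mult_left_mono suminf_emeasure_disjoint_le)
      show "disjoint_family_on (\<lambda>i. cball (z i) (\<delta> * (r i / 2))) I"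
        using I(2) hole unfolding disjoint_family_on_def by blast
      show "cball (z i) (\<delta> * (r i / 2)) \<subseteq> U - A" if "i \<in> I" for i
        using hole[OF that] I(1)[OF that] by (auto simp: K_def)
    qed (use U in auto)
    also have "\<dots> \<le> ennreal c * ennreal (e / c)"
      using U(3,4) by (intro mult_left_mono) (auto simp: emeasure_eq_measure2 intro!: ennreal_leI)
    also have "\<dots> = ennreal e"
      using \<open>c > 0\<close> \<open>0 < e\<close> by (simp add: ennreal_mult[symmetric])
    finally have *: "emeasure lebesgue ?T \<le> ennreal e" .
    then have "?T \<in> lmeasurable"
      by (intro fmeasurableI) (auto intro: le_less_trans)
    then have "measure lebesgue ?T \<le> e"
      using * \<open>0 < e\<close> by (simp add: emeasure_eq_measure2)
    then show "\<exists>T. P \<delta> M \<subseteq> T \<and> T \<in> lmeasurable \<and> measure lebesgue T \<le> e"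
      using I(3) \<open>?T \<in> lmeasurable\<close> by blast
  qed
  have "{u \<in> A. \<not> thick_at A u} \<subseteq> (\<Union>n. \<Union>M::nat. P (1 / real (Suc n)) (real M))"
  proof
    fix u assume u: "u \<in> {u \<in> A. \<not> thick_at A u}"
    then obtain \<delta> where \<delta>: "\<delta> > 0" "\<forall>R\<^sub>0>0. \<exists>R. 0 < R \<and> R < R\<^sub>0 \<and> (\<exists>z\<in>cball u R. \<forall>v\<in>A. \<delta> * R < dist z v)"
      unfolding thick_at_def by (auto simp: not_le)
    obtain n where n: "1 / real (Suc n) < \<delta>" using \<delta>(1) nat_approx_posE by blast
    obtain M where M: "norm u < real M" using reals_Archimedean2 by blast
    have "\<exists>R. 0 < R \<and> R < R\<^sub>0 \<and> (\<exists>z\<in>cball u R. \<forall>v\<in>A. 1 / real (Suc n) * R < dist z v)" if R0: "R\<^sub>0 > 0" for R\<^sub>0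
    proof -
      obtain R z where R: "0 < R" "R < R\<^sub>0" "z \<in> cball u R" "\<forall>v\<in>A. \<delta> * R < dist z v"
        using \<delta>(2) R0 by blast
      have "1 / real (Suc n) * R \<le> \<delta> * R" using n R(1) by (intro mult_right_mono) auto
      with R show ?thesis by (meson le_less_trans)
    qed
    then have "u \<in> P (1 / real (Suc n)) (real M)" using u M by (simp add: P_def)
    then show "u \<in> (\<Union>n. \<Union>M::nat. P (1 / real (Suc n)) (real M))" by blast
  qed
  moreover have "negligible (\<Union>n. \<Union>M::nat. P (1 / real (Suc n)) (real M))"
    by (intro negligible_countable_Union countable_image)
       (auto intro!: negligible_countable_Union P_null)
  ultimately show ?thesis by (rule negligible_subset[rotated])
qed

section \<open>Rademacher's theorem\<close>

lemma negligible_countable_UN: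
  "countable I \<Longrightarrow> (\<And>i. i \<in> I \<Longrightarrow> negligible (A i)) \<Longrightarrow> negligible (\<Union>i\<in>I. A i)"
  by (rule negligible_countable_Union) auto

lemma negligible_borel_iff:
  "S \<in> sets borel \<Longrightarrow> negligible S \<longleftrightarrow> emeasure lborel S = 0"
  by (simp add: negligible_iff_null_sets null_sets_completion_iff null_sets_def)

text \<open>
  On each line parallel to \<open>b\<close> the function is differentiable almost everywhere, so that the exceptional
  set meets each such line in a null set; Tonelli's theorem then shows that it is null. The
  statement has an error \<open>e\<close> and a rational slope \<open>c\<close> in order to have countably many
  closed sets, hence a Borel exceptional set.
\<close>

lemma ae_directional_derivative:
  fixes f :: "'a::euclidean_space \<Rightarrow> real" and b :: 'a
  assumes lip: "L-lipschitz_on UNIV f" and "e > 0"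
  defines "D \<equiv> \<lambda>c m. {x. \<forall>t. \<bar>t\<bar> < m \<longrightarrow> \<bar>f (x + t *\<^sub>R b) - f x - t * c\<bar> \<le> e * \<bar>t\<bar>}"
  shows "negligible (- (\<Union>c\<in>\<rat>. \<Union>n. D c (1 / real (Suc n))))"
proof -
  let ?G = "\<Union>c\<in>\<rat>. \<Union>n. D c (1 / real (Suc n))"
  have cont: "continuous_on UNIV f" using lip by (rule lipschitz_on_continuous_on)
  have D_closed: "closed (D c m)" for c m
  proof -
    have "D c m = (\<Inter>t\<in>{t. \<bar>t\<bar> < m}. {x. \<bar>f (x + t *\<^sub>R b) - f x - t * c\<bar> \<le> e * \<bar>t\<bar>})"
      by (auto simp: D_def)
    also have "closed \<dots>"
      by (intro closed_INT ballI closed_Collect_le continuous_intros continuous_on_compose2[OF cont]) auto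
    finally show ?thesis .
  qed
  have G_borel [measurable]: "?G \<in> sets borel"
    by (intro sets.countable_UN'' countable_rat sets.countable_UN borel_closed D_closed) auto
  define N where "N = - ?G"
  have N_borel [measurable]: "N \<in> sets borel"
    unfolding N_def using borel_comp[OF G_borel] .
  have line: "emeasure lborel {t. x + t *\<^sub>R b \<in> N} = 0" for x
  proof -
    define h where "h t = f (x + t *\<^sub>R b)" for t
    have "(L * norm b)-lipschitz_on UNIV h"
    proof (rule lipschitz_onI)
      show "dist (h s) (h t) \<le> L * norm b * dist s t" for s t
        using lipschitz_onD[OF lip, of "x + s *\<^sub>R b" "x + t *\<^sub>R b"]
        by (simp add: h_def dist_norm scaleR_diff_left[symmetric] mult_ac)
    qed (use lipschitz_on_nonneg[OF lip] in auto)
    from Lipschitz_ae_has_derivative[OF this]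
    obtain g M where M: "negligible M" "\<And>t. t \<notin> M \<Longrightarrow> (h has_real_derivative g t) (at t)"
      by (elim exE conjE, intro that) auto
    have "{t. x + t *\<^sub>R b \<in> N} \<subseteq> M"
    proof (rule ccontr)
      assume "\<not> ?thesis"
      then obtain t where t: "x + t *\<^sub>R b \<in> N" "t \<notin> M" by blast
      obtain c where "c \<in> \<rat>" "g t - e/2 < c" "c < g t + e/2"
        using Rats_dense_in_real[of "g t - e/2" "g t + e/2"] \<open>e > 0\<close> by auto
      then have c: "c \<in> \<rat>" "\<bar>c - g t\<bar> < e / 2" unfolding abs_less_iff by linarith+
      have "((\<lambda>s. (h (t + s) - h t) / s) \<longlongrightarrow> g t) (at 0)"
        using M(2)[OF t(2)] by (simp add: DERIV_def)
      then obtain d where d: "d > 0" "\<And>s. s \<noteq> 0 \<Longrightarrow> \<bar>s\<bar> < d \<Longrightarrow> \<bar>(h (t + s) - h t) / s - g t\<bar> < e / 2"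
        unfolding LIM_eq using \<open>e > 0\<close> by (metis diff_zero half_gt_zero real_norm_def)
      obtain n where n: "1 / real (Suc n) < d" using d(1) nat_approx_posE by blast
      have "\<bar>h (t + s) - h t - s * c\<bar> \<le> e * \<bar>s\<bar>" if "\<bar>s\<bar> < 1 / real (Suc n)" for s
      proof (cases "s = 0")
        case False
        have "\<bar>(h (t + s) - h t) / s - c\<bar> \<le> e"
          using d(2)[OF False] n that c(2) by linarith
        then have "\<bar>(h (t + s) - h t) / s - c\<bar> * \<bar>s\<bar> \<le> e * \<bar>s\<bar>"
          by (rule mult_right_mono) simp
        moreover have "((h (t + s) - h t) / s - c) * s = h (t + s) - h t - s * c"
        proof -
          have "(h (t + s) - h t) / s * s = h (t + s) - h t" using False by simp
          then show ?thesis unfolding left_diff_distrib by (simp add: mult.commute)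
        qed
        ultimately show ?thesis by (simp add: abs_mult[symmetric])
      qed simp
      then have "x + t *\<^sub>R b \<in> D c (1 / real (Suc n))"
        by (simp add: D_def h_def algebra_simps)
      then show False using t(1) c(1) unfolding N_def by blast
    qed
    then have "negligible {t. x + t *\<^sub>R b \<in> N}" by (rule negligible_subset[OF M(1)])
    moreover have "{t. x + t *\<^sub>R b \<in> N} \<in> sets borel"
      by measurable
    ultimately show ?thesis
      using negligible_borel_iff by blast
  qed
  \<comment> \<open>All translates of \<open>N\<close> by multiples of \<open>b\<close> have the same measure; averaging over them brings
    in the line sections.\<close>
  have "emeasure lborel N = (\<integral>\<^sup>+t\<in>{0..1::real}. emeasure lborel N \<partial>lborel)"
    by (simp add: nn_integral_cmult_indicator mult.commute)
  also have "\<dots> = (\<integral>\<^sup>+t. (\<integral>\<^sup>+x. indicator N (x + t *\<^sub>R b) * indicator {0..1} t \<partial>lborel) \<partial>lborel)"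
  proof (intro nn_integral_cong)
    fix t :: real
    have "emeasure lborel N = emeasure (distr lborel borel ((+) (t *\<^sub>R b))) N"
      by (simp add: lborel_distr_plus)
    also have "\<dots> = (\<integral>\<^sup>+x. indicator N x \<partial>distr lborel borel ((+) (t *\<^sub>R b)))"
      by simp
    also have "\<dots> = (\<integral>\<^sup>+x. indicator N (t *\<^sub>R b + x) \<partial>lborel)"
      by (rule nn_integral_distr) auto
    also have "\<dots> = (\<integral>\<^sup>+x. indicator N (x + t *\<^sub>R b) \<partial>lborel)"
      by (simp add: add.commute)
    finally show "emeasure lborel N * indicator {0..1} t =
        (\<integral>\<^sup>+x. indicator N (x + t *\<^sub>R b) * indicator {0..1} t \<partial>lborel)"
      by (simp add: nn_integral_multc)
  qed
  also have "\<dots> = (\<integral>\<^sup>+x. (\<integral>\<^sup>+t. indicator N (x + t *\<^sub>R b) * indicator {0..1} t \<partial>lborel) \<partial>lborel)"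
    by (intro lborel_pair.Fubini') measurable
  also have "\<dots> = 0"
  proof -
    have "(\<integral>\<^sup>+t. indicator N (x + t *\<^sub>R b) * indicator {0..1} t \<partial>lborel) \<le>
        (\<integral>\<^sup>+t. indicator {t. x + t *\<^sub>R b \<in> N} t \<partial>lborel)" for x
      by (intro nn_integral_mono) (auto simp: indicator_def)
    moreover have "(\<integral>\<^sup>+t. indicator {t. x + t *\<^sub>R b \<in> N} t \<partial>lborel) = 0" for x
      by (subst nn_integral_indicator) (auto simp: line)
    ultimately show ?thesis by simp
  qed
  finally show ?thesis
    using negligible_borel_iff[OF N_borel] by (simp add: N_def)
qed

text \<open>
  If the same slopes \<open>c \<bullet> b\<close> work uniformly at all points of \<open>K\<close>, walk from \<open>u\<close> to \<open>w\<close> along the coordinate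
  directions. The corners of the path need not lie in \<open>K\<close>, but at a thick point they are close to
  points of \<open>K\<close>, and the Lipschitz condition pays for the replacement.
\<close>

lemma approximate_derivative_at_thick_point:
  fixes f :: "'a::euclidean_space \<Rightarrow> real" and e m :: real
  assumes lip: "L-lipschitz_on UNIV f" and "e > 0" "m > 0"
    and K: "\<And>x b t. x \<in> K \<Longrightarrow> b \<in> Basis \<Longrightarrow> \<bar>t\<bar> < m \<Longrightarrow> \<bar>f (x + t *\<^sub>R b) - f x - t * (c \<bullet> b)\<bar> \<le> e * \<bar>t\<bar>"
    and u: "thick_at K u"
  shows "\<exists>r>0. \<forall>w. norm (w - u) < r \<longrightarrow> \<bar>f w - f u - c \<bullet> (w - u)\<bar> \<le> 2 * DIM('a) * e * norm (w - u)"
proof -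
  have L: "L \<ge> 0" using lip by (rule lipschitz_on_nonneg)
  have lipf: "\<bar>f x - f y\<bar> \<le> L * norm (x - y)" for x y
    using lipschitz_onD[OF lip, of x y] by (simp add: dist_real_def dist_norm)
  define n where "n = real DIM('a)"
  have n: "n > 0" by (simp add: n_def)
  \<comment> \<open>With this \<open>\<delta>\<close> the two replacements in a step, each costing \<open>L * \<delta> * n * R\<close>, cost at most \<open>e * R\<close>.\<close>
  define \<delta> where "\<delta> = e / (2 * (L + 1) * n)"
  have "\<delta> > 0" using n L \<open>e > 0\<close> by (simp add: \<delta>_def)
  moreover have "2 * (L + 1) * \<delta> * n = e"
    using n L by (simp add: \<delta>_def)
  moreover have "2 * L * \<delta> * n \<le> 2 * (L + 1) * \<delta> * n"
    using n L \<open>\<delta> > 0\<close> by (intro mult_right_mono) auto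
  ultimately have \<delta>: "\<delta> > 0" "2 * L * \<delta> * n \<le> e" by auto
  obtain R0 where R0: "R0 > 0" "\<forall>R. 0 < R \<and> R < R0 \<longrightarrow> (\<forall>z\<in>cball u R. \<exists>v\<in>K. dist z v \<le> \<delta> * R)"
    using u \<delta>(1) by (auto simp: thick_at_def)
  show ?thesis
  proof (intro exI[of _ "min m (R0 / n)"] conjI allI impI)
    show "min m (R0 / n) > 0" using \<open>m > 0\<close> R0(1) n by simp
    fix w assume w: "norm (w - u) < min m (R0 / n)"
    define R where "R = norm (w - u)"
    define p where "p B = u + (\<Sum>b\<in>B. ((w - u) \<bullet> b) *\<^sub>R b)" for B
    have "\<bar>f (p B) - f u - c \<bullet> (p B - u)\<bar> \<le> real (card B) * (2 * e * R)" if "B \<subseteq> Basis" for B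
      using finite_subset[OF that finite_Basis] that
    proof (induction B rule: finite_induct)
      case (insert b B)
      define t where "t = (w - u) \<bullet> b"
      have b: "b \<in> Basis" using insert by auto
      have t: "\<bar>t\<bar> \<le> R" using Basis_le_norm[OF b, of "w - u"] by (simp add: t_def R_def)
      have p_ins: "p (insert b B) = p B + t *\<^sub>R b"
        using insert by (simp add: p_def t_def algebra_simps)
      show ?case
      proof (cases "R = 0")
        case True
        then show ?thesis by (simp add: p_def R_def)
      next
        case False
        then have "R > 0" by (simp add: R_def)
        have "norm (p B - u) \<le> (\<Sum>b\<in>B. norm (((w - u) \<bullet> b) *\<^sub>R b))"
          using norm_sum[of "\<lambda>b. ((w - u) \<bullet> b) *\<^sub>R b" B] by (simp add: p_def)
        also have "\<dots> \<le> (\<Sum>b\<in>B. R)"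
          using insert.prems by (intro sum_mono) (auto simp: R_def Basis_le_norm)
        also have "\<dots> \<le> n * R"
          using card_mono[of Basis B] insert.prems \<open>R > 0\<close> by (simp add: n_def)
        finally have "p B \<in> cball u (n * R)" by (simp add: dist_norm norm_minus_commute)
        moreover have "n * R < R0" using w n by (simp add: R_def field_simps)
        ultimately obtain q where q: "q \<in> K" "dist (p B) q \<le> \<delta> * (n * R)"
          using R0(2) \<open>R > 0\<close> n by (meson mult_pos_pos)
        have "L * norm (p B - q) \<le> L * (\<delta> * (n * R))"
          using q(2) L by (intro mult_left_mono) (auto simp: dist_norm)
        moreover have "L * (\<delta> * (n * R)) * 2 \<le> e * R"
          using mult_right_mono[OF \<delta>(2), of R] \<open>R > 0\<close> by (simp add: mult_ac)
        moreover have "\<bar>f (p B + t *\<^sub>R b) - f (q + t *\<^sub>R b)\<bar> \<le> L * norm (p B - q)"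
          using lipf[of "p B + t *\<^sub>R b" "q + t *\<^sub>R b"] by simp
        moreover have "\<bar>f (p B) - f q\<bar> \<le> L * norm (p B - q)"
          by (rule lipf)
        moreover have "\<bar>f (q + t *\<^sub>R b) - f q - t * (c \<bullet> b)\<bar> \<le> e * \<bar>t\<bar>"
          using q(1) b t w by (intro K) (auto simp: R_def)
        moreover have "e * \<bar>t\<bar> \<le> e * R" using t \<open>e > 0\<close> by simp
        ultimately have "\<bar>f (p B + t *\<^sub>R b) - f (p B) - t * (c \<bullet> b)\<bar> \<le> 2 * e * R"
          by linarith
        moreover have "\<bar>f (p B) - f u - c \<bullet> (p B - u)\<bar> \<le> real (card B) * (2 * e * R)"
          using insert by simp
        moreover have "c \<bullet> (p (insert b B) - u) = c \<bullet> (p B - u) + t * (c \<bullet> b)"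
          by (simp add: p_ins inner_simps)
        moreover have "real (card (insert b B)) * (2 * e * R) = real (card B) * (2 * e * R) + 2 * e * R"
          using insert by (simp add: algebra_simps)
        ultimately show ?thesis unfolding p_ins by linarith
      qed
    qed (simp add: p_def)
    from this[of Basis] show "\<bar>f w - f u - c \<bullet> (w - u)\<bar> \<le> 2 * DIM('a) * e * norm (w - u)"
      by (simp add: p_def euclidean_representation R_def mult_ac)
  qed
qed

text \<open>
  Two vectors that approximate the increments with errors \<open>e\<close> and \<open>e'\<close> differ at most by \<open>e + e'\<close>, so
  approximating vectors for \<open>e = 1 / Suc n\<close> form a Cauchy sequence. The limit is the gradient.
\<close>

lemma differentiable_if_approximable:
  fixes f :: "'a::euclidean_space \<Rightarrow> real"
  assumes ap: "\<And>e. e > 0 \<Longrightarrow> \<exists>c. \<exists>r>0. \<forall>w. norm (w - u) < r \<longrightarrow> \<bar>f w - f u - c \<bullet> (w - u)\<bar> \<le> e * norm (w - u)"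
  shows "f differentiable (at u)"
proof -
  have "\<forall>n::nat. \<exists>c. \<exists>r>0. \<forall>w. norm (w - u) < r \<longrightarrow> \<bar>f w - f u - c \<bullet> (w - u)\<bar> \<le> (1 / real (Suc n)) * norm (w - u)"
    by (intro allI ap) simp
  then obtain c r where c: "\<And>n. r n > 0" "\<And>n w. norm (w - u) < r n \<Longrightarrow> \<bar>f w - f u - c n \<bullet> (w - u)\<bar> \<le> (1 / real (Suc n)) * norm (w - u)"
    by metis
  have close: "norm (c m - c n) \<le> 1 / real (Suc m) + 1 / real (Suc n)" for m n
  proof (cases "c m = c n")
    case False
    define v where "v = c m - c n"
    define t where "t = min (r m) (r n) / 2 / norm v"
    have v: "norm v > 0" using False by (simp add: v_def)
    have t: "t > 0" "t * norm v < r m" "t * norm v < r n"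
      using c(1)[of m] c(1)[of n] v by (auto simp: t_def)
    have "\<bar>f (u + t *\<^sub>R v) - f u - c m \<bullet> (t *\<^sub>R v)\<bar> \<le> (1 / real (Suc m)) * (t * norm v)"
         "\<bar>f (u + t *\<^sub>R v) - f u - c n \<bullet> (t *\<^sub>R v)\<bar> \<le> (1 / real (Suc n)) * (t * norm v)"
      using c(2)[of "u + t *\<^sub>R v" m] c(2)[of "u + t *\<^sub>R v" n] t by simp_all
    then have "\<bar>c m \<bullet> (t *\<^sub>R v) - c n \<bullet> (t *\<^sub>R v)\<bar> \<le> (1 / real (Suc m)) * (t * norm v) + (1 / real (Suc n)) * (t * norm v)"
      by linarith
    also have "c m \<bullet> (t *\<^sub>R v) - c n \<bullet> (t *\<^sub>R v) = norm v * (t * norm v)"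
    proof -
      have "c m \<bullet> (t *\<^sub>R v) - c n \<bullet> (t *\<^sub>R v) = t * (v \<bullet> v)"
        by (simp add: v_def inner_diff_left algebra_simps)
      then show ?thesis by (simp add: dot_square_norm power2_eq_square)
    qed
    finally have "norm v * (t * norm v) \<le> (1 / real (Suc m) + 1 / real (Suc n)) * (t * norm v)"
      using t v by (simp add: algebra_simps)
    then show ?thesis using t v by (simp add: v_def)
  qed simp
  have lim0: "(\<lambda>n. 1 / real (Suc n)) \<longlonglongrightarrow> 0" by (rule LIMSEQ_Suc[OF lim_1_over_n])
  have "Cauchy c"
  proof (rule metric_CauchyI)
    fix e :: real assume "e > 0"
    then obtain N where N: "1 / real (Suc N) < e / 2" using nat_approx_posE[of "e/2"] by auto
    show "\<exists>M. \<forall>m\<ge>M. \<forall>n\<ge>M. dist (c m) (c n) < e"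
    proof (intro exI[of _ N] allI impI)
      fix m n assume "m \<ge> N" "n \<ge> N"
      then have "1 / real (Suc m) \<le> 1 / real (Suc N)" "1 / real (Suc n) \<le> 1 / real (Suc N)"
        by (auto intro!: frac_le)
      then show "dist (c m) (c n) < e" using close[of m n] N by (simp add: dist_norm)
    qed
  qed
  then obtain c0 where c0: "c \<longlonglongrightarrow> c0" using Cauchy_convergent_iff convergent_def by blast
  have c0_close: "norm (c0 - c n) \<le> 1 / real (Suc n)" for n
  proof (rule tendsto_le[OF sequentially_bot])
    show "(\<lambda>m. 1 / real (Suc m) + 1 / real (Suc n)) \<longlonglongrightarrow> 1 / real (Suc n)"
      using tendsto_add[OF lim0 tendsto_const[of "1 / real (Suc n)"]] by simp
    show "(\<lambda>m. norm (c m - c n)) \<longlonglongrightarrow> norm (c0 - c n)"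
      by (intro tendsto_intros c0)
  qed (use close in simp)
  have "(f has_derivative (\<lambda>h. c0 \<bullet> h)) (at u)"
    unfolding has_derivative_at_alt
  proof (intro conjI allI impI)
    show "bounded_linear ((\<bullet>) c0)" by (rule bounded_linear_inner_right)
    fix e :: real assume "e > 0"
    then obtain n where n: "1 / real (Suc n) < e / 2" using nat_approx_posE[of "e/2"] by auto
    show "\<exists>d>0. \<forall>y. norm (y - u) < d \<longrightarrow> norm (f y - f u - c0 \<bullet> (y - u)) \<le> e * norm (y - u)"
    proof (intro exI[of _ "r n"] conjI allI impI)
      fix y assume y: "norm (y - u) < r n"
      have "\<bar>(c0 - c n) \<bullet> (y - u)\<bar> \<le> (1 / real (Suc n)) * norm (y - u)"
        by (rule order_trans[OF Cauchy_Schwarz_ineq2]) (rule mult_right_mono[OF c0_close], simp)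
      then have "\<bar>f y - f u - c0 \<bullet> (y - u)\<bar> \<le> (1 / real (Suc n) + 1 / real (Suc n)) * norm (y - u)"
        using c(2)[OF y] unfolding inner_diff_left distrib_right by linarith
      also have "\<dots> \<le> e * norm (y - u)"
        using n by (intro mult_right_mono) auto
      finally show "norm (f y - f u - c0 \<bullet> (y - u)) \<le> e * norm (y - u)" by simp
    qed (rule c(1))
  qed
  then show ?thesis by (auto simp: differentiable_def)
qed

text \<open>
  A countable dense set \<open>C\<close> of candidate gradients turns the space, up to a null set, into a countable
  union of the closed sets \<open>K\<close> to which \<open>approximate_derivative_at_thick_point\<close> applies.
\<close>

theorem Rademacher_real:
  fixes f :: "'a::euclidean_space \<Rightarrow> real"
  assumes lip: "L-lipschitz_on UNIV f"
  shows "negligible {u. \<not> f differentiable (at u)}"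
proof -
  obtain C :: "'a set" where C: "countable C" "\<And>X. open X \<Longrightarrow> X \<noteq> {} \<Longrightarrow> \<exists>d\<in>C. d \<in> X"
    using countable_dense_exists by blast
  have cont: "continuous_on UNIV f" using lip by (rule lipschitz_on_continuous_on)
  define D where "D b e c m = {x. \<forall>t. \<bar>t\<bar> < m \<longrightarrow> \<bar>f (x + t *\<^sub>R b) - f x - t * c\<bar> \<le> e * \<bar>t\<bar>}" for b e c m
  define K where "K e c m = (\<Inter>b\<in>Basis. D b e (c \<bullet> b) m)" for e c m
  have K_closed: "closed (K e c m)" for e c m
  proof -
    have "K e c m = (\<Inter>b\<in>Basis. \<Inter>t\<in>{t. \<bar>t\<bar> < m}. {x. \<bar>f (x + t *\<^sub>R b) - f x - t * (c \<bullet> b)\<bar> \<le> e * \<bar>t\<bar>})"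
      by (auto simp: K_def D_def)
    also have "closed \<dots>"
      by (intro closed_INT ballI closed_Collect_le continuous_intros continuous_on_compose2[OF cont]) auto
    finally show ?thesis .
  qed
  define \<epsilon> where "\<epsilon> j = 1 / real (Suc j)" for j
  define m where "m n = 1 / real (Suc n)" for n
  define Bad where "Bad = (\<Union>j. \<Union>b\<in>Basis. - (\<Union>c\<in>\<rat>. \<Union>n. D b (\<epsilon> j) c (m n)))
      \<union> (\<Union>j. \<Union>c\<in>C. \<Union>n. {u \<in> K (2 * \<epsilon> j) c (m n). \<not> thick_at (K (2 * \<epsilon> j) c (m n)) u})"
  have "negligible Bad"
    unfolding Bad_def
  proof (intro negligible_Un negligible_countable_UN C(1) countable_finite[OF finite_Basis] countableI_type)
    show "negligible (- (\<Union>c\<in>\<rat>. \<Union>n. D b (\<epsilon> j) c (m n)))" for b j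
      using ae_directional_derivative[OF lip, of "\<epsilon> j" b] by (simp add: D_def m_def \<epsilon>_def)
    show "negligible {u \<in> K (2 * \<epsilon> j) c (m n). \<not> thick_at (K (2 * \<epsilon> j) c (m n)) u}" for j c n
      using borel_closed[OF K_closed] by (intro negligible_not_thick) auto
  qed
  moreover have "{u. \<not> f differentiable (at u)} \<subseteq> Bad"
  proof (rule ccontr)
    assume "\<not> ?thesis"
    then obtain u where nd: "\<not> f differentiable (at u)" and u: "u \<notin> Bad" by blast
    have "\<exists>c. \<exists>r>0. \<forall>w. norm (w - u) < r \<longrightarrow> \<bar>f w - f u - c \<bullet> (w - u)\<bar> \<le> e * norm (w - u)" if "e > 0" for e
    proof -
      obtain j where j: "\<epsilon> j < e / (4 * DIM('a))"
        using nat_approx_posE[of "e / (4 * DIM('a))"] \<open>e > 0\<close> unfolding \<epsilon>_def by auto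
      have "\<epsilon> j > 0" by (simp add: \<epsilon>_def)
      have "\<forall>b\<in>Basis. \<exists>c n. u \<in> D b (\<epsilon> j) c (m n)"
        using u by (auto simp: Bad_def; blast)
      then obtain g n where gn: "\<And>b. b \<in> Basis \<Longrightarrow> u \<in> D b (\<epsilon> j) (g b) (m (n b))" by metis
      define g0 where "g0 = (\<Sum>b\<in>Basis. g b *\<^sub>R b)"
      obtain c where c: "c \<in> C" "c \<in> ball g0 (\<epsilon> j)"
        using C(2)[of "ball g0 (\<epsilon> j)"] \<open>\<epsilon> j > 0\<close> by auto
      define N where "N = Max (n ` Basis)"
      have "u \<in> K (2 * \<epsilon> j) c (m N)"
        unfolding K_def
      proof
        fix b :: 'a assume b: "b \<in> Basis"
        have "m N \<le> m (n b)" using b by (auto simp: m_def N_def intro!: frac_le)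
        have "\<bar>g b - c \<bullet> b\<bar> \<le> norm (g0 - c)"
          using Basis_le_norm[OF b, of "g0 - c"] b by (simp add: g0_def inner_diff_left)
        also have "\<dots> \<le> \<epsilon> j" using c(2) by (simp add: dist_norm)
        finally have gc: "\<bar>g b - c \<bullet> b\<bar> \<le> \<epsilon> j" .
        show "u \<in> D b (2 * \<epsilon> j) (c \<bullet> b) (m N)"
          unfolding D_def
        proof (intro CollectI allI impI)
          fix t assume t: "\<bar>t\<bar> < m N"
          have "\<bar>f (u + t *\<^sub>R b) - f u - t * g b\<bar> \<le> \<epsilon> j * \<bar>t\<bar>"
            using gn[OF b] t \<open>m N \<le> m (n b)\<close> by (simp add: D_def)
          moreover have "\<bar>t * g b - t * (c \<bullet> b)\<bar> \<le> \<epsilon> j * \<bar>t\<bar>"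
            using mult_right_mono[OF gc, of "\<bar>t\<bar>"] by (simp add: abs_mult[symmetric] algebra_simps)
          ultimately show "\<bar>f (u + t *\<^sub>R b) - f u - t * (c \<bullet> b)\<bar> \<le> 2 * \<epsilon> j * \<bar>t\<bar>" by linarith
        qed
      qed
      moreover from this have "thick_at (K (2 * \<epsilon> j) c (m N)) u"
        using u c(1) by (auto simp: Bad_def)
      ultimately obtain r where r: "r > 0" "\<And>w. norm (w - u) < r \<Longrightarrow> \<bar>f w - f u - c \<bullet> (w - u)\<bar> \<le> 2 * DIM('a) * (2 * \<epsilon> j) * norm (w - u)"
        using approximate_derivative_at_thick_point[OF lip, of "2 * \<epsilon> j" "m N" "K (2 * \<epsilon> j) c (m N)" c u] \<open>\<epsilon> j > 0\<close>
        by (auto simp: K_def D_def m_def)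
      have "2 * DIM('a) * (2 * \<epsilon> j) \<le> e" using j by (simp add: field_simps)
      then have "2 * DIM('a) * (2 * \<epsilon> j) * norm (w - u) \<le> e * norm (w - u)" for w
        by (rule mult_right_mono) simp
      then show ?thesis using r by (meson order_trans)
    qed
    then show False using differentiable_if_approximable nd by blast
  qed
  ultimately show ?thesis by (rule negligible_subset)
qed

text \<open>
  The largest \<open>L\<close>-Lipschitz function that agrees with \<open>\<phi>\<close> on \<open>A\<close>.
\<close>

lemma McShane_extension:
  fixes \<phi> :: "'a::metric_space \<Rightarrow> real"
  assumes lip: "L-lipschitz_on A \<phi>"
  shows "\<exists>\<psi>. L-lipschitz_on UNIV \<psi> \<and> (\<forall>a\<in>A. \<psi> a = \<phi> a)"
proof (cases "A = {}")
  case True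
  then show ?thesis
    using lipschitz_on_nonneg[OF lip] by (intro exI[of _ "\<lambda>_. 0"]) (auto intro: lipschitz_onI)
next
  case False
  then obtain a0 where a0: "a0 \<in> A" by blast
  have L: "L \<ge> 0" using lip by (rule lipschitz_on_nonneg)
  have lip\<phi>: "\<phi> a \<le> \<phi> b + L * dist a b" if "a \<in> A" "b \<in> A" for a b
    using lipschitz_onD[OF lip that] by (simp add: dist_real_def)
  define \<psi> where "\<psi> w = (INF a\<in>A. \<phi> a + L * dist w a)" for w
  have low: "\<phi> b - L * dist w b \<le> \<phi> a + L * dist w a" if "a \<in> A" "b \<in> A" for a b w
  proof -
    have "L * dist b a \<le> L * (dist w b + dist w a)"
      using dist_triangle[of b a w] L by (intro mult_left_mono) (auto simp: dist_commute)
    then show ?thesis using lip\<phi>[OF that(2,1)] by (simp add: algebra_simps)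
  qed
  then have bdd: "bdd_below ((\<lambda>a. \<phi> a + L * dist w a) ` A)" for w
    using a0 by (intro bdd_belowI[of _ "\<phi> a0 - L * dist w a0"]) auto
  have le: "\<psi> v \<le> \<psi> w + L * dist v w" for v w
  proof -
    have "\<psi> v - L * dist v w \<le> \<psi> w"
      unfolding \<psi>_def[of w]
    proof (rule cINF_greatest[OF False])
      fix a assume a: "a \<in> A"
      have "\<psi> v \<le> \<phi> a + L * dist v a"
        unfolding \<psi>_def by (rule cINF_lower[OF bdd a])
      also have "L * dist v a \<le> L * (dist v w + dist w a)"
        using L dist_triangle by (intro mult_left_mono) auto
      finally show "\<psi> v - L * dist v w \<le> \<phi> a + L * dist w a" by (simp add: algebra_simps)
    qed
    then show ?thesis by simp
  qed
  have "L-lipschitz_on UNIV \<psi>"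
  proof (rule lipschitz_onI[OF _ L])
    fix v w show "dist (\<psi> v) (\<psi> w) \<le> L * dist v w"
      using le[of v w] le[of w v] by (simp add: dist_real_def dist_commute abs_le_iff)
  qed
  moreover have "\<psi> a = \<phi> a" if a: "a \<in> A" for a
  proof (rule antisym)
    show "\<psi> a \<le> \<phi> a"
      unfolding \<psi>_def using cINF_lower[OF bdd a, of a] by simp
    show "\<phi> a \<le> \<psi> a"
      unfolding \<psi>_def using low[OF _ a, of _ a] by (intro cINF_greatest[OF False]) auto
  qed
  ultimately show ?thesis by blast
qed

text \<open>
  Each coordinate of \<open>F\<close> is extended separately. The extensions are differentiable almost everywhere in
  the whole space, which gives derivatives of \<open>F\<close> within \<open>A\<close>.
\<close>

theorem Rademacher_within:
  fixes F :: "'a::euclidean_space \<Rightarrow> 'b::euclidean_space"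
  assumes lip: "L-lipschitz_on A F"
  shows "negligible {u \<in> A. \<not> F differentiable (at u within A)}"
proof -
  have "\<exists>\<psi>. L-lipschitz_on UNIV \<psi> \<and> (\<forall>a\<in>A. \<psi> a = F a \<bullet> b)" if b: "b \<in> Basis" for b
  proof (rule McShane_extension)
    show "L-lipschitz_on A (\<lambda>a. F a \<bullet> b)"
    proof (rule lipschitz_onI[OF _ lipschitz_on_nonneg[OF lip]])
      fix x y assume xy: "x \<in> A" "y \<in> A"
      have "dist (F x \<bullet> b) (F y \<bullet> b) \<le> dist (F x) (F y)"
        using Basis_le_norm[OF b, of "F x - F y"] by (simp add: dist_norm inner_diff_left)
      then show "dist (F x \<bullet> b) (F y \<bullet> b) \<le> L * dist x y"
        using lipschitz_onD[OF lip xy] by simp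
    qed
  qed
  then have "\<forall>b\<in>Basis. \<exists>\<psi>. L-lipschitz_on UNIV \<psi> \<and> (\<forall>a\<in>A. \<psi> a = F a \<bullet> b)" by blast
  from bchoice[OF this] obtain \<psi> where \<psi>: "\<And>b. b \<in> Basis \<Longrightarrow> L-lipschitz_on UNIV (\<psi> b)"
    "\<And>b a. b \<in> Basis \<Longrightarrow> a \<in> A \<Longrightarrow> \<psi> b a = F a \<bullet> b"
    by auto
  have "negligible (\<Union>b\<in>Basis. {u. \<not> \<psi> b differentiable (at u)})"
    using \<psi>(1) by (intro negligible_countable_UN countable_finite[OF finite_Basis]) (rule Rademacher_real)
  moreover have "{u \<in> A. \<not> F differentiable (at u within A)} \<subseteq> (\<Union>b\<in>Basis. {u. \<not> \<psi> b differentiable (at u)})"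
  proof (rule ccontr)
    assume "\<not> ?thesis"
    then obtain u where u: "u \<in> A" "\<not> F differentiable (at u within A)"
      "\<And>b. b \<in> Basis \<Longrightarrow> \<psi> b differentiable (at u)" by blast
    have "(\<lambda>x. F x \<bullet> b) differentiable (at u within A)" if b: "b \<in> Basis" for b
    proof -
      obtain D where "(\<psi> b has_derivative D) (at u)"
        using u(3)[OF b] by (auto simp: differentiable_def)
      then have "(\<psi> b has_derivative D) (at u within A)" by (rule has_derivative_at_withinI)
      then have "((\<lambda>x. F x \<bullet> b) has_derivative D) (at u within A)"
        by (rule has_derivative_transform[OF u(1), rotated]) (simp add: \<psi>(2)[OF b])
      then show ?thesis by (auto simp: differentiable_def)
    qed
    then show False using u(2) differentiable_componentwise_within by blast
  qed
  ultimately show ?thesis by (rule negligible_subset)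
qed

section \<open>Hausdorff measures of a distance function\<close>

lemma ediam_mono: "A \<subseteq> B \<Longrightarrow> ediam d A \<le> ediam d B"
  unfolding ediam_def by (intro SUP_subset_mono order_refl)

lemma ediam_upper: "x \<in> A \<Longrightarrow> y \<in> A \<Longrightarrow> ennreal (d x y) \<le> ediam d A"
  unfolding ediam_def by (meson SUP_upper SUP_upper2)

lemma ediam_least: "(\<And>x y. x \<in> A \<Longrightarrow> y \<in> A \<Longrightarrow> ennreal (d x y) \<le> c) \<Longrightarrow> ediam d A \<le> c"
  unfolding ediam_def by (intro SUP_least)

definition hausdorff_gauge :: "('a \<Rightarrow> 'a \<Rightarrow> real) \<Rightarrow> nat \<Rightarrow> 'a set \<Rightarrow> ennreal" where
  "hausdorff_gauge d k A = (if A = {} then 0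
     else ennreal (unit_ball_vol (real k) / 2 ^ k) * ediam d A ^ k)"

lemma hausdorff_gauge_empty [simp]: "hausdorff_gauge d k {} = 0"
  by (simp add: hausdorff_gauge_def)

lemma hausdorff_gauge_mono: "A \<subseteq> B \<Longrightarrow> hausdorff_gauge d k A \<le> hausdorff_gauge d k B"
  by (auto simp: hausdorff_gauge_def intro!: mult_left_mono power_mono ediam_mono)

lemma hausdorff_pre_eq:
  "hausdorff_pre d k \<delta> A =
     (INF S\<in>{S :: nat \<Rightarrow> 'a set. A \<subseteq> (\<Union>i. S i) \<and> (\<forall>i. ediam d (S i) \<le> ennreal \<delta>)}.
        \<Sum>i. hausdorff_gauge d k (S i))"
  unfolding hausdorff_pre_def hausdorff_gauge_def ..

lemma hausdorff_pre_le:
  assumes "A \<subseteq> (\<Union>i. S i)" "\<And>i::nat. ediam d (S i) \<le> ennreal \<delta>"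
  shows "hausdorff_pre d k \<delta> A \<le> (\<Sum>i. hausdorff_gauge d k (S i))"
  unfolding hausdorff_pre_eq by (rule INF_lower) (use assms in auto)

lemma hausdorff_pre_mono: "A \<subseteq> B \<Longrightarrow> hausdorff_pre d k \<delta> A \<le> hausdorff_pre d k \<delta> B"
  unfolding hausdorff_pre_def by (rule INF_superset_mono) auto

lemma hausdorff_pre_empty [simp]: "hausdorff_pre d k \<delta> {} = 0"
proof -
  have "hausdorff_pre d k \<delta> {} \<le> (\<Sum>i. hausdorff_gauge d k {})"
    by (rule hausdorff_pre_le) (auto simp: ediam_def)
  then show ?thesis by simp
qed

lemma hausdorff_pre_subadditive:
  "hausdorff_pre d k \<delta> (\<Union>i::nat. A i) \<le> (\<Sum>i. hausdorff_pre d k \<delta> (A i))"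
proof (cases "(\<Sum>i. hausdorff_pre d k \<delta> (A i)) = top")
  case False
  then have fin: "hausdorff_pre d k \<delta> (A i) \<noteq> top" for i
    by (metis ennreal_suminf_lessD less_top)
  show ?thesis
  proof (rule ennreal_le_epsilon)
    fix e :: real assume "0 < e"
    have "\<exists>S. A i \<subseteq> (\<Union>j::nat. S j) \<and> (\<forall>j. ediam d (S j) \<le> ennreal \<delta>) \<and>
        (\<Sum>j. hausdorff_gauge d k (S j)) \<le> hausdorff_pre d k \<delta> (A i) + ennreal (e * (1/2)^Suc i)" for i
    proof -
      have "hausdorff_pre d k \<delta> (A i) < hausdorff_pre d k \<delta> (A i) + ennreal (e * (1/2)^Suc i)"
        using fin[of i] \<open>0 < e\<close> by (simp add: ennreal_add_left_cancel_less[of _ 0, simplified] ennreal_zero_less_mult_iff)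
      then show ?thesis
        by (subst (asm) hausdorff_pre_eq) (force simp: INF_less_iff intro: less_imp_le)
    qed
    then obtain S where S: "\<And>i. A i \<subseteq> (\<Union>j::nat. S i j)" "\<And>i j. ediam d (S i j) \<le> ennreal \<delta>"
      "\<And>i. (\<Sum>j. hausdorff_gauge d k (S i j)) \<le> hausdorff_pre d k \<delta> (A i) + ennreal (e * (1/2)^Suc i)"
      by metis
    define T where "T n = (case prod_decode n of (i, j) \<Rightarrow> S i j)" for n
    have "hausdorff_pre d k \<delta> (\<Union>i. A i) \<le> (\<Sum>n. hausdorff_gauge d k (T n))"
    proof (rule hausdorff_pre_le)
      show "(\<Union>i. A i) \<subseteq> (\<Union>n. T n)"
      proof safe
        fix x i assume "x \<in> A i"
        then obtain j where "x \<in> S i j" using S(1)[of i] by blast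
        then show "x \<in> (\<Union>n. T n)"
          by (intro UN_I[of "prod_encode (i, j)"]) (auto simp: T_def)
      qed
      show "ediam d (T n) \<le> ennreal \<delta>" for n
        using S(2) by (auto simp: T_def split: prod.split)
    qed
    also have "\<dots> = (\<Sum>n. (\<lambda>(i,j). hausdorff_gauge d k (S i j)) (prod_decode n))"
      by (intro arg_cong[where f = suminf] ext) (auto simp: T_def split: prod.split)
    also have "\<dots> = (\<Sum>i. \<Sum>j. hausdorff_gauge d k (S i j))"
      using suminf_ennreal_2dimen[of "\<lambda>i. \<Sum>j. hausdorff_gauge d k (S i j)" "\<lambda>(i,j). hausdorff_gauge d k (S i j)"]
      by simp
    also have "\<dots> \<le> (\<Sum>i. hausdorff_pre d k \<delta> (A i) + ennreal (e * (1/2)^Suc i))"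
      by (intro suminf_le S(3)) auto
    also have "\<dots> = (\<Sum>i. hausdorff_pre d k \<delta> (A i)) + (\<Sum>i. ennreal (e * (1/2)^Suc i))"
      by (intro suminf_add[symmetric]) auto
    also have "(\<Sum>i. ennreal (e * (1/2)^Suc i)) = ennreal e"
      using sums_mult[OF power_half_series, of e] \<open>0 < e\<close>
      by (intro suminf_ennreal_eq) auto
    finally show "hausdorff_pre d k \<delta> (\<Union>i. A i) \<le> (\<Sum>i. hausdorff_pre d k \<delta> (A i)) + ennreal e" .
  qed
qed simp

lemma hausdorff_pre_le_outer: "\<delta> > 0 \<Longrightarrow> hausdorff_pre d k \<delta> A \<le> hausdorff_outer d k A"
  unfolding hausdorff_outer_eq_SUP by (rule SUP_upper) simp

lemma hausdorff_outer_least: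
  "(\<And>\<delta>. \<delta> > 0 \<Longrightarrow> hausdorff_pre d k \<delta> A \<le> c) \<Longrightarrow> hausdorff_outer d k A \<le> c"
  unfolding hausdorff_outer_eq_SUP by (rule SUP_least) simp

lemma hausdorff_outer_empty [simp]: "hausdorff_outer d k {} = 0"
  by (simp add: hausdorff_outer_eq_SUP)

lemma hausdorff_outer_mono: "A \<subseteq> B \<Longrightarrow> hausdorff_outer d k A \<le> hausdorff_outer d k B"
  by (rule hausdorff_outer_least) (meson hausdorff_pre_le_outer hausdorff_pre_mono order_trans)

lemma hausdorff_outer_null_subset:
  "A \<subseteq> B \<Longrightarrow> hausdorff_outer d k B = 0 \<Longrightarrow> hausdorff_outer d k A = 0"
  using hausdorff_outer_mono[of A B d k] by simp

lemma hausdorff_outer_subadditive: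
  "hausdorff_outer d k (\<Union>i::nat. A i) \<le> (\<Sum>i. hausdorff_outer d k (A i))"
proof (rule hausdorff_outer_least)
  fix \<delta> :: real assume "0 < \<delta>"
  then show "hausdorff_pre d k \<delta> (\<Union>i. A i) \<le> (\<Sum>i. hausdorff_outer d k (A i))"
    by (intro order_trans[OF hausdorff_pre_subadditive] suminf_le hausdorff_pre_le_outer) auto
qed

lemma outer_measure_space_hausdorff: "outer_measure_space UNIV (hausdorff_outer d k)"
  unfolding outer_measure_space_def positive_def increasing_def countably_subadditive_def
  by (auto intro: hausdorff_outer_mono hausdorff_outer_subadditive)

lemma hausdorff_outer_Un: "hausdorff_outer d k (A \<union> B) \<le> hausdorff_outer d k A + hausdorff_outer d k B"
proof -
  interpret sigma_algebra UNIV "UNIV :: 'a set set"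
    using sigma_algebra_Pow[of "UNIV :: 'a set"] by simp
  have "subadditive UNIV (hausdorff_outer d k)"
    using outer_measure_space_hausdorff[of d k]
    by (intro countably_subadditive_subadditive) (auto simp: outer_measure_space_def)
  then have "A \<inter> (B - A) = {} \<Longrightarrow> hausdorff_outer d k (A \<union> (B - A))
     \<le> hausdorff_outer d k A + hausdorff_outer d k (B - A)"
    by (simp only: subadditive_def) blast
  moreover have "hausdorff_outer d k (B - A) \<le> hausdorff_outer d k B"
    by (rule hausdorff_outer_mono) auto
  ultimately show ?thesis
    by (auto intro: order_trans add_left_mono)
qed

lemma hausdorff_outer_null_Un:
  "hausdorff_outer d k A = 0 \<Longrightarrow> hausdorff_outer d k B = 0 \<Longrightarrow> hausdorff_outer d k (A \<union> B) = 0"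
  using hausdorff_outer_Un[of d k A B] by simp

lemma hausdorff_outer_null_UN:
  assumes "countable I" "\<And>i. i \<in> I \<Longrightarrow> hausdorff_outer d k (A i) = 0"
  shows "hausdorff_outer d k (\<Union>i\<in>I. A i) = 0"
proof (cases "I = {}")
  case False
  have "(\<Union>i\<in>I. A i) = (\<Union>n. A (from_nat_into I n))"
    using range_from_nat_into[OF False assms(1)] by (metis image_image)
  then have "hausdorff_outer d k (\<Union>i\<in>I. A i) \<le> (\<Sum>n. hausdorff_outer d k (A (from_nat_into I n)))"
    using hausdorff_outer_subadditive[of d k "\<lambda>n. A (from_nat_into I n)"] by simp
  then show ?thesis
    using assms(2) False by (simp add: from_nat_into)
qed simp

text \<open>
  The image of a cover under \<open>\<phi>\<close> is a cover whose diameters are larger at most by the factor \<open>c\<close>.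
\<close>

lemma hausdorff_outer_Lipschitz_image:
  assumes "c > 0" and lip: "\<And>x y. x \<in> S \<Longrightarrow> y \<in> S \<Longrightarrow> e (\<phi> x) (\<phi> y) \<le> c * d x y"
  shows "hausdorff_outer e k (\<phi> ` S) \<le> ennreal (c ^ k) * hausdorff_outer d k S"
proof (rule hausdorff_outer_least)
  fix \<delta> :: real assume "\<delta> > 0"
  define \<delta>' where "\<delta>' = \<delta> / (c + 1)"
  have \<delta>': "\<delta>' > 0" "c * \<delta>' \<le> \<delta>"
    using less_imp_le[OF \<open>c > 0\<close>] \<open>\<delta> > 0\<close> by (auto simp: \<delta>'_def field_simps)
  have diam: "ediam e (\<phi> ` (T \<inter> S)) \<le> ennreal c * ediam d T" for T
  proof (rule ediam_least)
    fix x y assume "x \<in> \<phi> ` (T \<inter> S)" "y \<in> \<phi> ` (T \<inter> S)"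
    then obtain u v where uv: "u \<in> T \<inter> S" "v \<in> T \<inter> S" "x = \<phi> u" "y = \<phi> v" by blast
    have "ennreal (e x y) \<le> ennreal (c * d u v)"
      using uv lip by (auto intro: ennreal_leI)
    also have "\<dots> = ennreal c * ennreal (d u v)"
      by (cases "d u v \<ge> 0") (auto simp: ennreal_mult ennreal_neg mult_nonneg_nonpos less_imp_le[OF \<open>c > 0\<close>])
    also have "\<dots> \<le> ennreal c * ediam d T"
      using uv by (intro mult_left_mono ediam_upper) auto
    finally show "ennreal (e x y) \<le> ennreal c * ediam d T" .
  qed
  have "hausdorff_pre e k \<delta> (\<phi> ` S) / ennreal (c ^ k) \<le> hausdorff_pre d k \<delta>' S"
    unfolding hausdorff_pre_eq[of d]
    proof (rule INF_greatest, clarify)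
      fix T :: "nat \<Rightarrow> 'a set" assume T: "S \<subseteq> (\<Union>i. T i)" "\<forall>i. ediam d (T i) \<le> ennreal \<delta>'"
      have "hausdorff_pre e k \<delta> (\<phi> ` S) \<le> (\<Sum>i. hausdorff_gauge e k (\<phi> ` (T i \<inter> S)))"
      proof (rule hausdorff_pre_le)
        show "\<phi> ` S \<subseteq> (\<Union>i. \<phi> ` (T i \<inter> S))" using T(1) by blast
        fix i
        have "ediam e (\<phi> ` (T i \<inter> S)) \<le> ennreal c * ennreal \<delta>'"
          by (rule order_trans[OF diam]) (use T(2) in \<open>auto intro: mult_left_mono\<close>)
        also have "\<dots> \<le> ennreal \<delta>"
          using \<delta>' less_imp_le[OF \<open>c > 0\<close>] by (simp add: ennreal_mult[symmetric] ennreal_leI)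
        finally show "ediam e (\<phi> ` (T i \<inter> S)) \<le> ennreal \<delta>" .
      qed
      also have "\<dots> \<le> (\<Sum>i. ennreal (c^k) * hausdorff_gauge d k (T i))"
      proof (intro suminf_le)
        fix i
        have "ediam e (\<phi> ` (T i \<inter> S)) ^ k \<le> ennreal (c^k) * ediam d (T i) ^ k"
          using power_mono[OF diam, of "T i" k] less_imp_le[OF \<open>c > 0\<close>]
          by (simp add: power_mult_distrib ennreal_power)
        from mult_left_mono[OF this, of "ennreal (unit_ball_vol (real k) / 2 ^ k)"]
        show "hausdorff_gauge e k (\<phi> ` (T i \<inter> S)) \<le> ennreal (c^k) * hausdorff_gauge d k (T i)"
          by (auto simp: hausdorff_gauge_def mult.left_commute)
      qed auto
      finally show "hausdorff_pre e k \<delta> (\<phi> ` S) / ennreal (c^k) \<le> (\<Sum>i. hausdorff_gauge d k (T i))"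
        using \<open>c > 0\<close> by (intro divide_le_posI_ennreal) (auto simp: mult.commute)
    qed
  also have "\<dots> \<le> hausdorff_outer d k S"
    by (intro hausdorff_pre_le_outer \<delta>')
  finally have "ennreal (c ^ k) * (hausdorff_pre e k \<delta> (\<phi> ` S) / ennreal (c ^ k))
      \<le> ennreal (c ^ k) * hausdorff_outer d k S"
    by (rule mult_left_mono) simp
  then show "hausdorff_pre e k \<delta> (\<phi> ` S) \<le> ennreal (c ^ k) * hausdorff_outer d k S"
    using mult_divide_eq_ennreal[of "ennreal (c ^ k)" "hausdorff_pre e k \<delta> (\<phi> ` S)"] \<open>c > 0\<close>
    by (simp add: ennreal_times_divide mult.commute)
qed

text \<open>
  A set of diameter less than \<open>r\<close> meets at most one of \<open>A\<close> and \<open>B\<close>, so that every fine cover of the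
  union splits into covers of the two parts.
\<close>

lemma hausdorff_outer_separated:
  assumes "r > 0" and sep: "\<And>x y. x \<in> A \<Longrightarrow> y \<in> B \<Longrightarrow> r \<le> d x y"
  shows "hausdorff_outer d k A + hausdorff_outer d k B \<le> hausdorff_outer d k (A \<union> B)"
proof -
  have main: "hausdorff_pre d k \<delta> A + hausdorff_pre d k \<delta> B \<le> hausdorff_outer d k (A \<union> B)"
    if "0 < \<delta>" "\<delta> < r" for \<delta>
  proof -
    have "hausdorff_pre d k \<delta> A + hausdorff_pre d k \<delta> B \<le> hausdorff_pre d k \<delta> (A \<union> B)"
      unfolding hausdorff_pre_eq[of d k \<delta> "A \<union> B"]
    proof (rule INF_greatest, clarify)
      fix S :: "nat \<Rightarrow> 'a set"
      assume S: "A \<union> B \<subseteq> (\<Union>i. S i)" "\<forall>i. ediam d (S i) \<le> ennreal \<delta>"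
      have le: "ediam d (S i \<inter> C) \<le> ennreal \<delta>" for i C
        using ediam_mono[of "S i \<inter> C" "S i" d] S(2) by (auto intro: order_trans)
      have "hausdorff_pre d k \<delta> A \<le> (\<Sum>i. hausdorff_gauge d k (S i \<inter> A))"
           "hausdorff_pre d k \<delta> B \<le> (\<Sum>i. hausdorff_gauge d k (S i \<inter> B))"
        using S le by (auto intro!: hausdorff_pre_le)
      then have "hausdorff_pre d k \<delta> A + hausdorff_pre d k \<delta> B
          \<le> (\<Sum>i. hausdorff_gauge d k (S i \<inter> A)) + (\<Sum>i. hausdorff_gauge d k (S i \<inter> B))"
        by (rule add_mono)
      also have "\<dots> = (\<Sum>i. hausdorff_gauge d k (S i \<inter> A) + hausdorff_gauge d k (S i \<inter> B))"
        by (rule suminf_add) auto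
      also have "\<dots> \<le> (\<Sum>i. hausdorff_gauge d k (S i))"
      proof (intro suminf_le)
        fix i
        have "S i \<inter> A = {} \<or> S i \<inter> B = {}"
        proof (rule ccontr)
          assume "\<not> ?thesis"
          then obtain x y where xy: "x \<in> S i" "x \<in> A" "y \<in> S i" "y \<in> B" by blast
          have "ennreal r \<le> ennreal (d x y)" using sep xy by (simp add: ennreal_leI)
          also have "\<dots> \<le> ennreal \<delta>" using ediam_upper[of x "S i" y d] xy S(2) by (auto intro: order_trans)
          finally show False using that by (auto simp: ennreal_le_iff)
        qed
        then show "hausdorff_gauge d k (S i \<inter> A) + hausdorff_gauge d k (S i \<inter> B) \<le> hausdorff_gauge d k (S i)"
          by (auto intro: hausdorff_gauge_mono)
      qed auto
      finally show "hausdorff_pre d k \<delta> A + hausdorff_pre d k \<delta> B \<le> (\<Sum>i. hausdorff_gauge d k (S i))" .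
    qed
    also have "\<dots> \<le> hausdorff_outer d k (A \<union> B)"
      by (rule hausdorff_pre_le_outer) fact
    finally show ?thesis .
  qed
  have "hausdorff_outer d k A + hausdorff_outer d k B
      = (SUP \<delta>\<in>{0<..}. SUP \<delta>'\<in>{0<..}. hausdorff_pre d k \<delta> A + hausdorff_pre d k \<delta>' B)"
    unfolding hausdorff_outer_eq_SUP
    by (simp add: ennreal_SUP_add_left[symmetric] ennreal_SUP_add_right[symmetric])
  also have "\<dots> \<le> hausdorff_outer d k (A \<union> B)"
  proof (intro SUP_least)
    fix \<delta> \<delta>' :: real assume \<delta>: "\<delta> \<in> {0<..}" "\<delta>' \<in> {0<..}"
    define \<eta> where "\<eta> = min (min \<delta> \<delta>') (r / 2)"
    have \<eta>: "0 < \<eta>" "\<eta> < r" "\<eta> \<le> \<delta>" "\<eta> \<le> \<delta>'"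
      using \<delta> \<open>r > 0\<close> by (auto simp: \<eta>_def)
    have "hausdorff_pre d k \<delta> A + hausdorff_pre d k \<delta>' B \<le> hausdorff_pre d k \<eta> A + hausdorff_pre d k \<eta> B"
      by (intro add_mono hausdorff_pre_antimono \<eta>)
    also note main[OF \<eta>(1,2)]
    finally show "hausdorff_pre d k \<delta> A + hausdorff_pre d k \<delta>' B \<le> hausdorff_outer d k (A \<union> B)" .
  qed
  finally show ?thesis .
qed

text \<open>
  Caratheodory's criterion: an outer measure that is additive on separated sets measures the open
  sets. Inside \<open>U\<close>, the points at distance at least \<open>1 / Suc n\<close> from the complement form sets
  \<open>A n\<close> that are separated from \<open>T - U\<close>. They exhaust \<open>U \<inter> T\<close> in measure because rings
  \<open>R n = A (Suc n) - A n\<close> that are not neighbours are separated as well, which makes the series of their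
  measures converge.
\<close>

lemma openin_in_lambda_system:
  assumes "Metric_space UNIV d" and U: "openin (Metric_space.mtopology UNIV d) U"
  shows "U \<in> lambda_system UNIV UNIV (hausdorff_outer d k)"
proof -
  interpret Metric_space UNIV d by fact
  let ?H = "hausdorff_outer d k"
  have "?H (U \<inter> T) + ?H (T - U) \<le> ?H T" for T
  proof (cases "?H T = top")
    case False
    define A where "A n = {x \<in> U \<inter> T. \<forall>y. y \<notin> U \<longrightarrow> 1 / real (Suc n) \<le> d x y}" for n
    define R where "R n = A (Suc n) - A n" for n
    have A_sub: "A n \<subseteq> U \<inter> T" for n by (auto simp: A_def)
    have A_mono: "A n \<subseteq> A (Suc n)" for n
    proof -
      have "1 / real (Suc (Suc n)) \<le> 1 / real (Suc n)" by (simp add: frac_le)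
      then show ?thesis unfolding A_def by fastforce
    qed
    have A_un: "(\<Union>n. A n) = U \<inter> T"
    proof -
      have "\<exists>n. x \<in> A n" if x: "x \<in> U" "x \<in> T" for x
      proof -
        obtain r where r: "r > 0" "mball x r \<subseteq> U"
          using U x unfolding openin_mtopology by blast
        obtain n where n: "1 / real (Suc n) < r"
          using r(1) nat_approx_posE by blast
        have "1 / real (Suc n) \<le> d x y" if "y \<notin> U" for y
        proof -
          have "r \<le> d x y"
            by (rule ccontr) (use r(2) that in \<open>auto simp: mball_def subset_iff\<close>)
          then show ?thesis using n by simp
        qed
        then show ?thesis using x by (auto simp: A_def)
      qed
      then show ?thesis using A_sub by auto
    qed
    have step: "?H (A m) + ?H (R (Suc m)) \<le> ?H (A (Suc (Suc m)))" for m
    proof -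
      have "?H (A m) + ?H (R (Suc m)) \<le> ?H (A m \<union> R (Suc m))"
      proof (rule hausdorff_outer_separated)
        show "1 / real (Suc m) - 1 / real (Suc (Suc m)) > 0"
          by (simp add: frac_less2)
        fix x y assume x: "x \<in> A m" and y: "y \<in> R (Suc m)"
        then obtain z where z: "z \<notin> U" "d y z < 1 / real (Suc (Suc m))"
          by (auto simp: R_def A_def not_le)
        then have "1 / real (Suc m) \<le> d x z" using x by (auto simp: A_def)
        also have "d x z \<le> d x y + d y z" by (rule triangle) auto
        finally show "1 / real (Suc m) - 1 / real (Suc (Suc m)) \<le> d x y" using z(2) by simp
      qed
      also have "\<dots> \<le> ?H (A (Suc (Suc m)))"
        using A_mono by (intro hausdorff_outer_mono) (auto simp: R_def)
      finally show ?thesis .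
    qed
    \<comment> \<open>Two consecutive sets in the bound handle the rings of even and odd index at the same time.\<close>
    have "(\<Sum>i<m. ?H (R (Suc i))) \<le> ?H (A (Suc m)) + ?H (A m)" for m
    proof (induction m)
      case (Suc m)
      have "(\<Sum>i<Suc m. ?H (R (Suc i))) \<le> ?H (A (Suc m)) + (?H (A m) + ?H (R (Suc m)))"
        using add_right_mono[OF Suc] by (simp add: add.assoc)
      also have "\<dots> \<le> ?H (A (Suc m)) + ?H (A (Suc (Suc m)))"
        by (intro add_left_mono step)
      finally show ?case by (simp add: add.commute)
    qed simp
    also have "?H (A (Suc m)) + ?H (A m) \<le> ?H T + ?H T" for m
      using A_sub by (intro add_mono hausdorff_outer_mono) auto
    finally have bnd: "(\<Sum>i<m. ?H (R (Suc i))) \<le> ?H T + ?H T" for m .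
    have "(\<Sum>i. ?H (R (Suc i))) \<le> ?H T + ?H T"
      by (intro suminf_le_const bnd) auto
    then have fin: "(\<Sum>i. ?H (R (Suc i))) \<noteq> top"
      using False by (auto simp: top_unique)
    have "?H (R (Suc i)) < top" for i
      using fin ennreal_suminf_lessD[of "\<lambda>i. ?H (R (Suc i))" top i] by (simp add: less_top)
    then obtain b where b: "\<And>i. b i \<ge> 0" "\<And>i. ?H (R (Suc i)) = ennreal (b i)"
      using that[of "\<lambda>i. enn2real (?H (R (Suc i)))"] by simp
    have sb: "summable b"
      using fin b by (intro summable_suminf_not_top) auto
    show ?thesis
    proof (rule ennreal_le_epsilon)
      fix e :: real assume "0 < e"
      obtain n where n: "norm (\<Sum>i. b (i + n)) < e"
        using suminf_exist_split[OF \<open>0 < e\<close> sb] by blast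
      have tail: "(\<Sum>i. ?H (R (Suc (i + n)))) \<le> ennreal e"
        using n b sb by (simp add: suminf_ennreal2 ennreal_leI)
      have "U \<inter> T \<subseteq> A (Suc n) \<union> (\<Union>i. R (Suc (i + n)))"
      proof
        fix x assume "x \<in> U \<inter> T"
        then obtain m where m: "x \<in> A m" using A_un by blast
        define l where "l = (LEAST m. x \<in> A m)"
        have l: "x \<in> A l" unfolding l_def by (rule LeastI[of _ m]) fact
        show "x \<in> A (Suc n) \<union> (\<Union>i. R (Suc (i + n)))"
        proof (cases "l \<le> Suc n")
          case True
          then show ?thesis using l lift_Suc_mono_le[of A, OF A_mono] by blast
        next
          case False
          then obtain j where j: "l = Suc (Suc (j + n))"
            by (metis add.commute add_Suc_right less_iff_Suc_add not_le)
          have "x \<notin> A (Suc (j + n))"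
            using not_less_Least[of "Suc (j + n)" "\<lambda>m. x \<in> A m"] j by (auto simp: l_def)
          then have "x \<in> R (Suc (j + n))" using l j by (auto simp: R_def)
          then show ?thesis by blast
        qed
      qed
      then have "?H (U \<inter> T) \<le> ?H (A (Suc n)) + ?H (\<Union>i. R (Suc (i + n)))"
        by (meson hausdorff_outer_mono hausdorff_outer_Un order_trans)
      also have "\<dots> \<le> ?H (A (Suc n)) + ennreal e"
        by (intro add_left_mono order_trans[OF hausdorff_outer_subadditive tail])
      finally have "?H (U \<inter> T) + ?H (T - U) \<le> (?H (A (Suc n)) + ?H (T - U)) + ennreal e"
        by (metis (no_types, lifting) add.assoc add.commute add_right_mono)
      also have "?H (A (Suc n)) + ?H (T - U) \<le> ?H (A (Suc n) \<union> (T - U))"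
        by (rule hausdorff_outer_separated[of "1 / real (Suc (Suc n))"]) (auto simp: A_def)
      also have "\<dots> \<le> ?H T"
        using A_sub by (intro hausdorff_outer_mono) auto
      finally show "?H (U \<inter> T) + ?H (T - U) \<le> ?H T + ennreal e" by simp
    qed
  qed simp
  moreover have "?H T \<le> ?H (U \<inter> T) + ?H (T - U)" for T
    using hausdorff_outer_Un[of d k "U \<inter> T" "T - U"] by (simp add: Un_Diff_Int inf_commute Un_commute)
  moreover have "(UNIV - U) \<inter> T = T - U" for T by auto
  ultimately show ?thesis
    by (auto simp: lambda_system_def intro!: antisym)
qed

lemma space_hausdorff_measure [simp]: "space (hausdorff_measure d k) = UNIV"
  by (simp add: hausdorff_measure_def)

lemma measure_space_hausdorff:
  "measure_space UNIV (lambda_system UNIV UNIV (hausdorff_outer d k)) (hausdorff_outer d k)"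
proof -
  interpret sigma_algebra UNIV "UNIV :: 'a set set"
    using sigma_algebra_Pow[of "UNIV :: 'a set"] by simp
  show ?thesis
    by (rule caratheodory_lemma[OF outer_measure_space_hausdorff])
qed

lemma sets_hausdorff_measure:
  "sets (hausdorff_measure d k) = lambda_system UNIV UNIV (hausdorff_outer d k)"
  using measure_space_hausdorff[of d k]
  by (simp add: hausdorff_measure_def measure_space_def sigma_algebra.sigma_sets_eq)

lemma emeasure_hausdorff_measure:
  "A \<in> sets (hausdorff_measure d k) \<Longrightarrow> emeasure (hausdorff_measure d k) A = hausdorff_outer d k A"
  using measure_space_hausdorff[of d k]
  unfolding sets_hausdorff_measure unfolding hausdorff_measure_def measure_space_def
  by (auto intro!: emeasure_measure_of_sigma)

lemma hausdorff_outer_null_sets: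
  assumes "hausdorff_outer d k N = 0"
  shows "N \<in> null_sets (hausdorff_measure d k)"
proof -
  have "hausdorff_outer d k (N \<inter> T) = 0" for T
    by (rule hausdorff_outer_null_subset[OF _ assms]) auto
  moreover have "hausdorff_outer d k ((UNIV - N) \<inter> T) \<le> hausdorff_outer d k T" for T
    by (rule hausdorff_outer_mono) auto
  moreover have "hausdorff_outer d k T \<le> hausdorff_outer d k (N \<inter> T) + hausdorff_outer d k ((UNIV - N) \<inter> T)" for T
    by (rule order_trans[OF hausdorff_outer_mono hausdorff_outer_Un]) auto
  ultimately have "N \<in> sets (hausdorff_measure d k)"
    unfolding sets_hausdorff_measure lambda_system_def by (auto intro!: antisym)
  then show ?thesis using assms by (auto simp: emeasure_hausdorff_measure)
qed

lemma space_dist_borel [simp]: "space (dist_borel d) = UNIV"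
  by (simp add: dist_borel_def)

lemma openin_dist_borel: "openin (Metric_space.mtopology UNIV d) U \<Longrightarrow> U \<in> sets (dist_borel d)"
  by (simp add: dist_borel_def)

lemma dist_borel_subset_hausdorff_measure:
  assumes "Metric_space UNIV d"
  shows "sets (dist_borel d) \<subseteq> sets (hausdorff_measure d k)"
proof -
  have "sigma_sets UNIV {U. openin (Metric_space.mtopology UNIV d) U} \<subseteq> sets (hausdorff_measure d k)"
    using openin_in_lambda_system[OF assms]
    by (intro sets.sigma_sets_subset[where M = "hausdorff_measure d k", simplified])
       (auto simp: sets_hausdorff_measure)
  then show ?thesis by (simp add: dist_borel_def)
qed

lemma dist_borel_dist: "sets (dist_borel (dist :: 'a::metric_space \<Rightarrow> _)) = sets borel"
  by (simp add: dist_borel_def borel_def mtopology_is_euclidean)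

section \<open>Hausdorff measure of images of small balls\<close>

lemma hausdorff_pre_Un_finite:
  assumes "finite I"
  shows "hausdorff_pre d k \<delta> (\<Union>i\<in>I. A i) \<le> (\<Sum>i\<in>I. hausdorff_pre d k \<delta> (A i))"
  using assms
proof induction
  case (insert i I)
  let ?B = "\<lambda>n::nat. if n = 0 then A i else if n = 1 then (\<Union>i\<in>I. A i) else {}"
  have "hausdorff_pre d k \<delta> (\<Union>n. ?B n) \<le> (\<Sum>n. hausdorff_pre d k \<delta> (?B n))"
    by (rule hausdorff_pre_subadditive)
  also have "(\<Sum>n. hausdorff_pre d k \<delta> (?B n)) = (\<Sum>n<2. hausdorff_pre d k \<delta> (?B n))"
    by (rule suminf_finite) auto
  also have "\<dots> = hausdorff_pre d k \<delta> (A i) + hausdorff_pre d k \<delta> (\<Union>i\<in>I. A i)"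
    by (simp add: numeral_2_eq_2)
  also have "(\<Union>n. ?B n) = (\<Union>i\<in>insert i I. A i)"
  proof safe
    fix x n assume "x \<in> ?B n"
    then show "x \<in> (\<Union>i\<in>insert i I. A i)" by (auto split: if_splits)
  next
    fix x assume "x \<in> A i" then show "x \<in> (\<Union>n. ?B n)" by (intro UN_I[of 0]) auto
  next
    fix x j assume "x \<in> A j" "j \<in> I" then show "x \<in> (\<Union>n. ?B n)" by (intro UN_I[of 1]) auto
  qed
  finally have "hausdorff_pre d k \<delta> (\<Union>i\<in>insert i I. A i)
      \<le> hausdorff_pre d k \<delta> (A i) + hausdorff_pre d k \<delta> (\<Union>i\<in>I. A i)" .
  also have "\<dots> \<le> hausdorff_pre d k \<delta> (A i) + (\<Sum>i\<in>I. hausdorff_pre d k \<delta> (A i))"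
    by (intro add_left_mono insert.IH)
  finally show ?case using insert.hyps by simp
qed simp

lemma hausdorff_pre_le_of_diameter:
  assumes "ediam d A \<le> ennreal D" "0 \<le> D" "D \<le> \<delta>"
  shows "hausdorff_pre d k \<delta> A \<le> ennreal (unit_ball_vol (real k) * (D / 2) ^ k)"
proof -
  let ?B = "\<lambda>n::nat. if n = 0 then A else {}"
  have "hausdorff_pre d k \<delta> A \<le> (\<Sum>n. hausdorff_gauge d k (?B n))"
  proof (rule hausdorff_pre_le)
    show "A \<subseteq> (\<Union>n. ?B n)" by auto
    show "ediam d (?B n) \<le> ennreal \<delta>" for n
      using assms by (auto simp: ediam_def intro: order_trans ennreal_leI)
  qed
  also have "\<dots> = (\<Sum>n<1. hausdorff_gauge d k (?B n))"
    by (rule suminf_finite) auto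
  also have "\<dots> \<le> ennreal (unit_ball_vol (real k) / 2 ^ k) * ennreal D ^ k"
    using assms(1) by (auto simp: hausdorff_gauge_def intro!: mult_left_mono power_mono)
  also have "\<dots> = ennreal (unit_ball_vol (real k) * (D / 2) ^ k)"
    using assms(2) by (simp add: ennreal_power ennreal_mult[symmetric] power_divide)
  finally show ?thesis .
qed

text \<open>
  Hausdorff measure of an image from a local estimate: the Vitali covering lemma chooses disjoint
  balls in \<open>U\<close> whose fivefold enlargements cover \<open>S\<close>, and the volumes of the small balls sum up to at
  most that of \<open>U\<close>. It suffices that every point has arbitrarily small good radii, without any
  uniformity in the point.
\<close>

lemma hausdorff_outer_le_local_density:
  fixes f :: "'a::euclidean_space \<Rightarrow> 'b"
  assumes U: "open U" "S \<subseteq> U"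
    and loc: "\<And>u \<rho> \<delta>. u \<in> S \<Longrightarrow> 0 < \<rho> \<Longrightarrow> 0 < \<delta> \<Longrightarrow> \<exists>r. 0 < r \<and> r < \<rho> \<and>
       hausdorff_pre d k \<delta> (f ` (S \<inter> cball u (5 * r))) \<le> \<theta> * emeasure lborel (cball u r)"
  shows "hausdorff_outer d k (f ` S) \<le> \<theta> * emeasure lborel U"
proof (rule hausdorff_outer_least)
  fix \<delta> :: real assume "0 < \<delta>"
  define K where "K = {(u, r). 0 < r \<and> r \<le> 1 \<and> cball u r \<subseteq> U \<and>
      hausdorff_pre d k \<delta> (f ` (S \<inter> cball u (5 * r))) \<le> \<theta> * emeasure lborel (cball u r)}"
  have "S \<subseteq> fst ` K"
  proof
    fix u assume u: "u \<in> S"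
    then obtain t where t: "t > 0" "cball u t \<subseteq> U"
      using U unfolding open_contains_cball by blast
    obtain r where r: "0 < r" "r < min t 1"
      "hausdorff_pre d k \<delta> (f ` (S \<inter> cball u (5 * r))) \<le> \<theta> * emeasure lborel (cball u r)"
      using loc[OF u, of "min t 1" \<delta>] t(1) \<open>0 < \<delta>\<close> by auto
    have "cball u r \<subseteq> U" using r(2) t(2) by (meson less_imp_le min_less_iff_conj order_trans subset_cball)
    then have "(u, r) \<in> K" using r by (simp add: K_def)
    then show "u \<in> fst ` K" by force
  qed
  then obtain I :: "nat set" and a r where I: "\<And>i. i \<in> I \<Longrightarrow> (a i, r i) \<in> K"
    "disjoint_family_on (\<lambda>i. cball (a i) (r i)) I" "S \<subseteq> (\<Union>i\<in>I. cball (a i) (5 * r i))"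
    by (rule Vitali_sequence[of S K 1]) (auto simp: K_def)
  let ?A = "\<lambda>i. if i \<in> I then f ` (S \<inter> cball (a i) (5 * r i)) else {}"
  have "hausdorff_pre d k \<delta> (f ` S) \<le> hausdorff_pre d k \<delta> (\<Union>i. ?A i)"
  proof (rule hausdorff_pre_mono, clarify)
    fix x assume "x \<in> S"
    then obtain i where "i \<in> I" "x \<in> cball (a i) (5 * r i)" using I(3) by blast
    then show "f x \<in> (\<Union>i. ?A i)" using \<open>x \<in> S\<close> by (intro UN_I[of i]) auto
  qed
  also have "\<dots> \<le> (\<Sum>i. hausdorff_pre d k \<delta> (?A i))"
    by (rule hausdorff_pre_subadditive)
  also have "\<dots> \<le> (\<Sum>i. \<theta> * (if i \<in> I then emeasure lborel (cball (a i) (r i)) else 0))"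
    using I(1) by (intro suminf_le) (auto simp: K_def)
  also have "\<dots> = \<theta> * (\<Sum>i. if i \<in> I then emeasure lborel (cball (a i) (r i)) else 0)"
    by (rule ennreal_suminf_cmult)
  also have "\<dots> \<le> \<theta> * emeasure lborel U"
    using I U by (intro mult_left_mono suminf_emeasure_disjoint_le) (auto simp: K_def)
  finally show "hausdorff_pre d k \<delta> (f ` S) \<le> \<theta> * emeasure lborel U" .
qed

text \<open>
  The local estimate holds with a constant that depends on the Lipschitz constant only, and the
  open set around \<open>N\<close> can be chosen with arbitrarily small volume.
\<close>

lemma hausdorff_outer_Lipschitz_negligible:
  fixes f :: "'a::euclidean_space \<Rightarrow> 'b"
  assumes N: "negligible N" and lip: "\<And>u v. u \<in> N \<Longrightarrow> v \<in> N \<Longrightarrow> d (f u) (f v) \<le> L * dist u v"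
  shows "hausdorff_outer d DIM('a) (f ` N) = 0"
proof -
  define B where "B = max L 1"
  have B: "B > 0" by (simp add: B_def)
  have lipB: "d (f u) (f v) \<le> B * dist u v" if "u \<in> N" "v \<in> N" for u v
    by (rule order_trans[OF lip[OF that]]) (simp add: B_def mult_right_mono)
  \<comment> \<open>The image of a ball of radius \<open>5 * r\<close> has diameter at most \<open>10 * B * r\<close>, and half of this is \<open>5 * B * r\<close>.\<close>
  let ?\<theta> = "ennreal ((5 * B) ^ DIM('a))"
  have le: "hausdorff_outer d DIM('a) (f ` N) \<le> ?\<theta> * emeasure lborel U" if U: "open U" "N \<subseteq> U" for U
  proof (rule hausdorff_outer_le_local_density[OF U])
    fix u \<rho> \<delta> :: real and x :: 'a assume "0 < \<rho>" "0 < \<delta>"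
    define r where "r = min (\<rho> / 2) (\<delta> / (10 * B))"
    have r: "0 < r" "r < \<rho>" "10 * B * r \<le> \<delta>"
      using \<open>0 < \<rho>\<close> \<open>0 < \<delta>\<close> B by (auto simp: r_def min_def field_simps)
    have "hausdorff_pre d DIM('a) \<delta> (f ` (N \<inter> cball x (5 * r))) \<le> ennreal (unit_ball_vol (real DIM('a)) * (10 * B * r / 2) ^ DIM('a))"
    proof (rule hausdorff_pre_le_of_diameter[OF _ _ r(3)])
      show "ediam d (f ` (N \<inter> cball x (5 * r))) \<le> ennreal (10 * B * r)"
      proof (rule ediam_least, clarify)
        fix v w assume vw: "v \<in> N" "v \<in> cball x (5 * r)" "w \<in> N" "w \<in> cball x (5 * r)"
        have "dist v w \<le> dist x v + dist x w" by (rule dist_triangle3)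
        then have "dist v w \<le> 10 * r" using vw by simp
        then have "B * dist v w \<le> B * (10 * r)" using B by (intro mult_left_mono) auto
        then show "ennreal (d (f v) (f w)) \<le> ennreal (10 * B * r)"
          using lipB[OF vw(1,3)] by (intro ennreal_leI) simp
      qed
    qed (use B r in auto)
    also have "\<dots> = ?\<theta> * emeasure lborel (cball x r)"
    proof -
      have "10 * B * r / 2 = (5 * B) * r" by simp
      then show ?thesis
        using B r by (simp only: power_mult_distrib emeasure_cball less_imp_le)
          (simp add: ennreal_mult[symmetric] power_mult_distrib mult_ac)
    qed
    finally show "\<exists>r. 0 < r \<and> r < \<rho> \<and> hausdorff_pre d DIM('a) \<delta> (f ` (N \<inter> cball x (5 * r))) \<le> ?\<theta> * emeasure lborel (cball x r)"
      using r by blast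
  qed
  have "hausdorff_outer d DIM('a) (f ` N) \<le> 0"
  proof (rule ennreal_le_epsilon)
    fix e :: real assume "0 < e"
    define e' where "e' = e / (5 * B) ^ DIM('a)"
    have e': "e' > 0" using \<open>0 < e\<close> B by (simp add: e'_def)
    have "N \<in> sets lebesgue" using N by (rule negligible_imp_sets)
    from sets_lebesgue_outer_open[OF this e'] obtain U where U: "open U" "N \<subseteq> U" "emeasure lebesgue (U - N) < ennreal e'"
      by metis
    have "emeasure lborel U \<le> emeasure lebesgue (U - N) + emeasure lebesgue N"
    proof -
      have "emeasure lborel U = emeasure lebesgue ((U - N) \<union> N)"
        using U by (simp add: Un_absorb2)
      also have "\<dots> \<le> emeasure lebesgue (U - N) + emeasure lebesgue N"
        using U(1) N by (intro emeasure_subadditive) (auto simp: negligible_imp_sets)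
      finally show ?thesis .
    qed
    also have "emeasure lebesgue N = 0" using N by (simp add: negligible_iff_null_sets null_sets_def)
    finally have "emeasure lborel U \<le> ennreal e'" using U(3) by (simp add: less_imp_le order_trans)
    then have "hausdorff_outer d DIM('a) (f ` N) \<le> ?\<theta> * ennreal e'"
      by (intro order_trans[OF le[OF U(1,2)]] mult_left_mono) auto
    also have "\<dots> = ennreal e"
      using e' B by (simp add: ennreal_mult[symmetric] e'_def)
    finally show "hausdorff_outer d DIM('a) (f ` N) \<le> 0 + ennreal e" by simp
  qed
  then show ?thesis by simp
qed

text \<open>
  Subtract a multiple of a kernel vector so that one coordinate vanishes. The coordinate \<open>j\<close> where the
  kernel vector is largest is chosen, which keeps the other coordinates bounded.
\<close>

lemma degenerate_linear_projection:
  fixes D :: "'a::euclidean_space \<Rightarrow> 'b::real_vector"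
  assumes D: "linear D" and "\<not> inj D"
  obtains j P where "j \<in> Basis" "\<And>h. D (P h) = D h" "\<And>h. P h \<bullet> j = 0"
    "\<And>h i. i \<in> Basis \<Longrightarrow> \<bar>P h \<bullet> i\<bar> \<le> 2 * norm h"
proof -
  obtain e where e: "e \<noteq> 0" "D e = 0"
    using assms linear_injective_0 by blast
  have "\<exists>j\<in>Basis. \<forall>i\<in>Basis. \<bar>e \<bullet> i\<bar> \<le> \<bar>e \<bullet> j\<bar>"
  proof -
    have "Max ((\<lambda>i. \<bar>e \<bullet> i\<bar>) ` Basis) \<in> (\<lambda>i. \<bar>e \<bullet> i\<bar>) ` Basis"
      by (intro Max_in) auto
    then obtain j where "j \<in> Basis" "Max ((\<lambda>i. \<bar>e \<bullet> i\<bar>) ` Basis) = \<bar>e \<bullet> j\<bar>" by blast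
    then show ?thesis by (metis Max_ge finite_Basis finite_imageI image_eqI)
  qed
  then obtain j where j: "j \<in> Basis" "\<And>i. i \<in> Basis \<Longrightarrow> \<bar>e \<bullet> i\<bar> \<le> \<bar>e \<bullet> j\<bar>" by blast
  have ej: "e \<bullet> j \<noteq> 0"
  proof
    assume "e \<bullet> j = 0"
    then have "\<forall>i\<in>Basis. e \<bullet> i = 0" using j(2) by auto
    then show False using e(1) euclidean_eq_iff[of e 0] by auto
  qed
  define P where "P h = h - ((h \<bullet> j) / (e \<bullet> j)) *\<^sub>R e" for h
  show thesis
  proof (rule that[of j P])
    show "D (P h) = D h" for h
      using e(2) by (simp add: P_def linear_diff[OF D] linear_cmul[OF D])
    show "P h \<bullet> j = 0" for h using ej by (simp add: P_def inner_diff_left)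
    show "\<bar>P h \<bullet> i\<bar> \<le> 2 * norm h" if i: "i \<in> Basis" for h i
    proof -
      have "\<bar>(h \<bullet> j) / (e \<bullet> j) * (e \<bullet> i)\<bar> = \<bar>h \<bullet> j\<bar> * (\<bar>e \<bullet> i\<bar> / \<bar>e \<bullet> j\<bar>)"
        by (simp add: abs_mult)
      also have "\<dots> \<le> norm h * 1"
        using j i ej by (intro mult_mono Basis_le_norm) (auto simp: divide_le_eq)
      finally have "\<bar>(h \<bullet> j) / (e \<bullet> j) * (e \<bullet> i)\<bar> \<le> norm h" by simp
      moreover have "P h \<bullet> i = h \<bullet> i - (h \<bullet> j) / (e \<bullet> j) * (e \<bullet> i)"
        by (simp add: P_def inner_diff_left)
      ultimately show ?thesis
        using Basis_le_norm[OF i, of h] by linarith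
    qed
  qed (rule j(1))
qed

text \<open>
  If \<open>D\<close> is not injective, the image of the ball is essentially that of a ball of one dimension less. A
  grid of mesh \<open>2 * R / m\<close> in the remaining coordinates has about \<open>m ^ (DIM('a) - 1)\<close> cells, and each
  cell has an image of diameter of order \<open>R / m\<close>. The resulting bound is smaller than
  \<open>R ^ DIM('a)\<close> by a factor of order \<open>1 / m\<close>.
\<close>

lemma hausdorff_pre_degenerate:
  fixes f :: "'a::euclidean_space \<Rightarrow> 'b" and D :: "'a \<Rightarrow> 'c::euclidean_space"
    and B R \<delta> :: real and m :: nat
  assumes D: "linear D" and "\<not> inj D" and B: "B > 0" "\<And>x. norm (D x) \<le> B * norm x"
    and "0 < R" "0 < m" and \<delta>: "4 * B * DIM('a) * R / m \<le> \<delta>"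
    and f: "\<And>w w'. w \<in> A \<inter> cball u R \<Longrightarrow> w' \<in> A \<inter> cball u R \<Longrightarrow>
       d (f w) (f w') \<le> norm (D (w - w')) + 2 * B * DIM('a) * R / m"
  shows "hausdorff_pre d DIM('a) \<delta> (f ` (A \<inter> cball u R)) \<le>
    ennreal ((2 * real m + 1) ^ (DIM('a) - 1) * (unit_ball_vol DIM('a) * (2 * B * DIM('a) * R / m) ^ DIM('a)))"
proof -
  obtain j P where j: "j \<in> Basis" "\<And>h. D (P h) = D h" "\<And>h. P h \<bullet> j = 0"
    "\<And>h i. i \<in> Basis \<Longrightarrow> \<bar>P h \<bullet> i\<bar> \<le> 2 * norm h"
    using degenerate_linear_projection[OF assms(1,2)] by metis
  define s where "s = 2 * R / m"
  have s: "s > 0" using assms by (simp add: s_def)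
  define cell where "cell w = (\<lambda>i\<in>Basis - {j}. \<lfloor>(P (w - u) \<bullet> i) / s\<rfloor>)" for w
  define C where "C = (PiE (Basis - {j}) (\<lambda>_. {- int m..int m}))"
  have C: "finite C" "card C = (2 * m + 1) ^ (DIM('a) - 1)"
    using j(1) by (auto simp: C_def card_PiE nat_add_distrib nat_mult_distrib intro!: finite_PiE)
  have cell: "cell w \<in> C" if w: "w \<in> cball u R" for w
    unfolding cell_def C_def
  proof (rule restrict_PiE_iff[THEN iffD2], intro ballI)
    fix i assume i: "i \<in> Basis - {j}"
    have "\<bar>P (w - u) \<bullet> i\<bar> \<le> 2 * R"
      using j(4)[of i "w - u"] i w by (auto simp: dist_norm norm_minus_commute)
    also have "2 * R = real m * s" using \<open>0 < m\<close> by (simp add: s_def)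
    finally have "\<bar>(P (w - u) \<bullet> i) / s\<bar> \<le> real m"
      using s by (simp add: divide_le_eq)
    then show "\<lfloor>(P (w - u) \<bullet> i) / s\<rfloor> \<in> {- int m..int m}"
      unfolding abs_le_iff by (simp add: le_floor_iff floor_le_iff)
  qed
  have same: "norm (D (w - w')) \<le> B * (DIM('a) * s)" if "cell w = cell w'" for w w'
  proof -
    have "\<bar>(P (w - u) - P (w' - u)) \<bullet> i\<bar> \<le> s" if i: "i \<in> Basis" for i
    proof (cases "i = j")
      case True
      then show ?thesis using j(3) s by (simp add: inner_diff_left)
    next
      case False
      then have "\<lfloor>(P (w - u) \<bullet> i) / s\<rfloor> = \<lfloor>(P (w' - u) \<bullet> i) / s\<rfloor>"
        using fun_cong[OF \<open>cell w = cell w'\<close>, of i] i by (simp add: cell_def)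
      then have "\<bar>(P (w - u) \<bullet> i) / s - (P (w' - u) \<bullet> i) / s\<bar> \<le> 1" by linarith
      then have "\<bar>P (w - u) \<bullet> i - P (w' - u) \<bullet> i\<bar> / s \<le> 1"
        using s by (simp add: diff_divide_distrib[symmetric])
      then show ?thesis using s by (simp add: inner_diff_left)
    qed
    then have "(\<Sum>i\<in>Basis. \<bar>(P (w - u) - P (w' - u)) \<bullet> i\<bar>) \<le> (\<Sum>i\<in>(Basis :: 'a set). s)"
      by (intro sum_mono)
    with norm_le_l1[of "P (w - u) - P (w' - u)"] have "norm (P (w - u) - P (w' - u)) \<le> DIM('a) * s"
      by simp
    then have "B * norm (P (w - u) - P (w' - u)) \<le> B * (DIM('a) * s)"
      using B by (intro mult_left_mono) auto
    moreover have "D (w - w') = D (P (w - u) - P (w' - u))"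
      by (simp add: linear_diff[OF D] j(2))
    ultimately show ?thesis using B(2)[of "P (w - u) - P (w' - u)"] by simp
  qed
  define X where "X c = f ` {w \<in> A \<inter> cball u R. cell w = c}" for c
  have X: "hausdorff_pre d DIM('a) \<delta> (X c) \<le> ennreal (unit_ball_vol DIM('a) * (4 * B * DIM('a) * R / m / 2) ^ DIM('a))" for c
  proof (rule hausdorff_pre_le_of_diameter[OF _ _ \<delta>])
    show "ediam d (X c) \<le> ennreal (4 * B * DIM('a) * R / m)"
    proof (rule ediam_least)
      fix x y assume "x \<in> X c" "y \<in> X c"
      then obtain w w' where w: "w \<in> A \<inter> cball u R" "w' \<in> A \<inter> cball u R" "cell w = cell w'" "x = f w" "y = f w'"
        by (auto simp: X_def)
      have "d x y \<le> B * (DIM('a) * s) + 2 * B * DIM('a) * R / m"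
        using f[OF w(1,2)] same[OF w(3)] w(4,5) by simp
      also have "\<dots> = 4 * B * DIM('a) * R / m" by (simp add: s_def)
      finally show "ennreal (d x y) \<le> ennreal (4 * B * DIM('a) * R / m)" by (rule ennreal_leI)
    qed
  qed (use B \<open>0 < R\<close> in auto)
  have "f ` (A \<inter> cball u R) \<subseteq> (\<Union>c\<in>C. X c)"
    using cell unfolding X_def by blast
  then have "hausdorff_pre d DIM('a) \<delta> (f ` (A \<inter> cball u R)) \<le> (\<Sum>c\<in>C. hausdorff_pre d DIM('a) \<delta> (X c))"
    by (rule order_trans[OF hausdorff_pre_mono hausdorff_pre_Un_finite[OF C(1)]])
  also have "\<dots> \<le> (\<Sum>c\<in>C. ennreal (unit_ball_vol DIM('a) * (4 * B * DIM('a) * R / m / 2) ^ DIM('a)))"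
    by (intro sum_mono X)
  also have "\<dots> = ennreal (real (card C)) * ennreal (unit_ball_vol DIM('a) * (2 * B * DIM('a) * R / m) ^ DIM('a))"
  proof -
    have "4 * B * DIM('a) * R / m / 2 = 2 * B * DIM('a) * R / m" by simp
    then show ?thesis by (simp only: sum_constant ennreal_of_nat_eq_real_of_nat)
  qed
  also have "\<dots> = ennreal ((2 * real m + 1) ^ (DIM('a) - 1) * (unit_ball_vol DIM('a) * (2 * B * DIM('a) * R / m) ^ DIM('a)))"
    using B \<open>0 < R\<close> by (subst ennreal_mult[symmetric]) (auto simp: C(2) add.commute)
  finally show ?thesis .
qed

section \<open>The Carnot-Caratheodory distance\<close>

text \<open>
  The standard symplectic form. Twice its value is the vertical term of the group law.
\<close>

definition symp :: "(real^'n) \<times> (real^'n) \<Rightarrow> (real^'n) \<times> (real^'n) \<Rightarrow> real" where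
  "symp v w = snd v \<bullet> fst w - fst v \<bullet> snd w"

lemma symp_self [simp]: "symp v v = 0"
  by (simp add: symp_def inner_commute)

lemma symp_simps:
  "symp (u + v) w = symp u w + symp v w" "symp u (v + w) = symp u v + symp u w"
  "symp (u - v) w = symp u w - symp v w" "symp u (v - w) = symp u v - symp u w"
  "symp (c *\<^sub>R u) v = c * symp u v" "symp u (c *\<^sub>R v) = c * symp u v"
  "symp 0 v = 0" "symp v 0 = 0"
  by (simp_all add: symp_def inner_simps algebra_simps)

lemma symp_minus: "symp (- u) v = - symp u v" "symp u (- v) = - symp u v"
  by (simp_all add: symp_def)

lemma symp_skew: "symp v w = - symp w v"
  by (simp add: symp_def inner_commute)

lemma symp_eq_inner: "symp v w = (snd v, - fst v) \<bullet> w"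
  by (simp add: symp_def inner_prod_def)

lemma abs_symp_le: "\<bar>symp v w\<bar> \<le> norm v * norm w"
proof -
  have "norm (snd v, - fst v) = norm v"
    by (simp add: norm_prod_def add.commute)
  then show ?thesis
    using Cauchy_Schwarz_ineq2[of "(snd v, - fst v)" w] by (simp add: symp_eq_inner)
qed

lemma heis_proj_alt: "heis_proj p = (fst p, fst (snd p))"
  by (simp add: heis_proj_def split: prod.split)

abbreviation heis_t :: "'n::finite heis \<Rightarrow> real" where "heis_t p \<equiv> snd (snd p)"

lemma heis_eqI: "heis_proj p = heis_proj q \<Longrightarrow> heis_t p = heis_t q \<Longrightarrow> p = q"
  by (simp add: heis_proj_alt prod_eq_iff)

lemma linear_heis_proj: "linear heis_proj"
  by (rule linearI) (auto simp: heis_proj_alt)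

lemma bounded_linear_heis_proj: "bounded_linear heis_proj"
  using linear_heis_proj linear_conv_bounded_linear by blast

lemma bounded_linear_heis_t: "bounded_linear (heis_t :: 'n::finite heis \<Rightarrow> real)"
  by (intro bounded_linear_compose[OF bounded_linear_snd bounded_linear_snd])

text \<open>
  The vertical coordinate of \<open>p\<inverse> * q\<close>, which is invariant under left translations.
\<close>

definition heis_tau :: "'n::finite heis \<Rightarrow> 'n heis \<Rightarrow> real" where
  "heis_tau p q = heis_t q - heis_t p - 2 * symp (heis_proj p) (heis_proj q)"

lemma heis_tau_self [simp]: "heis_tau p p = 0"
  by (simp add: heis_tau_def)

text \<open>
  The vertical coordinate is additive along a path up to twice the symplectic area that the path spans.
\<close>

lemma heis_tau_cocycle:
  "heis_tau p r = heis_tau p q + heis_tau q r + 2 * symp (heis_proj q - heis_proj p) (heis_proj r - heis_proj q)"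
  by (simp add: heis_tau_def symp_simps algebra_simps)

lemma heis_proj_mult: "heis_proj (heis_mult p q) = heis_proj p + heis_proj q"
  by (cases p; cases q) (simp add: heis_mult_def heis_proj_def)

lemma heis_t_mult: "heis_t (heis_mult p q) = heis_t p + heis_t q + 2 * symp (heis_proj p) (heis_proj q)"
  by (cases p; cases q) (simp add: heis_mult_def heis_proj_def symp_def inner_vec_def sum_subtractf)

lemma heis_proj_lift: "heis_proj (fst z, snd z, t) = z"
  by (simp add: heis_proj_def)

lemma horizontal_space_eq:
  "horizontal_space p = {v. heis_t v = 2 * symp (heis_proj p) (heis_proj v)}"
proof
  have "subspace {v. heis_t v = 2 * symp (heis_proj p) (heis_proj v)}"
    by (auto simp: subspace_def linear_0[OF linear_heis_proj] linear_add[OF linear_heis_proj]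
        linear_cmul[OF linear_heis_proj] symp_simps)
  moreover have "range (\<lambda>j. heis_X j p) \<union> range (\<lambda>j. heis_Y j p) \<subseteq> {v. heis_t v = 2 * symp (heis_proj p) (heis_proj v)}"
    by (auto simp: heis_X_def heis_Y_def heis_proj_alt symp_def inner_axis split: prod.split)
  ultimately show "horizontal_space p \<subseteq> {v. heis_t v = 2 * symp (heis_proj p) (heis_proj v)}"
    unfolding horizontal_space_def by (intro span_minimal)
  show "{v. heis_t v = 2 * symp (heis_proj p) (heis_proj v)} \<subseteq> horizontal_space p"
  proof safe
    fix a b :: "real^'a" and c :: real assume *: "heis_t (a, b, c) = 2 * symp (heis_proj p) (heis_proj (a, b, c))"
    have "(a, b, c) = heis_frame p (a, b, 0)"
      using * by (cases p) (simp add: heis_frame_eq heis_proj_alt symp_def inner_vec_def sum_subtractf)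
    also have "\<dots> = (\<Sum>j\<in>UNIV. a $ j *\<^sub>R heis_X j p) + (\<Sum>j\<in>UNIV. b $ j *\<^sub>R heis_Y j p)"
      by (simp add: heis_frame_def)
    also have "\<dots> \<in> horizontal_space p"
      unfolding horizontal_space_def by (intro span_add span_sum span_scale span_base) auto
    finally show "(a, b, c) \<in> horizontal_space p" .
  qed
qed

lemma heis_speed_horizontal:
  assumes "v \<in> horizontal_space p"
  shows "sqrt (heis_metric p v v) = norm (heis_proj v)"
proof -
  have "v = heis_frame p (fst v, fst (snd v), 0)"
    using assms by (cases p; cases v) (simp add: horizontal_space_eq heis_frame_eq heis_proj_alt symp_def inner_vec_def sum_subtractf)
  then have "heis_metric p v v = (fst v, fst (snd v), 0::real) \<bullet> (fst v, fst (snd v), 0::real)"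
    using heis_metric_frame by metis
  then show ?thesis
    by (simp add: heis_proj_alt norm_eq_sqrt_inner inner_prod_def)
qed

text \<open>
  The fundamental theorem of calculus for Lipschitz curves. The derivative exists almost everywhere by
  hypothesis; its integrability comes from the density found in the scalar case, with which it
  agrees almost everywhere.
\<close>

lemma Lipschitz_has_integral_derivative:
  fixes \<gamma> :: "real \<Rightarrow> 'a::euclidean_space"
  assumes "a < b" and lip: "L-lipschitz_on {a..b} \<gamma>" and "negligible N"
    and v: "\<And>s. s \<in> {a<..<b} - N \<Longrightarrow> (\<gamma> has_vector_derivative v s) (at s)"
  shows "(v has_integral \<gamma> b - \<gamma> a) {a..b}" "v absolutely_integrable_on {a..b}"
proof -
  define \<gamma>' where "\<gamma>' s = \<gamma> (max a (min b s))" for s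
  have clamp: "max a (min b s) \<in> {a..b}" for s using \<open>a < b\<close> by auto
  have "\<exists>g M. negligible M \<and> (\<forall>s. s \<notin> M \<longrightarrow> ((\<lambda>s. \<gamma>' s \<bullet> i) has_real_derivative g s) (at s))
      \<and> (\<forall>c d. c \<le> d \<longrightarrow> (g has_integral \<gamma>' d \<bullet> i - \<gamma>' c \<bullet> i) {c..d})
      \<and> (\<forall>c d. g absolutely_integrable_on {c..d})" if i: "i \<in> Basis" for i
  proof (rule Lipschitz_ae_has_derivative)
    show "L-lipschitz_on UNIV (\<lambda>s. \<gamma>' s \<bullet> i)"
    proof (rule lipschitz_onI[OF _ lipschitz_on_nonneg[OF lip]])
      fix s t
      have "dist (\<gamma>' s \<bullet> i) (\<gamma>' t \<bullet> i) \<le> dist (\<gamma>' s) (\<gamma>' t)"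
        using Basis_le_norm[OF i, of "\<gamma>' s - \<gamma>' t"] by (simp add: dist_norm inner_diff_left)
      also have "\<dots> \<le> L * dist (max a (min b s)) (max a (min b t))"
        unfolding \<gamma>'_def by (intro lipschitz_onD[OF lip] clamp)
      also have "\<dots> \<le> L * dist s t"
        by (intro mult_left_mono lipschitz_on_nonneg[OF lip]) (auto simp: dist_real_def)
      finally show "dist (\<gamma>' s \<bullet> i) (\<gamma>' t \<bullet> i) \<le> L * dist s t" .
    qed
  qed
  then have "\<forall>i\<in>Basis. \<exists>gM. negligible (snd gM) \<and> (\<forall>s. s \<notin> snd gM \<longrightarrow> ((\<lambda>s. \<gamma>' s \<bullet> i) has_real_derivative fst gM s) (at s))
      \<and> (\<forall>c d. c \<le> d \<longrightarrow> (fst gM has_integral \<gamma>' d \<bullet> i - \<gamma>' c \<bullet> i) {c..d})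
      \<and> (\<forall>c d. fst gM absolutely_integrable_on {c..d})" by (simp add: split_paired_Ex)
  from bchoice[OF this] obtain gM where gM: "\<forall>i\<in>Basis. negligible (snd (gM i)) \<and> (\<forall>s. s \<notin> snd (gM i) \<longrightarrow> ((\<lambda>s. \<gamma>' s \<bullet> i) has_real_derivative fst (gM i) s) (at s))
      \<and> (\<forall>c d. c \<le> d \<longrightarrow> (fst (gM i) has_integral \<gamma>' d \<bullet> i - \<gamma>' c \<bullet> i) {c..d})
      \<and> (\<forall>c d. fst (gM i) absolutely_integrable_on {c..d})" ..
  define N' where "N' i = N \<union> snd (gM i) \<union> {a, b}" for i
  have N': "negligible (N' i)" if "i \<in> Basis" for i
    using gM \<open>negligible N\<close> that by (auto simp: N'_def intro!: negligible_Un)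
  have eq: "v s \<bullet> i = fst (gM i) s" if i: "i \<in> Basis" and s: "s \<in> {a..b} - N' i" for i s
  proof -
    have s': "s \<in> {a<..<b} - N" "s \<notin> snd (gM i)" using s by (auto simp: N'_def)
    have "((\<lambda>t. \<gamma> t \<bullet> i) has_vector_derivative v s \<bullet> i) (at s)"
      using bounded_linear.has_vector_derivative[OF bounded_linear_inner_left v[OF s'(1)]] .
    moreover have "((\<lambda>t. \<gamma> t \<bullet> i) has_vector_derivative fst (gM i) s) (at s)"
    proof (rule has_vector_derivative_transform_within_open)
      show "((\<lambda>t. \<gamma>' t \<bullet> i) has_vector_derivative fst (gM i) s) (at s)"
        using gM i s'(2) by (simp add: has_real_derivative_iff_has_vector_derivative)
      show "open {a<..<b}" "s \<in> {a<..<b}" using s' by auto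
      show "\<gamma>' t \<bullet> i = \<gamma> t \<bullet> i" if "t \<in> {a<..<b}" for t
        using that by (simp add: \<gamma>'_def min_def max_def)
    qed
    ultimately show ?thesis by (rule vector_derivative_unique_at)
  qed
  have ends: "\<gamma>' a = \<gamma> a" "\<gamma>' b = \<gamma> b" using \<open>a < b\<close> by (auto simp: \<gamma>'_def)
  have comp: "((\<lambda>s. v s \<bullet> i) has_integral (\<gamma> b - \<gamma> a) \<bullet> i) {a..b}" if i: "i \<in> Basis" for i
  proof (rule has_integral_spike[OF N'[OF i]])
    show "(fst (gM i) has_integral (\<gamma> b - \<gamma> a) \<bullet> i) {a..b}"
      using gM i \<open>a < b\<close> by (simp add: inner_diff_left ends[symmetric])
  qed (rule eq[OF i])
  then show "(v has_integral \<gamma> b - \<gamma> a) {a..b}"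
    by (rule has_integral_componentwise)
  show "v absolutely_integrable_on {a..b}"
  proof (rule absolutely_integrable_componentwise)
    fix i :: 'a assume i: "i \<in> Basis"
    show "(\<lambda>s. v s \<bullet> i) absolutely_integrable_on {a..b}"
      by (rule absolutely_integrable_spike[OF _ N'[OF i]]) (use gM i eq[OF i] in auto)
  qed
qed

text \<open>
  The points are joined by a horizontal Lipschitz curve of length \<open>l\<close>. In contrast to
  \<open>horizontal_curve\<close> and \<open>heis_length\<close>, the velocity \<open>v\<close> is part of the data, the derivatives are
  two-sided and exist off a null set, and the length is stated with \<open>has_integral\<close>. This makes
  reparametrisation and concatenation direct.
\<close>

definition heis_join :: "'n::finite heis \<Rightarrow> 'n heis \<Rightarrow> real \<Rightarrow> bool" where
  "heis_join p q l \<longleftrightarrow> (\<exists>a b \<gamma> v L N. a < b \<and> L-lipschitz_on {a..b} \<gamma> \<and> negligible N \<and>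
     (\<forall>s\<in>{a<..<b} - N. (\<gamma> has_vector_derivative v s) (at s) \<and> v s \<in> horizontal_space (\<gamma> s)) \<and>
     ((\<lambda>s. norm (heis_proj (v s))) has_integral l) {a..b} \<and> \<gamma> a = p \<and> \<gamma> b = q)"

lemma horizontal_curve_alt:
  assumes "a < b"
  shows "horizontal_curve a b \<gamma> \<longleftrightarrow> (\<exists>L. L-lipschitz_on {a..b} \<gamma>) \<and>
    (\<exists>N. negligible N \<and> (\<forall>s\<in>{a<..<b} - N. \<exists>v\<in>horizontal_space (\<gamma> s). (\<gamma> has_vector_derivative v) (at s)))"
proof -
  let ?P = "\<lambda>s. \<exists>v\<in>horizontal_space (\<gamma> s). (\<gamma> has_vector_derivative v) (at s within {a..b})"
  have within: "at s within {a..b} = at s" if "s \<in> {a<..<b}" for s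
    using that by (intro at_within_interior) auto
  have "(AE s in lebesgue_on {a..b}. ?P s) \<longleftrightarrow> (\<exists>N. negligible N \<and> (\<forall>s\<in>{a..b} - N. ?P s))"
  proof -
    have "(AE s in lebesgue_on {a..b}. ?P s) \<longleftrightarrow> (\<exists>N\<in>null_sets lebesgue. {s. \<not> (s \<in> {a..b} \<longrightarrow> ?P s)} \<subseteq> N)"
      by (subst AE_restrict_space_iff) (simp_all add: eventually_ae_filter)
    also have "\<dots> \<longleftrightarrow> (\<exists>N. negligible N \<and> {s. \<not> (s \<in> {a..b} \<longrightarrow> ?P s)} \<subseteq> N)"
      by (simp only: negligible_iff_null_sets Bex_def)
    also have "\<dots> \<longleftrightarrow> (\<exists>N. negligible N \<and> (\<forall>s\<in>{a..b} - N. ?P s))"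
      by (intro ex_cong1 conj_cong refl) blast
    finally show ?thesis .
  qed
  also have "\<dots> \<longleftrightarrow> (\<exists>N. negligible N \<and> (\<forall>s\<in>{a<..<b} - N. ?P s))"
  proof safe
    fix N :: "real set" assume N: "negligible N" "\<forall>s\<in>{a<..<b} - N. ?P s"
    then show "\<exists>N. negligible N \<and> (\<forall>s\<in>{a..b} - N. ?P s)"
      by (intro exI[of _ "insert a (insert b N)"]) auto
  qed (meson DiffD1 DiffD2 DiffI greaterThanLessThan_subseteq_atLeastAtMost_iff order_refl subset_iff)
  also have "\<dots> \<longleftrightarrow> (\<exists>N. negligible N \<and> (\<forall>s\<in>{a<..<b} - N. \<exists>v\<in>horizontal_space (\<gamma> s). (\<gamma> has_vector_derivative v) (at s)))"
    using within by (intro ex_cong1 conj_cong refl ball_cong) auto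
  finally show ?thesis by (simp add: horizontal_curve_def)
qed

lemma heis_length_eqI:
  assumes "a < b" "negligible N"
    and v: "\<And>s. s \<in> {a<..<b} - N \<Longrightarrow> (\<gamma> has_vector_derivative v s) (at s)"
      "\<And>s. s \<in> {a<..<b} - N \<Longrightarrow> v s \<in> horizontal_space (\<gamma> s)"
    and int: "((\<lambda>s. norm (heis_proj (v s))) has_integral l) {a..b}"
  shows "heis_length a b \<gamma> = l"
  unfolding heis_length_def
proof (rule integral_unique, rule has_integral_spike[OF _ _ int])
  show "negligible (insert a (insert b N))" using assms(2) by simp
  fix s assume s: "s \<in> {a..b} - insert a (insert b N)"
  then have "at s within {a..b} = at s" by (intro at_within_interior) auto
  then have "vector_derivative \<gamma> (at s within {a..b}) = v s"
    using v(1)[of s] s by (simp add: vector_derivative_at)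
  then show "(let w = vector_derivative \<gamma> (at s within {a..b}) in sqrt (heis_metric (\<gamma> s) w w)) = norm (heis_proj (v s))"
    using v(2)[of s] s by (simp add: heis_speed_horizontal)
qed

lemma cc_dist_eq: "cc_dist p q = Inf {l. heis_join p q l}"
proof -
  have "{heis_length a b \<gamma> | a b \<gamma>. a < b \<and> horizontal_curve a b \<gamma> \<and> \<gamma> a = p \<and> \<gamma> b = q} = {l. heis_join p q l}"
  proof safe
    fix a b \<gamma> assume ab: "a < b" and h: "horizontal_curve a b \<gamma>"
    obtain L N where L: "L-lipschitz_on {a..b} \<gamma>" "negligible N"
      "\<forall>s\<in>{a<..<b} - N. \<exists>v. v\<in>horizontal_space (\<gamma> s) \<and> (\<gamma> has_vector_derivative v) (at s)"
      using h unfolding horizontal_curve_alt[OF ab] by blast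
    from bchoice[OF L(3)] obtain v where v: "\<forall>s\<in>{a<..<b} - N. v s\<in>horizontal_space (\<gamma> s) \<and> (\<gamma> has_vector_derivative v s) (at s)" ..
    have "v absolutely_integrable_on {a..b}"
      by (rule Lipschitz_has_integral_derivative[OF ab L(1,2)]) (use v in auto)
    then have "(\<lambda>s. heis_proj (v s)) absolutely_integrable_on {a..b}"
      using absolutely_integrable_linear[OF _ bounded_linear_heis_proj] by (auto simp: o_def)
    then have "((\<lambda>s. norm (heis_proj (v s))) has_integral integral {a..b} (\<lambda>s. norm (heis_proj (v s)))) {a..b}"
      by (intro integrable_integral) (auto simp: absolutely_integrable_on_def)
    moreover from this have "heis_length a b \<gamma> = integral {a..b} (\<lambda>s. norm (heis_proj (v s)))"
      using v by (intro heis_length_eqI[OF ab L(2)]) auto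
    ultimately show "heis_join (\<gamma> a) (\<gamma> b) (heis_length a b \<gamma>)"
      unfolding heis_join_def using ab L v by auto blast
  next
    fix l assume "heis_join p q l"
    then obtain a b \<gamma> v L N where *: "a < b" "L-lipschitz_on {a..b} \<gamma>" "negligible N"
     "\<forall>s\<in>{a<..<b} - N. (\<gamma> has_vector_derivative v s) (at s) \<and> v s \<in> horizontal_space (\<gamma> s)"
     "((\<lambda>s. norm (heis_proj (v s))) has_integral l) {a..b}" "\<gamma> a = p" "\<gamma> b = q"
      unfolding heis_join_def by blast
    have "heis_length a b \<gamma> = l" using * by (intro heis_length_eqI[of a b N \<gamma> v]) auto
    moreover have "horizontal_curve a b \<gamma>"
      unfolding horizontal_curve_alt[OF *(1)] using * by blast
    ultimately show "\<exists>a b \<gamma>. l = heis_length a b \<gamma> \<and> a < b \<and> horizontal_curve a b \<gamma> \<and> \<gamma> a = p \<and> \<gamma> b = q"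
      using * by blast
  qed
  then show ?thesis by (simp add: cc_dist_def)
qed

text \<open>
  The projected curve has the same length, which gives the first bound. The vertical coordinate
  relative to \<open>p\<close> has the derivative \<open>2 * symp (z - \<pi> p) z'\<close> along the curve with projection \<open>z\<close>, and both
  \<open>z - \<pi> p\<close> and the integral of \<open>norm z'\<close> are bounded by \<open>l\<close>.
\<close>

lemma heis_join_bounds:
  assumes "heis_join p q l"
  shows "norm (heis_proj q - heis_proj p) \<le> l" "\<bar>heis_tau p q\<bar> \<le> 2 * l\<^sup>2"
proof -
  obtain a b \<gamma> v L N where ab: "a < b" and lip: "L-lipschitz_on {a..b} \<gamma>" and N: "negligible N"
    and v: "\<And>s. s \<in> {a<..<b} - N \<Longrightarrow> (\<gamma> has_vector_derivative v s) (at s)"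
      "\<And>s. s \<in> {a<..<b} - N \<Longrightarrow> v s \<in> horizontal_space (\<gamma> s)"
    and l: "((\<lambda>s. norm (heis_proj (v s))) has_integral l) {a..b}" and ends: "\<gamma> a = p" "\<gamma> b = q"
    using assms unfolding heis_join_def by blast
  have vint: "(v has_integral \<gamma> c - p) {a..c}" if "a < c" "c \<le> b" for c
    using that ab v unfolding ends(1)[symmetric]
    by (intro Lipschitz_has_integral_derivative(1)[OF _ lipschitz_on_subset[OF lip] N]) auto
  have \<zeta>_int: "((\<lambda>s. heis_proj (v s)) has_integral heis_proj (\<gamma> c) - heis_proj p) {a..c}" if "a < c" "c \<le> b" for c
    using has_integral_linear[OF vint[OF that] bounded_linear_heis_proj]
    by (simp add: o_def linear_diff[OF linear_heis_proj])
  have \<zeta>_le: "norm (heis_proj (\<gamma> c) - heis_proj p) \<le> l" if "a \<le> c" "c \<le> b" for c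
  proof (cases "a = c")
    case True
    have "0 \<le> l" by (rule has_integral_nonneg[OF l]) simp
    then show ?thesis using True ends by simp
  next
    case False
    then have c: "a < c" using that by simp
    have int: "(\<lambda>s. norm (heis_proj (v s))) integrable_on {a..c}"
      by (rule integrable_subinterval_real[OF has_integral_integrable[OF l]]) (use that in auto)
    have "norm (heis_proj (\<gamma> c) - heis_proj p) \<le> integral {a..c} (\<lambda>s. norm (heis_proj (v s)))"
      unfolding integral_unique[OF \<zeta>_int[OF c that(2)], symmetric]
      by (rule Henstock_Kurzweil_Integration.integral_norm_bound_integral[OF has_integral_integrable[OF \<zeta>_int[OF c that(2)]] int]) simp
    also have "\<dots> \<le> integral {a..b} (\<lambda>s. norm (heis_proj (v s)))"
      by (rule integral_subset_le[OF _ int has_integral_integrable[OF l]]) (use that in auto)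
    finally show ?thesis using integral_unique[OF l] by simp
  qed
  from \<zeta>_le[of b] ab ends show "norm (heis_proj q - heis_proj p) \<le> l" by simp
  let ?w = "\<lambda>s. heis_t (v s) - 2 * symp (heis_proj p) (heis_proj (v s))"
  have "(?w has_integral heis_t (q - p) - 2 * symp (heis_proj p) (heis_proj (q - p))) {a..b}"
  proof (intro has_integral_diff has_integral_mult_right)
    have vb: "(v has_integral q - p) {a..b}" using vint[of b] ab ends by simp
    show "((\<lambda>s. heis_t (v s)) has_integral heis_t (q - p)) {a..b}"
      using has_integral_linear[OF vb bounded_linear_heis_t] by (simp only: o_def)
    have "bounded_linear (\<lambda>v. symp (heis_proj p) (heis_proj v))"
      unfolding symp_eq_inner
      by (rule bounded_linear_compose[OF bounded_linear_inner_right bounded_linear_heis_proj])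
    then show "((\<lambda>s. symp (heis_proj p) (heis_proj (v s))) has_integral symp (heis_proj p) (heis_proj (q - p))) {a..b}"
      using has_integral_linear[OF vb] by (simp only: o_def)
  qed
  moreover have "heis_t (q - p) - 2 * symp (heis_proj p) (heis_proj (q - p)) = heis_tau p q"
    by (simp add: heis_tau_def linear_diff[OF linear_heis_proj] symp_simps)
  ultimately have w_int: "(?w has_integral heis_tau p q) {a..b}" by simp
  define w' where "w' s = (if s \<in> {a<..<b} - N then ?w s else 0)" for s
  have w'_int: "(w' has_integral heis_tau p q) {a..b}"
    by (rule has_integral_spike[OF _ _ w_int, of "insert a (insert b N)"]) (use N in \<open>auto simp: w'_def\<close>)
  have "norm (integral {a..b} w') \<le> integral {a..b} (\<lambda>s. 2 * l * norm (heis_proj (v s)))"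
  proof (rule Henstock_Kurzweil_Integration.integral_norm_bound_integral[OF has_integral_integrable[OF w'_int]])
    show "(\<lambda>s. 2 * l * norm (heis_proj (v s))) integrable_on {a..b}"
      using has_integral_mult_right[OF l, of "2 * l"] by (rule has_integral_integrable)
    have l0: "0 \<le> l" by (rule has_integral_nonneg[OF l]) simp
    fix s assume "s \<in> {a..b}"
    show "norm (w' s) \<le> 2 * l * norm (heis_proj (v s))"
    proof (cases "s \<in> {a<..<b} - N")
      case True
      then have "w' s = 2 * symp (heis_proj (\<gamma> s) - heis_proj p) (heis_proj (v s))"
        using v(2)[OF True] by (simp add: w'_def horizontal_space_eq symp_simps)
      moreover have "\<bar>symp (heis_proj (\<gamma> s) - heis_proj p) (heis_proj (v s))\<bar> \<le> l * norm (heis_proj (v s))"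
        by (rule order_trans[OF abs_symp_le mult_right_mono]) (use \<zeta>_le[of s] True in auto)
      ultimately show ?thesis by (simp add: abs_mult)
    next
      case False
      then show ?thesis using l0 by (simp only: w'_def if_False) simp
    qed
  qed
  also have "\<dots> = 2 * l * l"
    using has_integral_mult_right[OF l, of "2 * l"] by (rule integral_unique)
  finally have "norm (heis_tau p q) \<le> 2 * l * l"
    using integral_unique[OF w'_int] by simp
  then show "\<bar>heis_tau p q\<bar> \<le> 2 * l\<^sup>2" by (simp add: power2_eq_square)
qed

text \<open>
  Left translates of horizontal lines through the origin are affine lines with constant velocity.
\<close>

lemma heis_join_segment:
  "heis_join p (heis_mult p (fst z, snd z, 0)) (norm z)"
proof -
  define w where "w = (fst z, snd z, 2 * symp (heis_proj p) z)"
  have w: "w \<in> horizontal_space (p + s *\<^sub>R w)" for s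
    by (simp add: horizontal_space_eq linear_add[OF linear_heis_proj] linear_cmul[OF linear_heis_proj] symp_simps)
       (simp add: w_def heis_proj_alt)
  have "(norm w)-lipschitz_on {0..1} (\<lambda>s. p + s *\<^sub>R w)"
    by (rule lipschitz_onI) (auto simp: dist_norm scaleR_diff_left[symmetric])
  moreover have "((\<lambda>s. p + s *\<^sub>R w) has_vector_derivative w) (at s)" for s :: real
    by (auto intro!: derivative_eq_intros)
  moreover have "((\<lambda>s::real. norm (heis_proj w)) has_integral norm z) {0..1}"
    using has_integral_const_real[of "norm (heis_proj w)" 0 1] by (simp add: w_def heis_proj_alt)
  moreover have "p + 1 *\<^sub>R w = heis_mult p (fst z, snd z, 0)"
    by (cases p) (simp add: w_def heis_mult_def heis_proj_alt symp_def inner_vec_def sum_subtractf)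
  ultimately show ?thesis
    unfolding heis_join_def
    by (intro exI[of _ "0::real"] exI[of _ "1::real"] exI[of _ "\<lambda>s. p + s *\<^sub>R w"] exI[of _ "\<lambda>_. w"]
        exI[of _ "norm w"] exI[of _ "{}"]) (auto simp: w)
qed

text \<open>
  For \<open>m = 1\<close> and \<open>m = -1\<close> this shifts and reverses curves.
\<close>

lemma heis_join_reparam:
  assumes "a < b" and lip: "L-lipschitz_on {a..b} \<gamma>" and N: "negligible N"
    and v: "\<forall>s\<in>{a<..<b} - N. (\<gamma> has_vector_derivative v s) (at s) \<and> v s \<in> horizontal_space (\<gamma> s)"
    and l: "((\<lambda>s. norm (heis_proj (v s))) has_integral l) {a..b}"
    and m: "\<bar>m\<bar> = 1" and I: "\<forall>s. s \<in> {c..d} \<longleftrightarrow> m * s + e \<in> {a..b}"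
       "\<forall>s. s \<in> {c<..<d} \<longleftrightarrow> m * s + e \<in> {a<..<b}"
  shows "L-lipschitz_on {c..d} (\<lambda>s. \<gamma> (m * s + e))"
    "negligible {s. m * s + e \<in> N}"
    "\<And>s. s \<in> {c<..<d} - {s. m * s + e \<in> N} \<Longrightarrow> ((\<lambda>s. \<gamma> (m * s + e)) has_vector_derivative m *\<^sub>R v (m * s + e)) (at s)"
    "\<And>s. s \<in> {c<..<d} - {s. m * s + e \<in> N} \<Longrightarrow> m *\<^sub>R v (m * s + e) \<in> horizontal_space (\<gamma> (m * s + e))"
    "((\<lambda>s. norm (heis_proj (m *\<^sub>R v (m * s + e)))) has_integral l) {c..d}"
proof -
  have mm: "m * m = 1" and m0: "m \<noteq> 0" using m by (auto simp: abs_if split: if_splits)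
  show "L-lipschitz_on {c..d} (\<lambda>s. \<gamma> (m * s + e))"
  proof (rule lipschitz_onI[OF _ lipschitz_on_nonneg[OF lip]])
    fix s t assume "s \<in> {c..d}" "t \<in> {c..d}"
    then have "dist (\<gamma> (m * s + e)) (\<gamma> (m * t + e)) \<le> L * dist (m * s + e) (m * t + e)"
      using I(1) by (intro lipschitz_onD[OF lip]) auto
    also have "dist (m * s + e) (m * t + e) = dist s t"
      using m by (simp add: dist_real_def right_diff_distrib[symmetric] abs_mult)
    finally show "dist (\<gamma> (m * s + e)) (\<gamma> (m * t + e)) \<le> L * dist s t" .
  qed
  have "{s. m * s + e \<in> N} = (\<lambda>t. m * (t - e)) ` N"
    using mm by (auto simp: image_iff algebra_simps mult.assoc[symmetric] intro!: bexI[of _ "m * _ + e"])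
  moreover have "negligible ((\<lambda>t. m * (t - e)) ` N)"
    by (rule negligible_differentiable_image_negligible[OF _ N]) (auto intro!: derivative_intros)
  ultimately show "negligible {s. m * s + e \<in> N}" by simp
  show "((\<lambda>s. \<gamma> (m * s + e)) has_vector_derivative m *\<^sub>R v (m * s + e)) (at s)"
    if "s \<in> {c<..<d} - {s. m * s + e \<in> N}" for s
  proof -
    have "((\<lambda>s. m * s + e) has_vector_derivative m) (at s)"
      by (auto intro!: derivative_eq_intros simp: has_real_derivative_iff_has_vector_derivative[symmetric])
    moreover have "(\<gamma> has_vector_derivative v (m * s + e)) (at (m * s + e))"
      using v that I(2) by blast
    ultimately have "((\<gamma> \<circ> (\<lambda>s. m * s + e)) has_vector_derivative m *\<^sub>R v (m * s + e)) (at s)"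
      by (rule vector_diff_chain_at)
    then show ?thesis by (simp add: o_def)
  qed
  show "m *\<^sub>R v (m * s + e) \<in> horizontal_space (\<gamma> (m * s + e))"
    if "s \<in> {c<..<d} - {s. m * s + e \<in> N}" for s
  proof -
    have "v (m * s + e) \<in> horizontal_space (\<gamma> (m * s + e))" using v that I(2) by blast
    then show ?thesis by (simp add: horizontal_space_def span_scale)
  qed
  have "((\<lambda>s. norm (heis_proj (v (m *\<^sub>R s + e)))) has_integral (1 / \<bar>m\<bar> ^ DIM(real)) *\<^sub>R l)
      ((\<lambda>x. (1 / m) *\<^sub>R x + - ((1 / m) *\<^sub>R e)) ` cbox a b)"
    by (rule has_integral_affinity) (use l m0 in auto)
  moreover have "(\<lambda>x. (1 / m) *\<^sub>R x + - ((1 / m) *\<^sub>R e)) ` cbox a b = {c..d}"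
  proof -
    have "s \<in> (\<lambda>x. (1 / m) *\<^sub>R x + - ((1 / m) *\<^sub>R e)) ` cbox a b \<longleftrightarrow> m * s + e \<in> {a..b}" for s
      using m0 by (auto simp: image_iff field_simps intro!: bexI[of _ "m * s + e"])
    then show ?thesis using I(1) by blast
  qed
  ultimately show "((\<lambda>s. norm (heis_proj (m *\<^sub>R v (m * s + e)))) has_integral l) {c..d}"
    using m by (simp add: linear_cmul[OF linear_heis_proj])
qed

lemma heis_join_sym:
  assumes "heis_join p q l" shows "heis_join q p l"
proof -
  obtain a b \<gamma> v L N where ab: "a < b" and lip: "L-lipschitz_on {a..b} \<gamma>" and N: "negligible N"
    and v: "\<forall>s\<in>{a<..<b} - N. (\<gamma> has_vector_derivative v s) (at s) \<and> v s \<in> horizontal_space (\<gamma> s)"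
    and l: "((\<lambda>s. norm (heis_proj (v s))) has_integral l) {a..b}" and ends: "\<gamma> a = p" "\<gamma> b = q"
    using assms unfolding heis_join_def by blast
  define \<gamma>' where "\<gamma>' s = \<gamma> (-1 * s + (a + b))" for s
  define v' where "v' s = -1 *\<^sub>R v (-1 * s + (a + b))" for s
  define N' where "N' = {s. -1 * s + (a + b) \<in> N}"
  have I: "\<forall>s. s \<in> {a..b} \<longleftrightarrow> -1 * s + (a + b) \<in> {a..b}" "\<forall>s. s \<in> {a<..<b} \<longleftrightarrow> -1 * s + (a + b) \<in> {a<..<b}"
    by auto
  have "\<bar>-1 :: real\<bar> = 1" by simp
  note R = heis_join_reparam[OF ab lip N v l this I, folded \<gamma>'_def v'_def N'_def]
  have "\<gamma>' a = q" "\<gamma>' b = p" using ends by (auto simp: \<gamma>'_def)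
  then show ?thesis
    unfolding heis_join_def using ab R by blast
qed

lemma heis_join_trans:
  assumes "heis_join p q l" "heis_join q r l'" shows "heis_join p r (l + l')"
proof -
  obtain a b \<gamma> v L N where ab: "a < b" and lip: "L-lipschitz_on {a..b} \<gamma>" and N: "negligible N"
    and v: "\<forall>s\<in>{a<..<b} - N. (\<gamma> has_vector_derivative v s) (at s) \<and> v s \<in> horizontal_space (\<gamma> s)"
    and l: "((\<lambda>s. norm (heis_proj (v s))) has_integral l) {a..b}" and ends: "\<gamma> a = p" "\<gamma> b = q"
    using assms(1) unfolding heis_join_def by blast
  obtain a1 b1 \<gamma>1 v1 L1 N1 where ab1: "a1 < b1" and lip1: "L1-lipschitz_on {a1..b1} \<gamma>1" and N1: "negligible N1"
    and v1: "\<forall>s\<in>{a1<..<b1} - N1. (\<gamma>1 has_vector_derivative v1 s) (at s) \<and> v1 s \<in> horizontal_space (\<gamma>1 s)"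
    and l1: "((\<lambda>s. norm (heis_proj (v1 s))) has_integral l') {a1..b1}" and ends1: "\<gamma>1 a1 = q" "\<gamma>1 b1 = r"
    using assms(2) unfolding heis_join_def by blast
  define c where "c = b + (b1 - a1)"
  have bc: "b < c" using ab1 by (simp add: c_def)
  have I: "\<forall>s. s \<in> {b..c} \<longleftrightarrow> 1 * s + (a1 - b) \<in> {a1..b1}" "\<forall>s. s \<in> {b<..<c} \<longleftrightarrow> 1 * s + (a1 - b) \<in> {a1<..<b1}"
    by (auto simp: c_def)
  define \<gamma>2 where "\<gamma>2 s = \<gamma>1 (1 * s + (a1 - b))" for s
  define v2 where "v2 s = 1 *\<^sub>R v1 (1 * s + (a1 - b))" for s
  define N2 where "N2 = {s. 1 * s + (a1 - b) \<in> N1}"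
  note R = heis_join_reparam[OF ab1 lip1 N1 v1 l1 abs_one I, folded \<gamma>2_def v2_def N2_def]
  have ends2: "\<gamma>2 b = q" "\<gamma>2 c = r" using ends1 by (auto simp: \<gamma>2_def c_def)
  define \<gamma>3 where "\<gamma>3 s = (if s \<le> b then \<gamma> s else \<gamma>2 s)" for s
  define v3 where "v3 s = (if s \<le> b then v s else v2 s)" for s
  have "(max L L1)-lipschitz_on {a..c} \<gamma>3"
    unfolding \<gamma>3_def
    by (rule lipschitz_on_concat_max[OF lip]) (simp_all only: R(1) ends ends2)
  moreover have "negligible (N \<union> N2 \<union> {b})"
    by (intro negligible_Un N R(2) negligible_sing)
  moreover have "(\<gamma>3 has_vector_derivative v3 s) (at s) \<and> v3 s \<in> horizontal_space (\<gamma>3 s)"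
    if s: "s \<in> {a<..<c} - (N \<union> N2 \<union> {b})" for s
  proof (cases "s < b")
    case True
    have "(\<gamma>3 has_vector_derivative v s) (at s)"
      by (rule has_vector_derivative_transform_within_open[of \<gamma> _ _ "{a<..<b}"])
         (use v s True in \<open>auto simp: \<gamma>3_def\<close>)
    then show ?thesis using True v s by (simp add: v3_def \<gamma>3_def)
  next
    case False
    then have s': "s \<in> {b<..<c} - N2" using s by auto
    have "(\<gamma>3 has_vector_derivative v2 s) (at s)"
      by (rule has_vector_derivative_transform_within_open[of \<gamma>2 _ _ "{b<..<c}"])
         (use R(3)[OF s'] s' in \<open>auto simp: \<gamma>3_def\<close>)
    moreover have "\<gamma>3 s = \<gamma>2 s" "v3 s = v2 s" using s' by (auto simp: v3_def \<gamma>3_def)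
    ultimately show ?thesis using R(4)[OF s'] by simp
  qed
  moreover have "((\<lambda>s. norm (heis_proj (v3 s))) has_integral (l + l')) {a..c}"
  proof (rule has_integral_combine[of a b c])
    show "((\<lambda>s. norm (heis_proj (v3 s))) has_integral l) {a..b}"
      by (rule has_integral_eq[OF _ l]) (auto simp: v3_def)
    show "((\<lambda>s. norm (heis_proj (v3 s))) has_integral l') {b..c}"
      by (rule has_integral_spike[of "{b}" _ _ "\<lambda>s. norm (heis_proj (v2 s))"])
         (use R(5) in \<open>auto simp: v3_def\<close>)
  qed (use ab bc in auto)
  moreover have "\<gamma>3 a = p" "\<gamma>3 c = r" "a < c"
    using ab bc ends ends2 by (auto simp: \<gamma>3_def)
  ultimately show ?thesis
    unfolding heis_join_def by blast
qed

lemma norm_axis_real: "norm (axis j x :: real^'n) = \<bar>x\<bar>"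
  by (simp add: norm_eq_sqrt_inner inner_axis_axis)

text \<open>
  A horizontal path above a square in a coordinate plane \<open>(x\<^sub>j, y\<^sub>j)\<close> returns to its initial projection and
  gains four times the oriented area of the square in height, so a height \<open>\<tau>\<close> requires the side length
  \<open>sqrt \<bar>\<tau>\<bar> / 2\<close>.
\<close>

lemma heis_join_vertical:
  fixes p q :: "'n::finite heis"
  assumes "heis_proj p = heis_proj q"
  shows "heis_join p q (2 * sqrt \<bar>heis_tau p q\<bar>)"
proof -
  obtain j :: 'n where True by blast
  define \<tau> where "\<tau> = heis_tau p q"
  define h where "h = sqrt \<bar>\<tau>\<bar> / 2"
  \<comment> \<open>The sign decides the orientation of the square; the height gained is \<open>- 4 * h * k\<close>.\<close>
  define k where "k = - sgn \<tau> * h"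
  have h: "h \<ge> 0" "4 * h\<^sup>2 = \<bar>\<tau>\<bar>" by (auto simp: h_def power_divide)
  have hk: "- 4 * h * k = \<tau>"
  proof -
    have "- 4 * h * k = sgn \<tau> * (4 * h\<^sup>2)" by (simp add: k_def power2_eq_square)
    then show ?thesis using h(2) by (simp add: sgn_mult_abs)
  qed
  define e1 e2 :: "(real^'n) \<times> (real^'n)" where "e1 = (axis j h, 0)" and "e2 = (0, axis j k)"
  have "\<bar>k\<bar> = h" using h(1) by (auto simp: k_def h_def abs_mult sgn_if)
  then have e: "norm e1 = h" "norm e2 = h"
    using h(1) by (simp_all add: e1_def e2_def norm_prod_def norm_axis_real)
  define m where "m p z = heis_mult p (fst z, snd z, 0)" for p :: "'n heis" and z
  have m: "heis_proj (m p z) = heis_proj p + z" "heis_t (m p z) = heis_t p + 2 * symp (heis_proj p) z" for p z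
    by (simp_all add: m_def heis_proj_mult heis_t_mult heis_proj_lift)
  have seg: "heis_join p (m p z) (norm z)" for p z
    unfolding m_def by (rule heis_join_segment)
  define q' where "q' = m (m (m (m p e1) e2) (- e1)) (- e2)"
  have "heis_join p q' (h + h + h + h)"
    using heis_join_trans[OF heis_join_trans[OF heis_join_trans[OF seg[of p e1] seg[of _ e2]] seg[of _ "- e1"]] seg[of _ "- e2"]]
    by (simp add: e q'_def)
  moreover have "q' = q"
  proof (rule heis_eqI)
    show "heis_proj q' = heis_proj q" using assms by (simp add: q'_def m)
    have "symp e1 e2 = - h * k"
      by (simp add: symp_def e1_def e2_def inner_axis_axis)
    then have "heis_t q' = heis_t p - 4 * h * k"
      using symp_skew[of e2 e1] by (simp add: q'_def m symp_simps symp_minus)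
    then show "heis_t q' = heis_t q"
      using hk assms by (simp add: \<tau>_def heis_tau_def)
  qed
  moreover have "h + h + h + h = 2 * sqrt \<bar>heis_tau p q\<bar>" by (simp add: h_def \<tau>_def)
  ultimately show ?thesis by (simp only:)
qed

text \<open>
  A horizontal segment above the difference of the projections, followed by a vertical
  displacement.
\<close>

lemma heis_join_exists:
  "heis_join p q (norm (heis_proj q - heis_proj p) + 2 * sqrt \<bar>heis_tau p q\<bar>)"
proof -
  define z where "z = heis_proj q - heis_proj p"
  define p' where "p' = heis_mult p (fst z, snd z, 0)"
  have "heis_proj p' = heis_proj p + z" "heis_t p' = heis_t p + 2 * symp (heis_proj p) z"
    unfolding p'_def heis_proj_mult heis_t_mult heis_proj_lift by simp_all
  then have p': "heis_proj p' = heis_proj q" "heis_t p' = heis_t p + 2 * symp (heis_proj p) z"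
    by (simp_all add: z_def)
  then have "heis_tau p' q = heis_tau p q"
    by (simp add: heis_tau_def z_def symp_simps)
  then show ?thesis
    using heis_join_trans[OF heis_join_segment[of p z] heis_join_vertical[OF p'(1)[unfolded p'_def]]]
    by (simp add: p'_def z_def)
qed

lemma heis_join_nonneg: "heis_join p q l \<Longrightarrow> 0 \<le> l"
  using heis_join_bounds(1)[of p q l] norm_ge_zero order_trans by blast

lemma cc_dist_le: "heis_join p q l \<Longrightarrow> cc_dist p q \<le> l"
  unfolding cc_dist_eq by (rule cInf_lower) (auto intro!: bdd_belowI[of _ 0] heis_join_nonneg)

lemma cc_dist_ge: "(\<And>l. heis_join p q l \<Longrightarrow> c \<le> l) \<Longrightarrow> c \<le> cc_dist p q"
  unfolding cc_dist_eq using heis_join_exists[of p q] by (intro cInf_greatest) auto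

lemma cc_dist_nonneg: "0 \<le> cc_dist p q"
  by (rule cc_dist_ge) (rule heis_join_nonneg)

lemma dist_heis_proj_le_cc_dist: "dist (heis_proj p) (heis_proj q) \<le> cc_dist p q"
  unfolding dist_norm norm_minus_commute[of "heis_proj p"] by (rule cc_dist_ge) (rule heis_join_bounds)

lemma abs_heis_tau_le: "\<bar>heis_tau p q\<bar> \<le> 2 * (cc_dist p q)\<^sup>2"
proof -
  have "sqrt (\<bar>heis_tau p q\<bar> / 2) \<le> cc_dist p q"
  proof (rule cc_dist_ge)
    fix l assume l: "heis_join p q l"
    then show "sqrt (\<bar>heis_tau p q\<bar> / 2) \<le> l"
      using heis_join_bounds(2)[OF l] heis_join_nonneg[OF l] by (intro real_le_lsqrt) auto
  qed
  then have "\<bar>heis_tau p q\<bar> / 2 \<le> (cc_dist p q)\<^sup>2"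
    by (rule sqrt_le_D)
  then show ?thesis by simp
qed

lemma cc_dist_upper: "cc_dist p q \<le> dist (heis_proj p) (heis_proj q) + 2 * sqrt \<bar>heis_tau p q\<bar>"
  unfolding dist_norm norm_minus_commute[of "heis_proj p"] by (rule cc_dist_le[OF heis_join_exists])

lemma Metric_space_cc_dist: "Metric_space UNIV cc_dist"
proof (rule Metric_space.intro)
  fix p q r :: "'a heis"
  show "0 \<le> cc_dist p q" by (rule cc_dist_nonneg)
  have "cc_dist p q \<le> cc_dist q p" for p q :: "'a heis"
    by (rule cc_dist_ge) (erule cc_dist_le[OF heis_join_sym])
  then show "cc_dist p q = cc_dist q p" by (simp add: antisym)
  show "cc_dist p q = 0 \<longleftrightarrow> p = q"
  proof
    assume 0: "cc_dist p q = 0"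
    then have "heis_proj p = heis_proj q" "heis_tau p q = 0"
      using dist_heis_proj_le_cc_dist[of p q] abs_heis_tau_le[of p q] by auto
    then show "p = q" by (intro heis_eqI) (auto simp: heis_tau_def)
  next
    assume "p = q"
    then show "cc_dist p q = 0"
      using cc_dist_upper[of p q] cc_dist_nonneg[of p q] by simp
  qed
  have "cc_dist p r - cc_dist p q \<le> cc_dist q r"
  proof (rule cc_dist_ge)
    fix l assume l: "heis_join q r l"
    have "cc_dist p r - l \<le> cc_dist p q"
      by (rule cc_dist_ge) (use cc_dist_le[OF heis_join_trans[OF _ l]] in \<open>simp add: algebra_simps\<close>)
    then show "cc_dist p r - cc_dist p q \<le> l" by simp
  qed
  then show "cc_dist p r \<le> cc_dist p q + cc_dist q r" by simp
qed

section \<open>Lipschitz maps into the Heisenberg group at density points\<close>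

text \<open>
  Differentiability at \<open>u\<close> compares increments between any two points near \<open>u\<close>, with an error relative to
  the radius instead of their distance.
\<close>

lemma has_derivative_within_two_points:
  fixes F :: "'a::euclidean_space \<Rightarrow> 'b::real_normed_vector"
  assumes D: "(F has_derivative D) (at u within A)" and "u \<in> A" "\<epsilon> > 0"
  shows "\<exists>R\<^sub>0>0. \<forall>R w w'. 0 < R \<and> R < R\<^sub>0 \<and> w \<in> A \<inter> cball u R \<and> w' \<in> A \<inter> cball u R \<longrightarrow>
    norm (F w - F w' - D (w - w')) \<le> \<epsilon> * R"
proof -
  have lin: "linear D" using D by (rule has_derivative_linear)
  have "\<exists>d>0. \<forall>y\<in>A. norm (y - u) < d \<longrightarrow> norm (F y - F u - D (y - u)) \<le> (\<epsilon> / 2) * norm (y - u)"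
    using D \<open>\<epsilon> > 0\<close> unfolding has_derivative_within_alt by (meson half_gt_zero)
  then obtain d where d: "d > 0" "\<And>y. y \<in> A \<Longrightarrow> norm (y - u) < d \<Longrightarrow> norm (F y - F u - D (y - u)) \<le> (\<epsilon> / 2) * norm (y - u)"
    by blast
  have "norm (F w - F w' - D (w - w')) \<le> \<epsilon> * R"
    if R: "0 < R" "R < d" and w: "w \<in> A \<inter> cball u R" "w' \<in> A \<inter> cball u R" for R w w'
  proof -
    have est: "norm (F y - F u - D (y - u)) \<le> (\<epsilon> / 2) * R" if "y \<in> A \<inter> cball u R" for y
    proof -
      have y: "norm (y - u) \<le> R" using that by (simp add: dist_norm norm_minus_commute)
      have "norm (F y - F u - D (y - u)) \<le> (\<epsilon> / 2) * norm (y - u)"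
        using d(2)[of y] that y R by simp
      also have "\<dots> \<le> (\<epsilon> / 2) * R" using y \<open>\<epsilon> > 0\<close> by (intro mult_left_mono) auto
      finally show ?thesis .
    qed
    have "F w - F w' - D (w - w') = (F w - F u - D (w - u)) - (F w' - F u - D (w' - u))"
      by (simp add: linear_diff[OF lin])
    then have "norm (F w - F w' - D (w - w')) \<le> norm (F w - F u - D (w - u)) + norm (F w' - F u - D (w' - u))"
      using norm_triangle_ineq4 by metis
    then show ?thesis using est[OF w(1)] est[OF w(2)] by simp
  qed
  then show ?thesis using d(1) by blast
qed

text \<open>
  Parallel vectors span no symplectic area, so only the errors contribute.
\<close>

lemma abs_symp_near_parallel:
  assumes "symp a b = 0" "norm a \<le> \<alpha>" "norm b \<le> \<alpha>" "norm e \<le> \<beta>" "norm e' \<le> \<beta>"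
  shows "\<bar>symp (a + e) (b + e')\<bar> \<le> 2 * \<alpha> * \<beta> + \<beta>\<^sup>2"
proof -
  have \<alpha>: "0 \<le> \<alpha>" and \<beta>: "0 \<le> \<beta>" using assms norm_ge_zero order_trans by blast+
  have "symp (a + e) (b + e') = symp a e' + symp e b + symp e e'"
    by (simp add: symp_simps assms(1))
  then have "\<bar>symp (a + e) (b + e')\<bar> \<le> \<bar>symp a e'\<bar> + \<bar>symp e b\<bar> + \<bar>symp e e'\<bar>"
    by linarith
  moreover have "\<bar>symp a e'\<bar> \<le> \<alpha> * \<beta>" "\<bar>symp e b\<bar> \<le> \<beta> * \<alpha>" "\<bar>symp e e'\<bar> \<le> \<beta> * \<beta>"
    using assms \<alpha> \<beta> by (auto intro!: order_trans[OF abs_symp_le] mult_mono)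
  moreover have "2 * \<alpha> * \<beta> + \<beta>\<^sup>2 = \<alpha> * \<beta> + \<beta> * \<alpha> + \<beta> * \<beta>" by (simp add: power2_eq_square)
  ultimately show ?thesis by linarith
qed

text \<open>
  The main estimate. Divide the segment from \<open>w\<close> to \<open>w'\<close> into \<open>m\<close> parts and move the division points
  into \<open>A\<close>. By \<open>heis_tau_cocycle\<close> the vertical coordinate is a sum of \<open>m\<close> vertical coordinates of
  steps, which are \<open>O((R / m)\<^sup>2)\<close> by the Lipschitz condition, and of \<open>m\<close> symplectic
  areas. The latter are small because the derivative maps all parts of the segment to parallel
  vectors.
\<close>

lemma heis_tau_small_at_thick_point:
  fixes f :: "'a::euclidean_space \<Rightarrow> 'n::finite heis"
  assumes lip: "\<And>v w. v \<in> A \<Longrightarrow> w \<in> A \<Longrightarrow> cc_dist (f v) (f w) \<le> L * dist v w"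
    and u: "u \<in> A" "thick_at A u"
    and D: "((\<lambda>w. heis_proj (f w)) has_derivative D) (at u within A)"
    and "\<epsilon> > 0"
  shows "\<exists>R\<^sub>0>0. \<forall>R w w'. 0 < R \<and> R < R\<^sub>0 \<and> w \<in> A \<inter> cball u R \<and> w' \<in> A \<inter> cball u R \<longrightarrow>
    \<bar>heis_tau (f w) (f w')\<bar> \<le> \<epsilon> * R\<^sup>2"
proof -
  let ?F = "\<lambda>w. heis_proj (f w)"
  have linD: "linear D" using D by (rule has_derivative_linear)
  obtain B where B: "B > 0" "\<And>x. norm (D x) \<le> norm x * B"
    using bounded_linear.pos_bounded[OF has_derivative_bounded_linear[OF D]] by blast
  have B': "norm (D x) \<le> B * r" if "norm x \<le> r" for x r
    using order_trans[OF B(2)[of x] mult_right_mono[OF that, of B]] B(1) by (simp add: mult.commute)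
  \<comment> \<open>\<open>m\<close> makes the vertical parts of the steps add up to at most \<open>\<epsilon> / 2 * R\<^sup>2\<close>; then \<open>\<kappa>\<close>, the error in
    the increments of the projection relative to \<open>R\<close>, does the same for the symplectic areas.\<close>
  obtain m :: nat where m: "64 * L\<^sup>2 / \<epsilon> < real m" using reals_Archimedean2 by blast
  have m0: "m > 0"
    using m \<open>\<epsilon> > 0\<close> by (cases m) (auto simp: divide_less_0_iff)
  have m\<epsilon>: "64 * L\<^sup>2 \<le> \<epsilon> * real m" using m \<open>\<epsilon> > 0\<close> by (simp add: field_simps)
  define \<kappa> where "\<kappa> = min 1 (\<epsilon> / (4 * m * (4 * B + 1)))"
  have \<kappa>: "0 < \<kappa>" "\<kappa> \<le> 1" "\<kappa> * (4 * m * (4 * B + 1)) \<le> \<epsilon>"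
  proof -
    have p: "4 * real m * (4 * B + 1) > 0" using B m0 by simp
    show "0 < \<kappa>" "\<kappa> \<le> 1" using p \<open>\<epsilon> > 0\<close> by (auto simp: \<kappa>_def)
    have "\<kappa> \<le> \<epsilon> / (4 * m * (4 * B + 1))" by (simp add: \<kappa>_def)
    then show "\<kappa> * (4 * m * (4 * B + 1)) \<le> \<epsilon>" using p by (simp add: pos_le_divide_eq)
  qed
  define \<delta> where "\<delta> = min (1 / m) (\<kappa> / (4 * B))"
  have \<delta>: "\<delta> > 0" "\<delta> \<le> 1 / m" "2 * B * \<delta> \<le> \<kappa> / 2"
  proof -
    show "\<delta> > 0" "\<delta> \<le> 1 / m" using \<kappa> B m0 by (auto simp: \<delta>_def)
    have "\<delta> \<le> \<kappa> / (4 * B)" by (simp add: \<delta>_def)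
    then show "2 * B * \<delta> \<le> \<kappa> / 2" using B(1) by (simp add: field_simps)
  qed
  obtain R1 where R1: "R1 > 0" "\<forall>R. 0 < R \<and> R < R1 \<longrightarrow> (\<forall>z\<in>cball u R. \<exists>v\<in>A. dist z v \<le> \<delta> * R)"
    using u(2) \<delta>(1) by (auto simp: thick_at_def)
  obtain R2 where R2: "R2 > 0" "\<And>R w w'. 0 < R \<Longrightarrow> R < R2 \<Longrightarrow> w \<in> A \<inter> cball u R \<Longrightarrow> w' \<in> A \<inter> cball u R \<Longrightarrow>
      norm (?F w - ?F w' - D (w - w')) \<le> \<kappa> / 4 * R"
    using has_derivative_within_two_points[OF D u(1), of "\<kappa> / 4"] \<kappa>(1) by (metis divide_pos_pos zero_less_numeral)
  have "\<bar>heis_tau (f w) (f w')\<bar> \<le> \<epsilon> * R\<^sup>2"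
    if R: "0 < R" "R < min R1 (R2 / 2)" and w: "w \<in> A \<inter> cball u R" "w' \<in> A \<inter> cball u R" for R w w'
  proof -
    define z where "z i = w + (real i / m) *\<^sub>R (w' - w)" for i
    have zu: "z i \<in> cball u R" if "i \<le> m" for i
    proof -
      have "z i = (1 - real i / m) *\<^sub>R w + (real i / m) *\<^sub>R w'" by (simp add: z_def algebra_simps)
      then show ?thesis
        using w that m0 convexD_alt[OF convex_cball[of u R], of w w' "real i / m"] by simp
    qed
    have "\<forall>i\<in>{..m}. \<exists>v\<in>A. dist (z i) v \<le> \<delta> * R"
      using R1(2) R zu by auto
    then obtain y where y: "\<And>i. i \<le> m \<Longrightarrow> y i \<in> A" "\<And>i. i \<le> m \<Longrightarrow> dist (z i) (y i) \<le> \<delta> * R"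
      by (metis atMost_iff)
    \<comment> \<open>The end points already belong to \<open>A\<close> and stay in place.\<close>
    define v where "v i = (if i = 0 then w else if i = m then w' else y i)" for i
    have z_ends: "z 0 = w" "z m = w'" using m0 by (auto simp: z_def)
    have v: "v i \<in> A" "norm (v i - z i) \<le> \<delta> * R" if "i \<le> m" for i
      using w y that z_ends R \<delta>(1) by (auto simp: v_def dist_norm norm_minus_commute)
    have "\<delta> \<le> 1" using \<delta>(2) m0 by (auto intro: order_trans)
    have vu: "v i \<in> A \<inter> cball u (2 * R)" if "i \<le> m" for i
    proof -
      have "\<delta> * R \<le> R" using \<open>\<delta> \<le> 1\<close> R by (simp add: mult_le_cancel_right1)
      then have "dist u (v i) \<le> 2 * R"
        using zu[OF that] v(2)[OF that] dist_triangle[of u "v i" "z i"] by (simp add: dist_norm norm_minus_commute)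
      then show ?thesis using v(1)[OF that] by simp
    qed
    have ww: "norm (w' - w) \<le> 2 * R"
      using w dist_triangle3[of w' w u] by (simp add: dist_norm norm_minus_commute)
    have lin_err: "norm (?F (v i) - ?F (v j) - D (z i - z j)) \<le> \<kappa> * R" if "i \<le> m" "j \<le> m" for i j
    proof -
      have "norm ((v i - z i) - (v j - z j)) \<le> 2 * (\<delta> * R)"
        using norm_triangle_ineq4[of "v i - z i" "v j - z j"] v(2)[OF that(1)] v(2)[OF that(2)] by linarith
      from B'[OF this] have "norm (D ((v i - z i) - (v j - z j))) \<le> 2 * B * \<delta> * R"
        by (simp add: mult_ac)
      also have "\<dots> \<le> \<kappa> / 2 * R"
        using R by (intro mult_right_mono \<delta>(3)) auto
      finally have "norm (D ((v i - z i) - (v j - z j))) \<le> \<kappa> / 2 * R" .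
      moreover have "norm (?F (v i) - ?F (v j) - D (v i - v j)) \<le> \<kappa> / 4 * (2 * R)"
        using R vu that by (intro R2(2)) auto
      ultimately have bnd: "norm ((?F (v i) - ?F (v j) - D (v i - v j)) + D ((v i - z i) - (v j - z j)))
          \<le> \<kappa> / 4 * (2 * R) + \<kappa> / 2 * R"
        by (intro order_trans[OF norm_triangle_ineq] add_mono)
      have eq: "?F (v i) - ?F (v j) - D (z i - z j) =
          (?F (v i) - ?F (v j) - D (v i - v j)) + D ((v i - z i) - (v j - z j))"
        by (simp add: linear_diff[OF linD])
      have "\<kappa> / 4 * (2 * R) + \<kappa> / 2 * R = \<kappa> * R" by simp
      then show ?thesis unfolding eq using bnd by (simp only:)
    qed
    have step: "\<bar>heis_tau (f w) (f (v (Suc i)))\<bar> \<le> \<bar>heis_tau (f w) (f (v i))\<bar> + \<epsilon> / m * R\<^sup>2" if i: "i < m" for i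
    proof -
      have "norm (z (Suc i) - z i) \<le> 2 * R / m"
      proof -
        have "z (Suc i) - z i = (1 / m) *\<^sub>R (w' - w)"
          by (simp add: z_def algebra_simps add_divide_distrib)
        then show ?thesis using ww m0 by (simp add: divide_right_mono)
      qed
      have "dist (v (Suc i)) (v i) \<le> 4 * R / m"
      proof -
        have "v (Suc i) - v i = (z (Suc i) - z i) + (v (Suc i) - z (Suc i)) - (v i - z i)" by simp
        then have "norm (v (Suc i) - v i) \<le> norm (z (Suc i) - z i) + norm (v (Suc i) - z (Suc i)) + norm (v i - z i)"
          by (smt (verit) norm_triangle_ineq norm_triangle_ineq4)
        also have "\<dots> \<le> 2 * R / m + \<delta> * R + \<delta> * R"
          using i by (intro add_mono v(2) \<open>norm (z (Suc i) - z i) \<le> 2 * R / m\<close>) auto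
        also have "\<dots> \<le> 2 * R / m + R / m + R / m"
          using mult_right_mono[OF \<delta>(2), of R] R by (intro add_mono) auto
        also have "\<dots> = 4 * R / m" by (simp add: add_divide_distrib[symmetric])
        finally show ?thesis by (simp add: dist_norm)
      qed
      then have d: "dist (v i) (v (Suc i)) \<le> 4 * R / m" by (simp add: dist_commute)
      have "cc_dist (f (v i)) (f (v (Suc i))) \<le> \<bar>L\<bar> * (4 * R / m)"
      proof -
        have "cc_dist (f (v i)) (f (v (Suc i))) \<le> L * dist (v i) (v (Suc i))"
          using v(1) i by (intro lip) auto
        also have "\<dots> \<le> \<bar>L\<bar> * (4 * R / m)"
          by (intro mult_mono d) auto
        finally show ?thesis .
      qed
      then have "(cc_dist (f (v i)) (f (v (Suc i))))\<^sup>2 \<le> (\<bar>L\<bar> * (4 * R / m))\<^sup>2"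
        by (intro power_mono cc_dist_nonneg)
      then have 1: "\<bar>heis_tau (f (v i)) (f (v (Suc i)))\<bar> \<le> 2 * (\<bar>L\<bar> * (4 * R / m))\<^sup>2"
        using abs_heis_tau_le[of "f (v i)" "f (v (Suc i))"] by linarith
      also have "\<dots> = (32 * L\<^sup>2) * R\<^sup>2 / (real m)\<^sup>2"
        by (simp add: power_mult_distrib power_divide)
      also have "\<dots> \<le> (\<epsilon> * m / 2) * R\<^sup>2 / (real m)\<^sup>2"
        using m\<epsilon> by (intro divide_right_mono mult_right_mono) auto
      also have "\<dots> = \<epsilon> / (2 * m) * R\<^sup>2"
        using m0 by (simp add: power2_eq_square)
      finally have 1: "\<bar>heis_tau (f (v i)) (f (v (Suc i)))\<bar> \<le> \<epsilon> / (2 * m) * R\<^sup>2" .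
      define a b where "a = D (z i - z 0)" and "b = D (z (Suc i) - z i)"
      have ab: "a = (real i / m) *\<^sub>R D (w' - w)" "b = (1 / m) *\<^sub>R D (w' - w)"
        by (auto simp: a_def b_def z_def linear_cmul[OF linD, symmetric] algebra_simps add_divide_distrib)
      have nD: "norm (D (w' - w)) \<le> 2 * B * R" using B'[OF ww] by (simp add: mult_ac)
      have "real i / m \<le> 1" "1 / real m \<le> 1" using i m0 by auto
      then have nab: "norm a \<le> 2 * B * R" "norm b \<le> 2 * B * R"
      proof -
        have *: "norm (c *\<^sub>R D (w' - w)) \<le> 2 * B * R" if "0 \<le> c" "c \<le> 1" for c
          using mult_left_le_one_le[OF norm_ge_zero that, of "D (w' - w)"] nD that by simp
        show "norm a \<le> 2 * B * R" "norm b \<le> 2 * B * R"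
          unfolding ab by (rule *; use \<open>real i / m \<le> 1\<close> \<open>1 / real m \<le> 1\<close> in simp)+
      qed
      have "\<bar>symp (a + (?F (v i) - ?F w - a)) (b + (?F (v (Suc i)) - ?F (v i) - b))\<bar> \<le> 2 * (2 * B * R) * (\<kappa> * R) + (\<kappa> * R)\<^sup>2"
      proof (rule abs_symp_near_parallel[OF _ nab])
        show "symp a b = 0" by (simp add: ab symp_simps)
        show "norm (?F (v i) - ?F w - a) \<le> \<kappa> * R"
          using lin_err[of i 0] i by (simp add: a_def v_def[of 0])
        show "norm (?F (v (Suc i)) - ?F (v i) - b) \<le> \<kappa> * R"
          using lin_err[of "Suc i" i] i by (simp add: b_def)
      qed
      then have "\<bar>symp (?F (v i) - ?F w) (?F (v (Suc i)) - ?F (v i))\<bar> \<le> 2 * (2 * B * R) * (\<kappa> * R) + (\<kappa> * R)\<^sup>2"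
        by simp
      also have "\<dots> = (4 * B + \<kappa>) * \<kappa> * R\<^sup>2" by (simp add: power2_eq_square algebra_simps)
      also have "\<dots> \<le> (\<epsilon> / (4 * m)) * R\<^sup>2"
      proof (rule mult_right_mono)
        have "(4 * B + \<kappa>) * \<kappa> \<le> (4 * B + 1) * \<kappa>" using \<kappa> by (intro mult_right_mono) auto
        also have "\<dots> \<le> \<epsilon> / (4 * m)" using \<kappa>(3) m0 by (simp add: pos_le_divide_eq mult_ac)
        finally show "(4 * B + \<kappa>) * \<kappa> \<le> \<epsilon> / (4 * m)" .
      qed simp
      finally have 2: "2 * \<bar>symp (?F (v i) - ?F w) (?F (v (Suc i)) - ?F (v i))\<bar> \<le> \<epsilon> / (2 * m) * R\<^sup>2"
        by simp
      have "\<epsilon> / m * R\<^sup>2 = \<epsilon> / (2 * m) * R\<^sup>2 + \<epsilon> / (2 * m) * R\<^sup>2" by simp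
      then show ?thesis
        using 1 2 heis_tau_cocycle[of "f w" "f (v (Suc i))" "f (v i)"] by linarith
    qed
    have "i \<le> m \<Longrightarrow> \<bar>heis_tau (f w) (f (v i))\<bar> \<le> real i * (\<epsilon> / m * R\<^sup>2)" for i
    proof (induction i)
      case (Suc i)
      have "real (Suc i) * (\<epsilon> / m * R\<^sup>2) = real i * (\<epsilon> / m * R\<^sup>2) + \<epsilon> / m * R\<^sup>2"
        by (simp only: of_nat_Suc distrib_right mult_1_left add.commute)
      with Suc show ?case using step[of i] by linarith
    qed (simp add: v_def)
    from this[of m] show ?thesis using m0 by (simp add: v_def)
  qed
  moreover have "min R1 (R2 / 2) > 0" using R1(1) R2(1) by simp
  ultimately show ?thesis by blast
qed

text \<open>
  To first order, the Carnot-Caratheodory distance of image points is the length of the image of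
  their difference under the derivative of the projected map.
\<close>

lemma cc_dist_at_thick_point:
  fixes f :: "'a::euclidean_space \<Rightarrow> 'n::finite heis"
  assumes lip: "\<And>v w. v \<in> A \<Longrightarrow> w \<in> A \<Longrightarrow> cc_dist (f v) (f w) \<le> L * dist v w"
    and u: "u \<in> A" "thick_at A u"
    and D: "((\<lambda>w. heis_proj (f w)) has_derivative D) (at u within A)"
    and "\<epsilon> > 0"
  shows "\<exists>R\<^sub>0>0. \<forall>R w w'. 0 < R \<and> R < R\<^sub>0 \<and> w \<in> A \<inter> cball u R \<and> w' \<in> A \<inter> cball u R \<longrightarrow>
    cc_dist (f w) (f w') \<le> dist (heis_proj (f w)) (heis_proj (f w')) + \<epsilon> * R \<and>
    \<bar>dist (heis_proj (f w)) (heis_proj (f w')) - norm (D (w - w'))\<bar> \<le> \<epsilon> * R"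
proof -
  have "(\<epsilon> / 2)\<^sup>2 > 0" using \<open>\<epsilon> > 0\<close> by simp
  then obtain R1 where R1: "R1 > 0" "\<And>R w w'. 0 < R \<Longrightarrow> R < R1 \<Longrightarrow> w \<in> A \<inter> cball u R \<Longrightarrow> w' \<in> A \<inter> cball u R \<Longrightarrow>
      \<bar>heis_tau (f w) (f w')\<bar> \<le> (\<epsilon> / 2)\<^sup>2 * R\<^sup>2"
    using heis_tau_small_at_thick_point[OF lip u D] by metis
  obtain R2 where R2: "R2 > 0" "\<And>R w w'. 0 < R \<Longrightarrow> R < R2 \<Longrightarrow> w \<in> A \<inter> cball u R \<Longrightarrow> w' \<in> A \<inter> cball u R \<Longrightarrow>
      norm (heis_proj (f w) - heis_proj (f w') - D (w - w')) \<le> \<epsilon> * R"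
    using has_derivative_within_two_points[OF D u(1) \<open>\<epsilon> > 0\<close>] by metis
  show ?thesis
  proof (intro exI[of _ "min R1 R2"] conjI allI impI; (elim conjE)?)
    show "min R1 R2 > 0" using R1 R2 by simp
    fix R w w' assume R: "0 < R" "R < min R1 R2" and w: "w \<in> A \<inter> cball u R" "w' \<in> A \<inter> cball u R"
    have "sqrt \<bar>heis_tau (f w) (f w')\<bar> \<le> \<epsilon> / 2 * R"
    proof (rule real_le_lsqrt)
      show "\<bar>heis_tau (f w) (f w')\<bar> \<le> (\<epsilon> / 2 * R)\<^sup>2"
        unfolding power_mult_distrib using R1(2)[OF R(1) _ w] R by simp
    qed (use R \<open>\<epsilon> > 0\<close> in auto)
    then show "cc_dist (f w) (f w') \<le> dist (heis_proj (f w)) (heis_proj (f w')) + \<epsilon> * R"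
      using cc_dist_upper[of "f w" "f w'"] by simp
    show "\<bar>dist (heis_proj (f w)) (heis_proj (f w')) - norm (D (w - w'))\<bar> \<le> \<epsilon> * R"
      using R2(2)[OF R(1) _ w] R norm_triangle_ineq3[of "heis_proj (f w) - heis_proj (f w')" "D (w - w')"]
      by (simp add: dist_norm)
  qed
qed

section \<open>Decomposition of rectifiable sets into almost isometric pieces\<close>

text \<open>
  A Sard type statement: at the points of \<open>S\<close>, \<open>hausdorff_pre_degenerate\<close> makes the local density of the image
  arbitrarily small.
\<close>

lemma critical_values_hausdorff_null:
  fixes f :: "'a::euclidean_space \<Rightarrow> 'n::finite heis"
  assumes "bounded A"
    and lip: "\<And>v w. v \<in> A \<Longrightarrow> w \<in> A \<Longrightarrow> cc_dist (f v) (f w) \<le> L * dist v w"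
    and S: "S \<subseteq> A" "\<And>u. u \<in> S \<Longrightarrow> thick_at A u"
      "\<And>u. u \<in> S \<Longrightarrow> \<exists>D. ((\<lambda>w. heis_proj (f w)) has_derivative D) (at u within A) \<and> \<not> inj D"
  shows "hausdorff_outer cc_dist DIM('a) (f ` S) = 0"
proof -
  let ?n = "DIM('a)" and ?F = "\<lambda>w. heis_proj (f w)"
  obtain M where M: "S \<subseteq> ball 0 M"
    using bounded_subset_ballD[OF \<open>bounded A\<close>, of 0] S(1) by blast
  have le: "hausdorff_outer cc_dist ?n (f ` S) \<le> ennreal \<theta> * emeasure lborel (ball 0 M :: 'a set)" if "\<theta> > 0" for \<theta>
  proof (rule hausdorff_outer_le_local_density[OF open_ball M])
    fix u and \<rho> \<delta> :: real assume u: "u \<in> S" and "0 < \<rho>" "0 < \<delta>"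
    obtain D where D: "(?F has_derivative D) (at u within A)" "\<not> inj D" using S(3)[OF u] by blast
    obtain B where B: "B > 0" "\<And>x. norm (D x) \<le> norm x * B"
      using bounded_linear.pos_bounded[OF has_derivative_bounded_linear[OF D(1)]] by blast
    \<comment> \<open>The local density obtained from a grid with parameter \<open>m\<close> is at most \<open>c / m\<close>.\<close>
    define c where "c = 3 ^ (?n - 1) * (10 * B * ?n) ^ ?n"
    have c: "c > 0" using B by (simp add: c_def)
    obtain m :: nat where m: "c / \<theta> < real m" using reals_Archimedean2 by blast
    have m0: "m > 0" using m c \<open>\<theta> > 0\<close> by (cases m) (auto simp: divide_less_0_iff)
    have cm: "c / m \<le> \<theta>" using m m0 \<open>\<theta> > 0\<close> by (simp add: field_simps)
    \<comment> \<open>The two error terms \<open>\<epsilon> * R\<close> together are the tolerance allowed in \<open>hausdorff_pre_degenerate\<close>.\<close>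
    define \<epsilon> where "\<epsilon> = B * ?n / m"
    have "\<epsilon> > 0" using B m0 by (simp add: \<epsilon>_def)
    have "u \<in> A" using u S(1) by blast
    obtain R0 where R0: "R0 > 0" "\<And>R w w'. 0 < R \<Longrightarrow> R < R0 \<Longrightarrow> w \<in> A \<inter> cball u R \<Longrightarrow> w' \<in> A \<inter> cball u R \<Longrightarrow>
        cc_dist (f w) (f w') \<le> dist (?F w) (?F w') + \<epsilon> * R \<and>
        \<bar>dist (?F w) (?F w') - norm (D (w - w'))\<bar> \<le> \<epsilon> * R"
      using cc_dist_at_thick_point[OF lip \<open>u \<in> A\<close> S(2)[OF u] D(1) \<open>\<epsilon> > 0\<close>] by metis
    define r where "r = min (\<rho> / 2) (min (R0 / 10) (\<delta> * m / (20 * B * ?n)))"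
    have r: "0 < r" "r < \<rho>" "5 * r < R0" "4 * B * ?n * (5 * r) / m \<le> \<delta>"
    proof -
      show "0 < r" "r < \<rho>" "5 * r < R0"
        using \<open>0 < \<rho>\<close> \<open>0 < \<delta>\<close> R0(1) B m0 by (auto simp: r_def)
      have "r \<le> \<delta> * m / (20 * B * ?n)" by (simp add: r_def)
      then have "r * (20 * B * ?n) \<le> \<delta> * m" using B by (simp add: pos_le_divide_eq)
      then show "4 * B * ?n * (5 * r) / m \<le> \<delta>" using m0 by (simp add: pos_divide_le_eq mult_ac)
    qed
    have "hausdorff_pre cc_dist ?n \<delta> (f ` (S \<inter> cball u (5 * r))) \<le> hausdorff_pre cc_dist ?n \<delta> (f ` (A \<inter> cball u (5 * r)))"
      using S(1) by (intro hausdorff_pre_mono) auto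
    also have "\<dots> \<le> ennreal ((2 * real m + 1) ^ (?n - 1) * (unit_ball_vol ?n * (2 * B * ?n * (5 * r) / m) ^ ?n))"
    proof (rule hausdorff_pre_degenerate[OF has_derivative_linear[OF D(1)] D(2) B(1) _ _ m0 r(4)])
      show "norm (D x) \<le> B * norm x" for x using B(2)[of x] by (simp add: mult.commute)
      show "0 < 5 * r" using r by simp
      fix w w' assume w: "w \<in> A \<inter> cball u (5 * r)" "w' \<in> A \<inter> cball u (5 * r)"
      have "cc_dist (f w) (f w') \<le> norm (D (w - w')) + \<epsilon> * (5 * r) + \<epsilon> * (5 * r)"
        using R0(2)[OF _ r(3) w] r(1) by (simp add: abs_le_iff)
      also have "\<dots> = norm (D (w - w')) + 2 * B * ?n * (5 * r) / m" by (simp add: \<epsilon>_def)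
      finally show "cc_dist (f w) (f w') \<le> norm (D (w - w')) + 2 * B * ?n * (5 * r) / m" .
    qed
    also have "\<dots> \<le> ennreal (\<theta> * (unit_ball_vol ?n * r ^ ?n))"
    proof (rule ennreal_leI)
      have eq: "2 * B * ?n * (5 * r) / m = (10 * B * ?n) * r / m" by simp
      have "(2 * real m + 1) ^ (?n - 1) \<le> (3 * real m) ^ (?n - 1)"
        using m0 by (intro power_mono) auto
      then have "(2 * real m + 1) ^ (?n - 1) * (unit_ball_vol ?n * ((10 * B * ?n) * r / m) ^ ?n)
          \<le> (3 * real m) ^ (?n - 1) * (unit_ball_vol ?n * ((10 * B * ?n) * r / m) ^ ?n)"
        using B r by (intro mult_right_mono) auto
      also have "\<dots> = c * (real m ^ (?n - 1) / real m ^ ?n) * (unit_ball_vol ?n * r ^ ?n)"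
        by (simp add: c_def power_mult_distrib power_divide)
      also have "real m ^ (?n - 1) / real m ^ ?n = 1 / m"
      proof -
        have "real m ^ ?n = real m ^ (?n - 1) * m"
          using DIM_positive[where 'a = 'a] by (metis Suc_pred' power_Suc2)
        then show ?thesis using m0 by simp
      qed
      also have "c * (1 / m) * (unit_ball_vol ?n * r ^ ?n) \<le> \<theta> * (unit_ball_vol ?n * r ^ ?n)"
        using cm r by (intro mult_right_mono) auto
      finally show "(2 * real m + 1) ^ (?n - 1) * (unit_ball_vol ?n * (2 * B * ?n * (5 * r) / m) ^ ?n)
          \<le> \<theta> * (unit_ball_vol ?n * r ^ ?n)" unfolding eq .
    qed
    also have "\<dots> = ennreal \<theta> * emeasure lborel (cball u r)"
      using r \<open>\<theta> > 0\<close> by (simp add: emeasure_cball ennreal_mult)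
    finally show "\<exists>r. 0 < r \<and> r < \<rho> \<and> hausdorff_pre cc_dist ?n \<delta> (f ` (S \<inter> cball u (5 * r)))
        \<le> ennreal \<theta> * emeasure lborel (cball u r)"
      using r by blast
  qed
  have "hausdorff_outer cc_dist ?n (f ` S) \<le> 0"
  proof (rule ennreal_le_epsilon)
    fix e :: real assume "0 < e"
    define \<mu> where "\<mu> = measure lborel (ball 0 M :: 'a set)"
    have \<mu>: "emeasure lborel (ball 0 M :: 'a set) = ennreal \<mu>"
      unfolding \<mu>_def by (rule emeasure_eq_ennreal_measure) (use emeasure_bounded_finite[of "ball 0 M :: 'a set"] in auto)
    have "\<mu> \<ge> 0" by (simp add: \<mu>_def)
    then have "e / (\<mu> + 1) > 0" "e / (\<mu> + 1) * \<mu> \<le> e" using \<open>0 < e\<close> by (auto simp: field_simps)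
    note e = this
    have "hausdorff_outer cc_dist ?n (f ` S) \<le> ennreal (e / (\<mu> + 1)) * ennreal \<mu>"
      using le[OF e(1)] unfolding \<mu> .
    also have "\<dots> = ennreal (e / (\<mu> + 1) * \<mu>)"
      using e(1) \<open>\<mu> \<ge> 0\<close> by (intro ennreal_mult[symmetric]) auto
    also have "\<dots> \<le> ennreal e" by (rule ennreal_leI) (rule e(2))
    finally show "hausdorff_outer cc_dist ?n (f ` S) \<le> 0 + ennreal e" by simp
  qed
  then show ?thesis by simp
qed

text \<open>
  Injectivity of \<open>D\<close> bounds the projected distance from below by a multiple of \<open>dist u w\<close>, so the
  error term of \<open>cc_dist_at_thick_point\<close> is a small fraction of it.
\<close>

lemma cc_dist_le_at_immersion_point:
  fixes f :: "'a::euclidean_space \<Rightarrow> 'n::finite heis"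
  assumes lip: "\<And>v w. v \<in> A \<Longrightarrow> w \<in> A \<Longrightarrow> cc_dist (f v) (f w) \<le> L * dist v w"
    and u: "u \<in> A" "thick_at A u"
    and D: "((\<lambda>w. heis_proj (f w)) has_derivative D) (at u within A)" "inj D"
    and "\<eta> > 0"
  shows "\<exists>r>0. \<forall>w\<in>A. dist u w < r \<longrightarrow> cc_dist (f u) (f w) \<le> (1 + \<eta>) * dist (heis_proj (f u)) (heis_proj (f w))"
proof -
  let ?F = "\<lambda>w. heis_proj (f w)"
  obtain c where c: "c > 0" "\<And>x. c * norm x \<le> norm (D x)"
    using linear_inj_bounded_below_pos[OF has_derivative_linear[OF D(1)] D(2)] by metis
  \<comment> \<open>The solution of \<open>\<epsilon> = \<eta> * (c - \<epsilon>)\<close>: the projected distance is at least \<open>(c - \<epsilon>) * R\<close>, so \<open>\<eta>\<close> times it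
    covers the error \<open>\<epsilon> * R\<close>.\<close>
  define \<epsilon> where "\<epsilon> = c * \<eta> / (1 + \<eta>)"
  have \<epsilon>: "\<epsilon> > 0" "\<epsilon> = \<eta> * (c - \<epsilon>)" using c(1) \<open>\<eta> > 0\<close> by (auto simp: \<epsilon>_def field_simps)
  obtain R0 where R0: "R0 > 0" "\<And>R w w'. 0 < R \<Longrightarrow> R < R0 \<Longrightarrow> w \<in> A \<inter> cball u R \<Longrightarrow> w' \<in> A \<inter> cball u R \<Longrightarrow>
      cc_dist (f w) (f w') \<le> dist (?F w) (?F w') + \<epsilon> * R \<and>
      \<bar>dist (?F w) (?F w') - norm (D (w - w'))\<bar> \<le> \<epsilon> * R"
    using cc_dist_at_thick_point[OF lip u D(1) \<epsilon>(1)] by metis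
  have "cc_dist (f u) (f w) \<le> (1 + \<eta>) * dist (?F u) (?F w)" if w: "w \<in> A" "dist u w < R0" for w
  proof (cases "u = w")
    case True
    then show ?thesis
      using Metric_space.mdist_zero[OF Metric_space_cc_dist, of "f w"] by simp
  next
    case False
    define R where "R = dist u w"
    have R: "0 < R" "R < R0" "u \<in> A \<inter> cball u R" "w \<in> A \<inter> cball u R"
      using False w u by (auto simp: R_def)
    note * = R0(2)[OF R]
    have "c * R \<le> norm (D (u - w))" using c(2)[of "u - w"] by (simp add: R_def dist_norm)
    then have "(c - \<epsilon>) * R \<le> dist (?F u) (?F w)" using * by (simp add: left_diff_distrib abs_le_iff)
    then have "\<eta> * ((c - \<epsilon>) * R) \<le> \<eta> * dist (?F u) (?F w)" using \<open>\<eta> > 0\<close> by (intro mult_left_mono) auto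
    moreover have "\<eta> * ((c - \<epsilon>) * R) = \<epsilon> * R" using \<epsilon>(2) by simp
    ultimately show ?thesis using * by (simp add: distrib_right)
  qed
  then show ?thesis using R0(1) by blast
qed

text \<open>
  The points whose estimate from \<open>cc_dist_le_at_immersion_point\<close> holds up to distance \<open>1 / Suc m\<close> form a
  closed set \<open>P m\<close>; cut into parts of smaller diameter, it satisfies the estimate for all pairs. The
  points outside all \<open>P m\<close> are degenerate, not thick, or not points of differentiability.
\<close>

lemma Lipschitz_image_decomposition:
  fixes f :: "'a::euclidean_space \<Rightarrow> 'n::finite heis"
  assumes A: "compact A"
    and lip: "\<And>v w. v \<in> A \<Longrightarrow> w \<in> A \<Longrightarrow> cc_dist (f v) (f w) \<le> L * dist v w"
    and "\<eta> > 0"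
  shows "\<exists>\<K>. countable \<K> \<and> (\<forall>K\<in>\<K>. compact K \<and> K \<subseteq> A \<and>
      (\<forall>v\<in>K. \<forall>w\<in>K. cc_dist (f v) (f w) \<le> (1 + \<eta>) * dist (heis_proj (f v)) (heis_proj (f w)))) \<and>
    hausdorff_outer cc_dist DIM('a) (f ` (A - \<Union>\<K>)) = 0"
proof -
  let ?F = "\<lambda>w. heis_proj (f w)"
  interpret cc: Metric_space "UNIV :: 'n heis set" cc_dist by (rule Metric_space_cc_dist)
  have lip0: "cc_dist (f v) (f w) \<le> \<bar>L\<bar> * dist v w" if "v \<in> A" "w \<in> A" for v w
    by (rule order_trans[OF lip[OF that]]) (simp add: mult_right_mono)
  have F_lip: "\<bar>L\<bar>-lipschitz_on A ?F"
    by (rule lipschitz_onI) (auto intro: order_trans[OF dist_heis_proj_le_cc_dist lip0])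
  have F_cont: "continuous_on A ?F" by (rule lipschitz_on_continuous_on[OF F_lip])
  have d_cont: "continuous_on A (\<lambda>v. cc_dist (f v) (f w))" for w
  proof -
    have "\<bar>L\<bar>-lipschitz_on A (\<lambda>v. cc_dist (f v) (f w))"
    proof (rule lipschitz_onI)
      fix v v' assume v: "v \<in> A" "v' \<in> A"
      have "\<bar>cc_dist (f v) (f w) - cc_dist (f v') (f w)\<bar> \<le> cc_dist (f v) (f v')"
        using cc.triangle[of "f v" "f v'" "f w"] cc.triangle[of "f v'" "f v" "f w"] cc.commute[of "f v" "f v'"]
        by simp
      then show "dist (cc_dist (f v) (f w)) (cc_dist (f v') (f w)) \<le> \<bar>L\<bar> * dist v v'"
        using lip0[OF v] by (simp add: dist_real_def)
    qed simp
    then show ?thesis by (rule lipschitz_on_continuous_on)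
  qed
  define P where "P m = {u \<in> A. \<forall>w\<in>A. dist u w < 1 / real (Suc m) \<longrightarrow> cc_dist (f u) (f w) \<le> (1 + \<eta>) * dist (?F u) (?F w)}" for m
  have P_closed: "closed (P m)" for m
  proof -
    define far where "far w = A \<inter> {u. 1 / real (Suc m) \<le> dist u w}" for w
    define good where
      "good w = A \<inter> (\<lambda>u. cc_dist (f u) (f w) - (1 + \<eta>) * dist (?F u) (?F w)) -` {..0}" for w
    have "closed (far w)" for w
      unfolding far_def by (intro closed_Int compact_imp_closed A closed_Collect_le continuous_intros)
    moreover have "closed (good w)" for w
      unfolding good_def
      by (rule continuous_closed_preimage[OF _ compact_imp_closed[OF A] closed_atMost])
         (intro continuous_intros d_cont F_cont)
    ultimately have "closed (A \<inter> (\<Inter>w\<in>A. far w \<union> good w))"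
      by (intro closed_Int[OF compact_imp_closed[OF A]] closed_INT ballI closed_Un)
    also have "A \<inter> (\<Inter>w\<in>A. far w \<union> good w) = P m"
      unfolding P_def far_def good_def by (auto simp: not_less[symmetric])
    finally show ?thesis .
  qed
  obtain C :: "'a set" where C: "countable C" "\<And>X. open X \<Longrightarrow> X \<noteq> {} \<Longrightarrow> \<exists>d\<in>C. d \<in> X"
    using countable_dense_exists by blast
  define piece where "piece = (\<lambda>(m, q). P m \<inter> cball q (1 / (3 * real (Suc m))))"
  define \<K> where "\<K> = piece ` (UNIV \<times> C)"
  define N where "N = {u \<in> A. \<not> thick_at A u} \<union> {u \<in> A. \<not> ?F differentiable (at u within A)}"
  define S where "S = {u \<in> A. thick_at A u \<and> (\<exists>D. (?F has_derivative D) (at u within A) \<and> \<not> inj D)}"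
  have "negligible N"
    unfolding N_def using A by (intro negligible_Un negligible_not_thick Rademacher_within[OF F_lip])
      (auto intro: lmeasurable_compact fmeasurableD)
  then have N: "hausdorff_outer cc_dist DIM('a) (f ` N) = 0"
    using lip by (intro hausdorff_outer_Lipschitz_negligible[where L = L]) (auto simp: N_def)
  have S: "hausdorff_outer cc_dist DIM('a) (f ` S) = 0"
    by (rule critical_values_hausdorff_null[OF compact_imp_bounded[OF A] lip]) (auto simp: S_def)
  have cover: "A - \<Union>\<K> \<subseteq> N \<union> S"
  proof (rule subsetI, rule ccontr)
    fix u assume u: "u \<in> A - \<Union>\<K>" "u \<notin> N \<union> S"
    then have thick: "u \<in> A" "thick_at A u" by (auto simp: N_def)
    obtain D where D: "(?F has_derivative D) (at u within A)" "inj D"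
      using u thick by (auto simp: N_def S_def differentiable_def)
    obtain r where r: "r > 0" "\<forall>w\<in>A. dist u w < r \<longrightarrow> cc_dist (f u) (f w) \<le> (1 + \<eta>) * dist (?F u) (?F w)"
      using cc_dist_le_at_immersion_point[OF lip thick D \<open>\<eta> > 0\<close>] by blast
    obtain m where m: "1 / real (Suc m) < r" using r(1) nat_approx_posE by blast
    have "u \<in> P m" using thick r(2) m by (auto simp: P_def)
    obtain q where q: "q \<in> C" "q \<in> ball u (1 / (3 * real (Suc m)))"
      using C(2)[of "ball u (1 / (3 * real (Suc m)))"] by auto
    then have "u \<in> piece (m, q)" using \<open>u \<in> P m\<close> by (simp add: piece_def dist_commute)
    then show False using u(1) q(1) unfolding \<K>_def by blast
  qed
  show ?thesis
  proof (intro exI[of _ \<K>] conjI ballI)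
    show "countable \<K>" unfolding \<K>_def using C(1) by auto
    show "hausdorff_outer cc_dist DIM('a) (f ` (A - \<Union>\<K>)) = 0"
    proof (rule hausdorff_outer_null_subset)
      show "f ` (A - \<Union>\<K>) \<subseteq> f ` N \<union> f ` S" using cover by blast
      show "hausdorff_outer cc_dist DIM('a) (f ` N \<union> f ` S) = 0"
        using hausdorff_outer_Un[of cc_dist "DIM('a)" "f ` N" "f ` S"] N S by simp
    qed
    fix K assume "K \<in> \<K>"
    then obtain m q where K: "K = P m \<inter> cball q (1 / (3 * real (Suc m)))" by (auto simp: \<K>_def piece_def)
    show "K \<subseteq> A" by (auto simp: K P_def)
    then have "bounded K" using compact_imp_bounded[OF A] bounded_subset by blast
    then show "compact K"
      using P_closed by (simp add: compact_eq_bounded_closed K closed_Int)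
    fix v w assume vw: "v \<in> K" "w \<in> K"
    then have "dist v w \<le> 1 / (3 * real (Suc m)) + 1 / (3 * real (Suc m))"
      using dist_triangle3[of v w q] by (simp add: K)
    also have "\<dots> < 1 / real (Suc m)" by (simp add: field_simps)
    finally show "cc_dist (f v) (f w) \<le> (1 + \<eta>) * dist (?F v) (?F w)"
      using vw \<open>K \<subseteq> A\<close> by (auto simp: K P_def)
  qed
qed

text \<open>
  The reverse inequality \<open>dist (heis_proj p) (heis_proj q) \<le> cc_dist p q\<close> holds everywhere, so for \<open>c\<close>
  close to one the projection is almost an isometry on \<open>S\<close>.
\<close>

definition cc_bilipschitz_piece :: "real \<Rightarrow> 'n::finite heis set \<Rightarrow> bool" where
  "cc_bilipschitz_piece c S \<longleftrightarrow> S \<in> sets (dist_borel cc_dist) \<and> heis_proj ` S \<in> sets borel \<and>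
     (\<forall>p\<in>S. \<forall>q\<in>S. cc_dist p q \<le> c * dist (heis_proj p) (heis_proj q))"

text \<open>
  The parameter sets are exhausted by compact sets up to null sets, whose images are null sets too.
\<close>

theorem rectifiable_decomposition:
  fixes E :: "'n::finite heis set"
  assumes E: "countably_rectifiable TYPE('k::finite) cc_dist E" and "\<eta> > 0"
  shows "\<exists>\<S>. countable \<S> \<and> (\<forall>S\<in>\<S>. S \<subseteq> E \<and> cc_bilipschitz_piece (1 + \<eta>) S) \<and>
    hausdorff_outer cc_dist CARD('k) (E - \<Union>\<S>) = 0"
proof -
  let ?H = "hausdorff_outer cc_dist CARD('k)"
  interpret cc: Metric_space "UNIV :: 'n heis set" cc_dist by (rule Metric_space_cc_dist)
  obtain A :: "nat \<Rightarrow> (real^'k) set" and f where A: "\<And>i. A i \<in> sets lebesgue" "\<And>i. f i ` A i \<subseteq> E"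
    "\<And>i. \<exists>L. \<forall>u\<in>A i. \<forall>v\<in>A i. cc_dist (f i u) (f i v) \<le> L * dist u v"
    "?H (E - (\<Union>i. f i ` A i)) = 0"
    using E unfolding countably_rectifiable_def by blast
  have "\<exists>L. \<forall>i. \<forall>u\<in>A i. \<forall>v\<in>A i. cc_dist (f i u) (f i v) \<le> L i * dist u v"
    using A(3) by (intro choice) auto
  then obtain L where L: "\<And>i u v. u \<in> A i \<Longrightarrow> v \<in> A i \<Longrightarrow> cc_dist (f i u) (f i v) \<le> L i * dist u v" by blast
  have "\<exists>C T. range C \<subseteq> Collect compact \<and> negligible T \<and> (\<Union>n::nat. C n) \<union> T = A i" for i
  proof (rule lebesgue_set_almost_fsigma[OF A(1)[of i]])
    fix C T assume "fsigma C" "T \<in> null_sets lebesgue" "C \<union> T = A i"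
    then show ?thesis by (auto simp: fsigma_Union_compact negligible_iff_null_sets)
  qed
  then obtain C T where C: "\<And>i n. compact (C i (n::nat))" and T: "\<And>i. negligible (T i)"
    and CT: "\<And>i. (\<Union>n. C i n) \<union> T i = A i"
    by (simp add: image_subset_iff) metis
  have CA: "C i n \<subseteq> A i" "T i \<subseteq> A i" for i n using CT by blast+
  define Q where "Q i n \<K> \<longleftrightarrow> countable \<K> \<and> (\<forall>K\<in>\<K>. compact K \<and> K \<subseteq> C i n \<and>
      (\<forall>v\<in>K. \<forall>w\<in>K. cc_dist (f i v) (f i w) \<le> (1 + \<eta>) * dist (heis_proj (f i v)) (heis_proj (f i w)))) \<and>
      hausdorff_outer cc_dist DIM(real^'k) (f i ` (C i n - \<Union>\<K>)) = 0" for i n \<K>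
  have "\<forall>p. \<exists>\<K>. Q (fst p) (snd p) \<K>"
  proof
    fix p show "\<exists>\<K>. Q (fst p) (snd p) \<K>"
      unfolding Q_def
      by (rule Lipschitz_image_decomposition[OF C _ \<open>\<eta> > 0\<close>, where L = "L (fst p)"]) (use L CA in blast)
  qed
  from choice[OF this] obtain \<K>' where "\<forall>p. Q (fst p) (snd p) (\<K>' p)" ..
  then have "Q i n (\<K>' (i, n))" for i n by (auto dest: spec[of _ "(i, n)"])
  then obtain \<K> where Q: "\<And>i n. Q i n (\<K> i n)" by (rule that[of "\<lambda>i n. \<K>' (i, n)"])
  have \<K>: "\<And>i n. countable (\<K> i n)"
    "\<And>i n K. K \<in> \<K> i n \<Longrightarrow> compact K \<and> K \<subseteq> C i n \<and>
       (\<forall>v\<in>K. \<forall>w\<in>K. cc_dist (f i v) (f i w) \<le> (1 + \<eta>) * dist (heis_proj (f i v)) (heis_proj (f i w)))"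
    "\<And>i n. ?H (f i ` (C i n - \<Union>(\<K> i n))) = 0"
    using Q unfolding Q_def by simp_all
  define \<S> where "\<S> = (\<Union>i. \<Union>n. (`) (f i) ` \<K> i n)"
  show ?thesis
  proof (intro exI[of _ \<S>] conjI ballI)
    show "countable \<S>" unfolding \<S>_def using \<K>(1) by auto
    have "E - \<Union>\<S> \<subseteq> (E - (\<Union>i. f i ` A i)) \<union> ((\<Union>i. f i ` T i) \<union> (\<Union>i. \<Union>n. f i ` (C i n - \<Union>(\<K> i n))))"
    proof
      fix x assume x: "x \<in> E - \<Union>\<S>"
      have "x \<in> (\<Union>i. f i ` T i) \<union> (\<Union>i. \<Union>n. f i ` (C i n - \<Union>(\<K> i n)))" if xA: "x \<in> (\<Union>i. f i ` A i)"
      proof -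
        obtain i v where v: "v \<in> A i" "x = f i v" using xA by blast
        show ?thesis
        proof (cases "v \<in> T i")
          case False
          then obtain n where n: "v \<in> C i n" using v(1) CT[of i] by blast
          have "v \<notin> \<Union>(\<K> i n)"
          proof
            assume "v \<in> \<Union>(\<K> i n)"
            then obtain K where K: "K \<in> \<K> i n" "v \<in> K" by blast
            from K(1) have "f i ` K \<in> \<S>" unfolding \<S>_def by blast
            then show False using x K(2) v(2) by blast
          qed
          then show ?thesis using n v(2) by blast
        qed (use v(2) in blast)
      qed
      then show "x \<in> (E - (\<Union>i. f i ` A i)) \<union> ((\<Union>i. f i ` T i) \<union> (\<Union>i. \<Union>n. f i ` (C i n - \<Union>(\<K> i n))))"
        using x by blast
    qed
    moreover have "?H (\<Union>i. f i ` T i) = 0"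
    proof (rule hausdorff_outer_null_UN)
      fix i
      have "hausdorff_outer cc_dist DIM(real^'k) (f i ` T i) = 0"
        using L CA by (intro hausdorff_outer_Lipschitz_negligible[OF T, where L = "L i"]) blast
      then show "?H (f i ` T i) = 0" by simp
    qed simp
    moreover have "?H (\<Union>i. \<Union>n. f i ` (C i n - \<Union>(\<K> i n))) = 0"
      using \<K>(3) by (intro hausdorff_outer_null_UN) auto
    ultimately show "?H (E - \<Union>\<S>) = 0"
      by (elim hausdorff_outer_null_subset) (intro hausdorff_outer_null_Un A(4))
    fix S assume "S \<in> \<S>"
    then obtain i n K where K: "K \<in> \<K> i n" "S = f i ` K" by (auto simp: \<S>_def)
    have KA: "K \<subseteq> A i" "compact K" using \<K>(2)[OF K(1)] CA by blast+
    show "S \<subseteq> E" using KA A(2) K(2) by blast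
    have bilip: "cc_dist p q \<le> (1 + \<eta>) * dist (heis_proj p) (heis_proj q)" if "p \<in> S" "q \<in> S" for p q
      using that \<K>(2)[OF K(1)] K(2) by blast
    have lipK: "cc_dist (f i u) (f i v) \<le> \<bar>L i\<bar> * dist u v" if "u \<in> K" "v \<in> K" for u v
      by (rule order_trans[OF L[of u i v]]) (use that KA in \<open>auto intro: mult_right_mono\<close>)
    have "\<bar>L i\<bar>-lipschitz_on K (\<lambda>v. heis_proj (f i v))"
      by (rule lipschitz_onI) (auto intro: order_trans[OF dist_heis_proj_le_cc_dist lipK])
    from compact_continuous_image[OF lipschitz_on_continuous_on[OF this] KA(2)]
    have "compact (heis_proj ` S)" by (simp add: K(2) image_image)
    then have image_borel: "heis_proj ` S \<in> sets borel" by (rule borel_compact)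
    have "openin cc.mtopology (- S)"
      unfolding cc.openin_mtopology
    proof (intro conjI allI impI)
      fix p assume p: "p \<in> - S"
      show "\<exists>r>0. cc.mball p r \<subseteq> - S"
      proof (cases "K = {}")
        case False
        have "\<bar>L i\<bar>-lipschitz_on K (\<lambda>v. cc_dist p (f i v))"
        proof (rule lipschitz_onI)
          fix v w assume vw: "v \<in> K" "w \<in> K"
          have "\<bar>cc_dist p (f i v) - cc_dist p (f i w)\<bar> \<le> cc_dist (f i v) (f i w)"
            using cc.triangle[of p "f i v" "f i w"] cc.triangle[of p "f i w" "f i v"] cc.commute[of "f i v" "f i w"]
            by simp
          then show "dist (cc_dist p (f i v)) (cc_dist p (f i w)) \<le> \<bar>L i\<bar> * dist v w"
            using lipK[OF vw] by (simp add: dist_real_def)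
        qed simp
        from continuous_attains_inf[OF KA(2) False lipschitz_on_continuous_on[OF this]]
        obtain v where v: "v \<in> K" "\<And>w. w \<in> K \<Longrightarrow> cc_dist p (f i v) \<le> cc_dist p (f i w)" by blast
        have "p \<noteq> f i v" using p v(1) K(2) by blast
        then have "cc_dist p (f i v) > 0" using cc.mdist_pos_eq by simp
        moreover have "cc.mball p (cc_dist p (f i v)) \<subseteq> - S"
          using v(2) K(2) by (force simp: cc.mball_def)
        ultimately show ?thesis by blast
      qed (use K(2) in \<open>auto intro: exI[of _ 1]\<close>)
    qed simp
    then have "- S \<in> sets (dist_borel cc_dist)" by (rule openin_dist_borel)
    then have "space (dist_borel cc_dist) - (- S) \<in> sets (dist_borel cc_dist)" by (rule sets.compl_sets)
    then have "S \<in> sets (dist_borel cc_dist)" by (simp add: Compl_eq_Diff_UNIV[symmetric])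
    then show "cc_bilipschitz_piece (1 + \<eta>) S"
      using bilip image_borel by (simp add: cc_bilipschitz_piece_def)
  qed
qed

section \<open>Integration over almost isometric pieces\<close>

lemma cc_bilipschitz_piece_inj:
  assumes "cc_bilipschitz_piece c S" shows "inj_on heis_proj S"
proof (rule inj_onI)
  fix p q assume pq: "p \<in> S" "q \<in> S" "heis_proj p = heis_proj q"
  have "cc_dist p q \<le> c * dist (heis_proj p) (heis_proj q)"
    using assms pq unfolding cc_bilipschitz_piece_def by blast
  then have "cc_dist p q \<le> 0" using pq(3) by simp
  then show "p = q"
    using Metric_space.zero[OF Metric_space_cc_dist, of p q] cc_dist_nonneg[of p q] by simp
qed

text \<open>
  The inverse of the projection is Lipschitz on the image of a piece.
\<close>

lemma measurable_inverse_of_piece: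
  assumes S: "cc_bilipschitz_piece c S" and "c > 0"
  shows "the_inv_into S heis_proj \<in> measurable (restrict_space borel (heis_proj ` S)) (dist_borel cc_dist)"
  unfolding dist_borel_def
proof (rule measurable_measure_of)
  interpret cc: Metric_space "UNIV :: 'a heis set" cc_dist by (rule Metric_space_cc_dist)
  let ?h = "the_inv_into S heis_proj" and ?T = "heis_proj ` S"
  note h = the_inv_into_f_f[OF cc_bilipschitz_piece_inj[OF S]]
  fix U :: "'a heis set" assume "U \<in> {U. openin cc.mtopology U}"
  then have U: "\<And>p. p \<in> U \<Longrightarrow> \<exists>r>0. cc.mball p r \<subseteq> U"
    by (auto simp: cc.openin_mtopology)
  then obtain r where r: "\<And>p. p \<in> U \<Longrightarrow> r p > 0" "\<And>p. p \<in> U \<Longrightarrow> cc.mball p (r p) \<subseteq> U" by metis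
  define V where "V = (\<Union>p\<in>U \<inter> S. ball (heis_proj p) (r p / c))"
  have "?h -` U \<inter> ?T = ?T \<inter> V"
  proof (intro equalityI subsetI)
    fix y assume "y \<in> ?h -` U \<inter> ?T"
    then obtain p where p: "p \<in> S" "y = heis_proj p" "?h y \<in> U" by blast
    then have "p \<in> U" using h[OF p(1)] by simp
    then have "y \<in> ball (heis_proj p) (r p / c)" using r(1) \<open>c > 0\<close> p(2) by simp
    then show "y \<in> ?T \<inter> V" unfolding V_def using p \<open>p \<in> U\<close> by blast
  next
    fix y assume "y \<in> ?T \<inter> V"
    then obtain p q where q: "q \<in> S" "y = heis_proj q" and p: "p \<in> U" "p \<in> S" "y \<in> ball (heis_proj p) (r p / c)"
      unfolding V_def by blast
    have pq: "dist (heis_proj p) (heis_proj q) < r p / c" using p(3) q(2) by simp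
    have "cc_dist p q \<le> c * dist (heis_proj p) (heis_proj q)"
      using S p(2) q(1) unfolding cc_bilipschitz_piece_def by blast
    also have "\<dots> < r p" using pq \<open>c > 0\<close> by (simp add: pos_less_divide_eq mult.commute)
    finally have "q \<in> cc.mball p (r p)" by simp
    then have "q \<in> U" using r(2)[OF p(1)] by blast
    then show "y \<in> ?h -` U \<inter> ?T" using h[OF q(1)] q by simp
  qed
  moreover have "open V" unfolding V_def by auto
  ultimately show "?h -` U \<inter> space (restrict_space borel ?T) \<in> sets (restrict_space borel ?T)"
    by (auto simp: sets_restrict_space space_restrict_space)
qed auto

lemma borel_subset_hausdorff_measure:
  "sets (borel :: 'a::metric_space measure) \<subseteq> sets (hausdorff_measure dist k)"
  using dist_borel_subset_hausdorff_measure[OF Met_TC.Metric_space_axioms, of k]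
  by (simp add: dist_borel_dist)

lemma piece_image_measurable:
  assumes S: "cc_bilipschitz_piece c S" and "c > 0" and B: "B \<in> sets (dist_borel cc_dist)"
  shows "heis_proj ` (B \<inter> S) \<in> sets borel"
proof -
  have T: "heis_proj ` S \<in> sets borel" using S by (simp add: cc_bilipschitz_piece_def)
  have "the_inv_into S heis_proj -` B \<inter> heis_proj ` S = heis_proj ` (B \<inter> S)"
    using the_inv_into_f_f[OF cc_bilipschitz_piece_inj[OF S]] by auto
  moreover have "the_inv_into S heis_proj -` B \<inter> space (restrict_space borel (heis_proj ` S))
      \<in> sets (restrict_space borel (heis_proj ` S))"
    by (rule measurable_sets[OF measurable_inverse_of_piece[OF S \<open>c > 0\<close>] B])
  ultimately have "heis_proj ` (B \<inter> S) \<in> sets (restrict_space borel (heis_proj ` S))"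
    by (simp add: space_restrict_space)
  then show ?thesis using T by (auto simp: sets_restrict_space)
qed

lemma cc_bilipschitz_piece_subset:
  assumes S: "cc_bilipschitz_piece c S" and "c > 0" and "B \<in> sets (dist_borel cc_dist)"
  shows "cc_bilipschitz_piece c (S \<inter> B)"
  using S piece_image_measurable[OF assms] assms(3) by (auto simp: cc_bilipschitz_piece_def Int_commute)

text \<open>
  The projection does not increase distances.
\<close>

lemma hausdorff_outer_heis_proj_le:
  "hausdorff_outer dist k (heis_proj ` S) \<le> hausdorff_outer cc_dist k S"
proof -
  have "hausdorff_outer dist k (heis_proj ` S) \<le> ennreal (1 ^ k) * hausdorff_outer cc_dist k S"
    by (rule hausdorff_outer_Lipschitz_image) (simp_all add: dist_heis_proj_le_cc_dist)
  then show ?thesis by simp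
qed

lemma piece_hausdorff_bounds:
  assumes S: "cc_bilipschitz_piece c S" and "c > 0"
  shows "hausdorff_outer dist k (heis_proj ` S) \<le> hausdorff_outer cc_dist k S"
    "hausdorff_outer cc_dist k S \<le> ennreal (c ^ k) * hausdorff_outer dist k (heis_proj ` S)"
proof -
  show "hausdorff_outer dist k (heis_proj ` S) \<le> hausdorff_outer cc_dist k S"
    by (rule hausdorff_outer_heis_proj_le)
  let ?h = "the_inv_into S heis_proj"
  note h = the_inv_into_f_f[OF cc_bilipschitz_piece_inj[OF S]]
  have "hausdorff_outer cc_dist k (?h ` heis_proj ` S) \<le> ennreal (c ^ k) * hausdorff_outer dist k (heis_proj ` S)"
  proof (rule hausdorff_outer_Lipschitz_image[OF \<open>c > 0\<close>])
    fix y z assume "y \<in> heis_proj ` S" "z \<in> heis_proj ` S"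
    then obtain p q where "p \<in> S" "q \<in> S" "y = heis_proj p" "z = heis_proj q" by blast
    then show "cc_dist (?h y) (?h z) \<le> c * dist y z"
      using S h unfolding cc_bilipschitz_piece_def by simp
  qed
  moreover have "?h ` heis_proj ` S = S" using h by (simp add: image_image)
  ultimately show "hausdorff_outer cc_dist k S \<le> ennreal (c ^ k) * hausdorff_outer dist k (heis_proj ` S)" by simp
qed

lemma fibre_of_piece:
  assumes S: "cc_bilipschitz_piece c S"
  shows "(\<Sum>\<^sub>\<infinity>x\<in>heis_proj -` {y} \<inter> S. g x :: ennreal) =
    g (the_inv_into S heis_proj y) * indicator (heis_proj ` S) y"
proof (cases "y \<in> heis_proj ` S")
  case True
  then obtain p where p: "p \<in> S" "y = heis_proj p" by blast
  have "heis_proj -` {y} \<inter> S = {p}"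
    using p cc_bilipschitz_piece_inj[OF S] by (auto simp: inj_on_def)
  moreover have "the_inv_into S heis_proj y = p"
    using p the_inv_into_f_f[OF cc_bilipschitz_piece_inj[OF S]] by simp
  ultimately show ?thesis using True by simp
next
  case False
  then have "heis_proj -` {y} \<inter> S = {}" by blast
  then show ?thesis using False by simp
qed

text \<open>
  Both integrals are integrals of \<open>g\<close> over \<open>S\<close>, one with respect to the measure
  \<open>B \<mapsto> \<H>\<^sub>c\<^sub>c (S \<inter> B)\<close> and the other with respect to \<open>B \<mapsto> \<H> (\<pi> (S \<inter> B))\<close>. By
  \<open>piece_hausdorff_bounds\<close> these measures bound each other up to the factor \<open>c ^ k\<close>.
\<close>

lemma piece_integral_bounds:
  fixes g :: "'n::finite heis \<Rightarrow> ennreal"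
  assumes S: "cc_bilipschitz_piece c S" and "c > 0" and g: "g \<in> borel_measurable (dist_borel cc_dist)"
  defines "G \<equiv> \<lambda>y. \<Sum>\<^sub>\<infinity>x\<in>heis_proj -` {y} \<inter> S. g x"
  shows "G \<in> borel_measurable (hausdorff_measure dist k)"
    "(\<integral>\<^sup>+y. G y \<partial>hausdorff_measure dist k) \<le> (\<integral>\<^sup>+x\<in>S. g x \<partial>hausdorff_measure cc_dist k)"
    "(\<integral>\<^sup>+x\<in>S. g x \<partial>hausdorff_measure cc_dist k) \<le> ennreal (c ^ k) * (\<integral>\<^sup>+y. G y \<partial>hausdorff_measure dist k)"
proof -
  let ?\<mu> = "hausdorff_measure cc_dist k :: 'n heis measure"
  let ?\<nu> = "hausdorff_measure dist k :: ((real^'n) \<times> (real^'n)) measure"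
  let ?h = "the_inv_into S heis_proj" and ?T = "heis_proj ` S"
  have \<mu>: "sets (dist_borel cc_dist) \<subseteq> sets ?\<mu>"
    by (rule dist_borel_subset_hausdorff_measure[OF Metric_space_cc_dist])
  have \<nu>: "sets borel \<subseteq> sets ?\<nu>" by (rule borel_subset_hausdorff_measure)
  have S_sets: "S \<in> sets (dist_borel cc_dist)" "?T \<in> sets borel" using S by (auto simp: cc_bilipschitz_piece_def)
  have h: "?h \<in> measurable (restrict_space ?\<nu> ?T) (dist_borel cc_dist)"
    by (rule measurable_mono[OF order_refl refl _ _, THEN subsetD, OF _ _ measurable_inverse_of_piece[OF S \<open>c > 0\<close>]])
       (use \<nu> in \<open>auto simp: sets_restrict_space space_restrict_space\<close>)
  have id: "(\<lambda>x. x) \<in> measurable (restrict_space ?\<mu> S) (dist_borel cc_dist)"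
    by (rule measurable_restrict_space1, rule measurableI) (use \<mu> in auto)
  define N1 where "N1 = distr (restrict_space ?\<nu> ?T) (dist_borel cc_dist) ?h"
  define N2 where "N2 = distr (restrict_space ?\<mu> S) (dist_borel cc_dist) (\<lambda>x. x)"
  have sets12: "sets N1 = sets (dist_borel cc_dist)" "sets N2 = sets (dist_borel cc_dist)"
    by (auto simp: N1_def N2_def)
  have G_eq: "G = (\<lambda>y. g (?h y) * indicator ?T y)"
    unfolding G_def by (intro ext fibre_of_piece[OF S])
  have gh: "(\<lambda>y. g (?h y)) \<in> borel_measurable (restrict_space ?\<nu> ?T)"
    by (rule measurable_compose[OF h g])
  then show "G \<in> borel_measurable ?\<nu>"
    unfolding G_eq using S_sets \<nu> by (subst (asm) borel_measurable_restrict_space_iff_ennreal) auto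
  have int1: "(\<integral>\<^sup>+y. G y \<partial>?\<nu>) = (\<integral>\<^sup>+x. g x \<partial>N1)"
  proof -
    have "(\<integral>\<^sup>+x. g x \<partial>N1) = (\<integral>\<^sup>+y. g (?h y) \<partial>restrict_space ?\<nu> ?T)"
      unfolding N1_def by (rule nn_integral_distr[OF h]) (use g in simp)
    also have "\<dots> = (\<integral>\<^sup>+y. G y \<partial>?\<nu>)"
      unfolding G_eq using S_sets \<nu> by (subst nn_integral_restrict_space) auto
    finally show ?thesis by simp
  qed
  have int2: "(\<integral>\<^sup>+x\<in>S. g x \<partial>?\<mu>) = (\<integral>\<^sup>+x. g x \<partial>N2)"
  proof -
    have "(\<integral>\<^sup>+x. g x \<partial>N2) = (\<integral>\<^sup>+x. g x \<partial>restrict_space ?\<mu> S)"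
      unfolding N2_def by (rule nn_integral_distr[OF id]) (use g in simp)
    also have "\<dots> = (\<integral>\<^sup>+x\<in>S. g x \<partial>?\<mu>)"
      using S_sets \<mu> by (subst nn_integral_restrict_space) auto
    finally show ?thesis by simp
  qed
  have em1: "emeasure N1 B = hausdorff_outer dist k (heis_proj ` (S \<inter> B))"
    if B: "B \<in> sets (dist_borel cc_dist)" for B
  proof -
    have "?h -` B \<inter> ?T = heis_proj ` (S \<inter> B)"
      using the_inv_into_f_f[OF cc_bilipschitz_piece_inj[OF S]] by auto
    moreover have "heis_proj ` (S \<inter> B) \<in> sets ?\<nu>"
      using piece_image_measurable[OF S \<open>c > 0\<close> B] \<nu> by (auto simp: Int_commute)
    ultimately show ?thesis
      using S_sets \<nu> unfolding N1_def emeasure_distr[OF h B]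
      by (subst emeasure_restrict_space) (auto simp: space_restrict_space emeasure_hausdorff_measure)
  qed
  have em2: "emeasure N2 B = hausdorff_outer cc_dist k (S \<inter> B)"
    if B: "B \<in> sets (dist_borel cc_dist)" for B
  proof -
    have "S \<inter> B \<in> sets ?\<mu>" using S_sets B \<mu> by auto
    then show ?thesis
      using S_sets \<mu> unfolding N2_def emeasure_distr[OF id B]
      by (subst emeasure_restrict_space) (auto simp: space_restrict_space emeasure_hausdorff_measure Int_commute)
  qed
  note bounds = piece_hausdorff_bounds[OF cc_bilipschitz_piece_subset[OF S \<open>c > 0\<close>] \<open>c > 0\<close>]
  have "N1 \<le> N2"
    unfolding le_measure[OF sets12(1)[folded sets12(2)]]
    by (auto simp: le_fun_def em1 em2 bounds sets12)
  then show "(\<integral>\<^sup>+y. G y \<partial>?\<nu>) \<le> (\<integral>\<^sup>+x\<in>S. g x \<partial>?\<mu>)"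
    unfolding int1 int2 by (rule nn_integral_mono_measure[rotated]) (simp add: sets12)
  have "N2 \<le> scale_measure (ennreal (c ^ k)) N1"
    by (subst le_measure) (auto simp: le_fun_def em1 em2 bounds sets12)
  then have "(\<integral>\<^sup>+x. g x \<partial>N2) \<le> (\<integral>\<^sup>+x. g x \<partial>scale_measure (ennreal (c ^ k)) N1)"
    by (rule nn_integral_mono_measure[rotated]) (simp add: sets12)
  also have "\<dots> = ennreal (c ^ k) * (\<integral>\<^sup>+x. g x \<partial>N1)"
    using g by (intro nn_integral_scale_measure) (simp add: measurable_cong_sets[OF sets12(1) refl])
  finally show "(\<integral>\<^sup>+x\<in>S. g x \<partial>?\<mu>) \<le> ennreal (c ^ k) * (\<integral>\<^sup>+y. G y \<partial>?\<nu>)"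
    unfolding int1 int2 .
qed

lemma infsum_ennreal_nat:
  fixes f :: "nat \<Rightarrow> ennreal"
  shows "(\<Sum>\<^sub>\<infinity>n\<in>UNIV. f n) = (\<Sum>n. f n)"
proof -
  have "(f has_sum (\<Sum>\<^sub>\<infinity>n\<in>UNIV. f n)) UNIV" by (rule has_sum_infsum[OF nonneg_summable_on_complete]) simp
  then have "f sums (\<Sum>\<^sub>\<infinity>n\<in>UNIV. f n)" by (rule has_sum_imp_sums)
  then show ?thesis by (rule sums_unique)
qed

text \<open>
  Each piece contributes at most one point to the fibre, so the sum over the fibre becomes a sum over
  the pieces.
\<close>

lemma fibre_of_disjoint_pieces:
  fixes S :: "nat \<Rightarrow> 'n::finite heis set"
  assumes S: "\<And>n. cc_bilipschitz_piece c (S n)" and disj: "disjoint_family S"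
  shows "(\<Sum>\<^sub>\<infinity>x\<in>heis_proj -` {y} \<inter> (\<Union>n. S n). g x :: ennreal) = (\<Sum>n. \<Sum>\<^sub>\<infinity>x\<in>heis_proj -` {y} \<inter> S n. g x)"
proof -
  define J where "J = {n. y \<in> heis_proj ` S n}"
  define x where "x n = the_inv_into (S n) heis_proj y" for n
  have x: "x n \<in> S n" "heis_proj (x n) = y" if "n \<in> J" for n
  proof -
    from that obtain p where p: "p \<in> S n" "y = heis_proj p" by (auto simp only: J_def mem_Collect_eq image_iff)
    then have "x n = p" using the_inv_into_f_f[OF cc_bilipschitz_piece_inj[OF S]] by (simp add: x_def)
    then show "x n \<in> S n" "heis_proj (x n) = y" using p by simp_all
  qed
  have x_unique: "p = x n" if "p \<in> S n" "heis_proj p = y" for p n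
    using the_inv_into_f_f[OF cc_bilipschitz_piece_inj[OF S] that(1)] that(2) by (simp add: x_def)
  have inj: "inj_on x J"
  proof (rule inj_onI)
    fix m n assume mn: "m \<in> J" "n \<in> J" "x m = x n"
    then have "x m \<in> S m \<inter> S n" using x(1)[of m] x(1)[of n] by simp
    then show "m = n" using disj by (auto simp: disjoint_family_on_def)
  qed
  have "heis_proj -` {y} \<inter> (\<Union>n. S n) = x ` J"
  proof (intro equalityI subsetI)
    fix p assume "p \<in> heis_proj -` {y} \<inter> (\<Union>n. S n)"
    then obtain n where n: "p \<in> S n" "heis_proj p = y" by blast
    then have "n \<in> J" "p = x n" using x_unique[OF n] by (simp_all add: J_def image_iff) blast
    then show "p \<in> x ` J" by blast
  next
    fix p assume "p \<in> x ` J"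
    then show "p \<in> heis_proj -` {y} \<inter> (\<Union>n. S n)" using x by blast
  qed
  then have "(\<Sum>\<^sub>\<infinity>p\<in>heis_proj -` {y} \<inter> (\<Union>n. S n). g p) = (\<Sum>\<^sub>\<infinity>n\<in>J. g (x n))"
    by (simp add: infsum_reindex[OF inj] o_def)
  also have "\<dots> = (\<Sum>\<^sub>\<infinity>n\<in>UNIV. g (x n) * indicator (heis_proj ` S n) y)"
    by (rule infsum_cong_neutral) (auto simp: J_def)
  also have "\<dots> = (\<Sum>n. g (x n) * indicator (heis_proj ` S n) y)"
    by (rule infsum_ennreal_nat)
  also have "\<dots> = (\<Sum>n. \<Sum>\<^sub>\<infinity>p\<in>heis_proj -` {y} \<inter> S n. g p)"
    by (simp add: fibre_of_piece[OF S] x_def)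
  finally show ?thesis .
qed

text \<open>
  Make the pieces disjoint and add up \<open>piece_integral_bounds\<close>. Values of \<open>g\<close> on the null set left
  out by the pieces do not matter on the left, and on the right its projection is a null set as well.
\<close>

lemma integral_bounds_of_decomposition:
  fixes E :: "'n::finite heis set" and g :: "'n heis \<Rightarrow> ennreal"
  assumes g: "g \<in> borel_measurable (restrict_space (dist_borel cc_dist) E)" and "c > 0"
    and \<S>: "countable \<S>" "\<forall>S\<in>\<S>. S \<subseteq> E \<and> cc_bilipschitz_piece c S"
    and null: "hausdorff_outer cc_dist k (E - \<Union>\<S>) = 0"
  defines "I \<equiv> (\<integral>\<^sup>+x\<in>E. g x \<partial>hausdorff_measure cc_dist k)"
    and "J \<equiv> (\<integral>\<^sup>+y\<in>heis_proj ` E. (\<Sum>\<^sub>\<infinity>x\<in>heis_proj -` {y} \<inter> E. g x) \<partial>hausdorff_measure dist k)"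
  shows "J \<le> I" "I \<le> ennreal (c ^ k) * J"
proof -
  let ?\<mu> = "hausdorff_measure cc_dist k :: 'n heis measure"
  let ?\<nu> = "hausdorff_measure dist k :: ((real^'n) \<times> (real^'n)) measure"
  have \<mu>: "sets (dist_borel cc_dist) \<subseteq> sets ?\<mu>"
    by (rule dist_borel_subset_hausdorff_measure[OF Metric_space_cc_dist])
  \<comment> \<open>The empty piece is added because an enumeration needs a nonempty set.\<close>
  define P where "P = from_nat_into (insert {} \<S>)"
  have P_range: "range P = insert {} \<S>"
    unfolding P_def using \<S>(1) by (intro range_from_nat_into) auto
  have piece_empty: "cc_bilipschitz_piece c {}" by (simp add: cc_bilipschitz_piece_def)
  have P: "cc_bilipschitz_piece c (P n)" "P n \<subseteq> E" for n
  proof -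
    have "P n \<in> insert {} \<S>" using P_range by blast
    then show "cc_bilipschitz_piece c (P n)" "P n \<subseteq> E" using \<S>(2) piece_empty by auto
  qed
  define D where "D = disjointed P"
  define Z where "Z = E - \<Union>\<S>"
  define S0 where "S0 = (\<Union>n. D n)"
  have P_sets: "P n \<in> sets (dist_borel cc_dist)" for n using P(1) by (simp add: cc_bilipschitz_piece_def)
  have D: "cc_bilipschitz_piece c (D n)" for n
  proof -
    have "cc_bilipschitz_piece c (P n \<inter> (P n - (\<Union>i\<in>{0..<n}. P i)))"
      using P_sets by (intro cc_bilipschitz_piece_subset P \<open>c > 0\<close> sets.Diff sets.finite_UN) auto
    also have "P n \<inter> (P n - (\<Union>i\<in>{0..<n}. P i)) = D n" by (auto simp: D_def disjointed_def)
    finally show ?thesis .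
  qed
  have D_sets: "D n \<in> sets (dist_borel cc_dist)" for n using D by (simp add: cc_bilipschitz_piece_def)
  have disj: "disjoint_family D" unfolding D_def by (rule disjoint_family_disjointed)
  have S0: "S0 = \<Union>\<S>"
    unfolding S0_def D_def UN_disjointed_eq using P_range by auto
  have S0_sets: "S0 \<in> sets (dist_borel cc_dist)" unfolding S0_def using D_sets by auto
  have S0_E: "S0 \<subseteq> E" "E = S0 \<union> Z" "S0 \<inter> Z = {}" using \<S>(2) by (auto simp: S0 Z_def)
  \<comment> \<open>\<open>g\<close> is measurable on \<open>E\<close> only; cut off to the Borel set \<open>S0\<close> it is measurable everywhere.\<close>
  define g0 where "g0 x = g x * indicator S0 x" for x
  have g0: "g0 \<in> borel_measurable (dist_borel cc_dist)"
  proof -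
    have "g \<in> borel_measurable (restrict_space (dist_borel cc_dist) S0)"
      by (rule measurable_restrict_mono[OF g S0_E(1)])
    then show ?thesis
      using S0_sets unfolding g0_def by (subst (asm) borel_measurable_restrict_space_iff_ennreal) auto
  qed
  define G where "G n y = (\<Sum>\<^sub>\<infinity>x\<in>heis_proj -` {y} \<inter> D n. g0 x)" for n y
  note B = piece_integral_bounds[OF D \<open>c > 0\<close> g0, where k = k, folded G_def]
  have Z: "Z \<in> null_sets ?\<mu>" using null unfolding Z_def by (rule hausdorff_outer_null_sets)
  have "hausdorff_outer dist k (heis_proj ` Z) \<le> hausdorff_outer cc_dist k Z"
    by (rule hausdorff_outer_heis_proj_le)
  then have pZ: "heis_proj ` Z \<in> null_sets ?\<nu>"
    using null by (intro hausdorff_outer_null_sets) (simp add: Z_def)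
  have I_eq: "I = (\<Sum>n. \<integral>\<^sup>+x\<in>D n. g0 x \<partial>?\<mu>)"
  proof -
    have "I = (\<integral>\<^sup>+x. (\<Sum>n. g0 x * indicator (D n) x) \<partial>?\<mu>)"
      unfolding I_def
    proof (rule nn_integral_cong_AE)
      show "AE x in ?\<mu>. g x * indicator E x = (\<Sum>n. g0 x * indicator (D n) x)"
        using AE_not_in[OF Z]
      proof eventually_elim
        fix x assume "x \<notin> Z"
        then have "indicator E x = (indicator S0 x :: ennreal)" using S0_E by (auto simp: indicator_def)
        moreover have "(\<Sum>n. g0 x * indicator (D n) x) = g0 x * (\<Sum>n. indicator (D n) x)"
          by (rule ennreal_suminf_cmult)
        moreover have "(\<Sum>n. indicator (D n) x) = (indicator S0 x :: ennreal)"
          unfolding S0_def by (rule suminf_indicator[OF disj])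
        ultimately show "g x * indicator E x = (\<Sum>n. g0 x * indicator (D n) x)"
          by (auto simp: g0_def indicator_def)
      qed
    qed
    also have "\<dots> = (\<Sum>n. \<integral>\<^sup>+x\<in>D n. g0 x \<partial>?\<mu>)"
    proof (rule nn_integral_suminf)
      fix n
      have "(\<lambda>x. g0 x * indicator (D n) x) \<in> borel_measurable (dist_borel cc_dist)"
        using g0 D_sets by auto
      then show "(\<lambda>x. g0 x * indicator (D n) x) \<in> borel_measurable ?\<mu>"
        using measurable_mono[OF order_refl refl \<mu>, of "borel :: ennreal measure"] by auto
    qed
    finally show ?thesis .
  qed
  have J_eq: "J = (\<Sum>n. \<integral>\<^sup>+y. G n y \<partial>?\<nu>)"
  proof -
    have "J = (\<integral>\<^sup>+y. (\<Sum>n. G n y) \<partial>?\<nu>)"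
      unfolding J_def
    proof (rule nn_integral_cong_AE)
      show "AE y in ?\<nu>. (\<Sum>\<^sub>\<infinity>x\<in>heis_proj -` {y} \<inter> E. g x) * indicator (heis_proj ` E) y = (\<Sum>n. G n y)"
        using AE_not_in[OF pZ]
      proof eventually_elim
        fix y assume y: "y \<notin> heis_proj ` Z"
        have "(\<Sum>\<^sub>\<infinity>x\<in>heis_proj -` {y} \<inter> E. g x) * indicator (heis_proj ` E) y = (\<Sum>\<^sub>\<infinity>x\<in>heis_proj -` {y} \<inter> E. g x)"
        proof (cases "y \<in> heis_proj ` E")
          case False
          then have "heis_proj -` {y} \<inter> E = {}" by blast
          then show ?thesis by simp
        qed simp
        also have "\<dots> = (\<Sum>\<^sub>\<infinity>x\<in>heis_proj -` {y} \<inter> S0. g0 x)"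
        proof -
          have "heis_proj -` {y} \<inter> E = heis_proj -` {y} \<inter> S0" using y S0_E by blast
          moreover have "(\<Sum>\<^sub>\<infinity>x\<in>heis_proj -` {y} \<inter> S0. g x) = (\<Sum>\<^sub>\<infinity>x\<in>heis_proj -` {y} \<inter> S0. g0 x)"
            by (rule infsum_cong) (simp add: g0_def)
          ultimately show ?thesis by simp
        qed
        also have "\<dots> = (\<Sum>n. G n y)"
          unfolding S0_def G_def by (rule fibre_of_disjoint_pieces[OF D disj])
        finally show "(\<Sum>\<^sub>\<infinity>x\<in>heis_proj -` {y} \<inter> E. g x) * indicator (heis_proj ` E) y = (\<Sum>n. G n y)" .
      qed
    qed
    also have "\<dots> = (\<Sum>n. \<integral>\<^sup>+y. G n y \<partial>?\<nu>)"
      by (rule nn_integral_suminf) (rule B(1))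
    finally show ?thesis .
  qed
  show "J \<le> I"
    unfolding I_eq J_eq by (intro suminf_le B(2)) auto
  have "I \<le> (\<Sum>n. ennreal (c ^ k) * (\<integral>\<^sup>+y. G n y \<partial>?\<nu>))"
    unfolding I_eq by (intro suminf_le B(3)) auto
  also have "\<dots> = ennreal (c ^ k) * J"
    unfolding J_eq by (rule ennreal_suminf_cmult)
  finally show "I \<le> ennreal (c ^ k) * J" .
qed

lemma ennreal_le_if_le_power_mult:
  fixes a b :: ennreal
  assumes "\<And>\<eta>. \<eta> > 0 \<Longrightarrow> a \<le> ennreal ((1 + \<eta>) ^ k) * b"
  shows "a \<le> b"
proof (cases "b = top")
  case False
  have "((\<lambda>\<eta>::real. ennreal ((1 + \<eta>) ^ k)) \<longlongrightarrow> ennreal ((1 + 0) ^ k)) (at_right 0)"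
    by (intro tendsto_intros)
  then have "((\<lambda>\<eta>::real. b * ennreal ((1 + \<eta>) ^ k)) \<longlongrightarrow> b * ennreal ((1 + 0) ^ k)) (at_right 0)"
    using False by (intro ennreal_tendsto_cmult) (auto simp: less_top)
  then have "((\<lambda>\<eta>::real. b * ennreal ((1 + \<eta>) ^ k)) \<longlongrightarrow> b) (at_right 0)" by simp
  then show ?thesis
  proof (rule tendsto_lowerbound)
    show "\<forall>\<^sub>F \<eta> in at_right 0. a \<le> b * ennreal ((1 + \<eta>) ^ k)"
      using eventually_at_right_less[of "0::real"] by eventually_elim (use assms in \<open>simp add: mult.commute\<close>)
  qed simp
qed simp

section \<open>The area formula\<close>

theorem theorem1p7:
  fixes E :: "'n::finite heis set" and g :: "'n heis \<Rightarrow> ennreal"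
  assumes "CARD('k::finite) \<le> CARD('n)"
    and "countably_rectifiable TYPE('k) cc_dist E"
    and "g \<in> borel_measurable (restrict_space (dist_borel cc_dist) E)"
  shows "(\<integral>\<^sup>+x\<in>E. g x \<partial>hausdorff_measure cc_dist CARD('k)) =
         (\<integral>\<^sup>+y\<in>heis_proj ` E. (\<Sum>\<^sub>\<infinity>x\<in>heis_proj -` {y} \<inter> E. g x) \<partial>hausdorff_measure dist CARD('k))"
    (is "?I = ?J")
proof -
  have bounds: "?J \<le> ?I \<and> ?I \<le> ennreal ((1 + \<eta>) ^ CARD('k)) * ?J" if "\<eta> > 0" for \<eta> :: real
  proof -
    obtain \<S> where \<S>: "countable \<S>" "\<forall>S\<in>\<S>. S \<subseteq> E \<and> cc_bilipschitz_piece (1 + \<eta>) S"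
      "hausdorff_outer cc_dist CARD('k) (E - \<Union>\<S>) = 0"
      using rectifiable_decomposition[OF assms(2) \<open>\<eta> > 0\<close>] by blast
    have "0 < 1 + \<eta>" using \<open>\<eta> > 0\<close> by simp
    note B = integral_bounds_of_decomposition[OF assms(3) \<open>0 < 1 + \<eta>\<close> \<S>]
    show ?thesis by (intro conjI B)
  qed
  have "?I \<le> ?J"
    by (rule ennreal_le_if_le_power_mult) (rule conjunct2[OF bounds])
  moreover have "?J \<le> ?I"
    by (rule conjunct1[OF bounds[of 1]]) simp
  ultimately show ?thesis by (rule antisym)
qed

end
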